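(* Let $\mathbb{H}=\{(z_1,z_2)\in\mathbb{C}^2:|z_1|<|z_2|<1\}$ be the Hartogs triangle, let $1\le p<\infty$, and let $\alpha=\alpha_1\,d\bar z_1+\alpha_2\,d\bar z_2$ be a $(0,1)$-form that is $\bar\partial$-closed in the weak sense on $\mathbb{H}$ and satisfies $$ \bar z_1\,\alpha_1+\bar z_2\,\alpha_2=0 . $$ Assume that $\alpha_1\in L^p(\mathbb{H})$. Let $\phi:\mathbb{H}\to\mathbb{D}\times\mathbb{D}^*$ be the biholomorphism $\phi(z_1,z_2)=(z_1/z_2,z_2)=(w_1,w_2)$, let $\tilde\alpha_j=\alpha_j\circ\phi^{-1}$ for $j=1,2$, and let $f=f_1\,d\bar w_1+f_2\,d\bar w_2$ be the form on $\mathbb{D}\times\mathbb{D}^*$ with $f_1=\bar w_2\,\tilde\alpha_1$ and $f_2=\bar w_1\,\tilde\alpha_1+\tilde\alpha_2$. Then $v=T(f)\circ\phi$, with $T$ the integral operator on $\mathbb{D}\times\mathbb{D}^*$ given in the context, is a weak solution of $\bar\partial v=\alpha$ on $\mathbb{H}$ satisfying the $L^p$ estimate $$ \|v\|_{L^p(\mathbb{H})}\le C\|\alpha_1\|_{L^p(\mathbb{H})} $$ for a constant $C>0$ independent of $\alpha$.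
   Context: $\mathbb{D}=\{z\in\mathbb{C}:|z|<1\}$, $\mathbb{D}^*=\{z\in\mathbb{C}:0<|z|<1\}$. Weakly $\bar\partial$-closed means $\frac{\partial\alpha_1}{\partial\bar z_2}=\frac{\partial\alpha_2}{\partial\bar z_1}$ as distributions, and a weak solution of $\bar\partial v=\alpha$ satisfies $\frac{\partial v}{\partial\bar z_j}=\alpha_j$ as distributions, $j=1,2$. The operator $T$ on $(0,1)$-forms $f=f_1\,d\bar w_1+f_2\,d\bar w_2$ on $\mathbb{D}\times\mathbb{D}^*$ is $$ \begin{aligned} T(f)(w_1,w_2) &=\frac{-1}{2 \pi i}\int_{\mathbb{D}^*}\frac{f_2(w_1,\zeta_2)}{\zeta_2-w_2}\,d\bar \zeta_2\wedge d\zeta_2+\frac{-1}{2 \pi i}\int_{\mathbb{D}}\frac{f_1(\zeta_1,w_2)}{\zeta_1-w_1}\,d\bar \zeta_1\wedge d\zeta_1\\ &\quad+\frac{-1}{(2 \pi i)^2}\int_{\mathbb{D}\times\mathbb{D}^*}\frac{(\mathscr{D}f)(\zeta_1,\zeta_2)}{(\zeta_1-w_1)(\zeta_2-w_2)}\,d\bar \zeta_1\wedge d\zeta_1\wedge d\bar \zeta_2\wedge d\zeta_2, \end{aligned} $$ where $\mathscr{D} f= \frac 12\left( \frac{\partial f_1}{\partial\bar w_2} + \frac{\partial f_2}{\partial\bar w_1}\right)$ in the distributional sense, and $d\bar\zeta\wedge d\zeta=2i\,dA(\zeta)$ in one complex variable. (For the forms in this statement $f_2=0$ and $\mathscr{D}f=0$,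 so only the second term of $T(f)$ is present.) *)

theory Defs
  imports "HOL-Analysis.Analysis"
begin

subsection \<open>Domains\<close>

definition punctured_disc :: "complex set" where
  "punctured_disc = {z. 0 < norm z \<and> norm z < 1}"

definition disc_prod :: "(complex \<times> complex) set" where
  "disc_prod = ball 0 1 \<times> punctured_disc"

definition hartogs :: "(complex \<times> complex) set" where
  "hartogs = {(z1, z2). norm z1 < norm z2 \<and> norm z2 < 1}"

definition hartogs_map :: "complex \<times> complex \<Rightarrow> complex \<times> complex" where
  "hartogs_map = (\<lambda>(z1, z2). (z1 / z2, z2))"

lemma inv_hartogs_map:
  assumes "w \<in> disc_prod"
  shows "inv_into hartogs hartogs_map w = (fst w * snd w, snd w)"
proof -
  have inj: "inj_on hartogs_map hartogs"
    by (auto simp: inj_on_def hartogs_map_def hartogs_def)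
  have "(fst w * snd w, snd w) \<in> hartogs"
    using assms by (auto simp: hartogs_def disc_prod_def punctured_disc_def norm_mult)
  moreover have "hartogs_map (fst w * snd w, snd w) = w"
    using assms by (auto simp: hartogs_map_def disc_prod_def punctured_disc_def)
  ultimately show ?thesis
    using inv_into_f_f[OF inj] by metis
qed

lemma bij_betw_hartogs_map: "bij_betw hartogs_map hartogs disc_prod"
proof (rule bij_betw_byWitness[where f' = "\<lambda>w. (fst w * snd w, snd w)"])
  show "hartogs_map ` hartogs \<subseteq> disc_prod"
  proof
    fix w assume "w \<in> hartogs_map ` hartogs"
    then obtain z1 z2 where z: "norm z1 < norm z2" "norm z2 < 1" "w = (z1 / z2, z2)"
      by (auto simp: hartogs_map_def hartogs_def)
    moreover have "0 < norm z2"
      using z(1) norm_ge_zero[of z1] by linarith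
    ultimately show "w \<in> disc_prod"
      by (simp add: disc_prod_def punctured_disc_def norm_divide)
  qed
qed (auto simp: hartogs_map_def hartogs_def disc_prod_def punctured_disc_def norm_mult)

subsection \<open>Test functions and distributions\<close>

text \<open>\<open>C\<^sup>k\<close> on the whole space, via directional derivatives; for finite-dimensional domains this is the
  usual notion.\<close>

fun cont_diff :: "nat \<Rightarrow> ('a::real_normed_vector \<Rightarrow> 'b::real_normed_vector) \<Rightarrow> bool" where
  "cont_diff 0 f \<longleftrightarrow> continuous_on UNIV f"
| "cont_diff (Suc k) f \<longleftrightarrow> (\<forall>x. f differentiable (at x)) \<and>
     (\<forall>v. cont_diff k (\<lambda>x. frechet_derivative f (at x) v))"

definition test_functions :: "(complex \<times> complex) set \<Rightarrow> (complex \<times> complex \<Rightarrow> complex) set" where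
  "test_functions \<Omega> = {\<psi>. (\<forall>k. cont_diff k \<psi>) \<and>
     compact (closure {z. \<psi> z \<noteq> 0}) \<and> closure {z. \<psi> z \<noteq> 0} \<subseteq> \<Omega>}"

text \<open>Distributions on an open set \<open>\<Omega>\<close> are represented by functionals whose values matter only on
  \<open>test_functions \<Omega>\<close>. All those used below come from locally integrable functions by
  differentiation and linear combination, so linearity and continuity are automatic.\<close>

type_synonym distr = "(complex \<times> complex \<Rightarrow> complex) \<Rightarrow> complex"

definition loc_integrable :: "(complex \<times> complex) set \<Rightarrow> (complex \<times> complex \<Rightarrow> complex) \<Rightarrow> bool" where
  "loc_integrable \<Omega> u \<longleftrightarrow> (\<forall>K. compact K \<and> K \<subseteq> \<Omega> \<longrightarrow> set_integrable lebesgue K u)"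

definition regular_distr :: "(complex \<times> complex) set \<Rightarrow> (complex \<times> complex \<Rightarrow> complex) \<Rightarrow> distr" where
  "regular_distr \<Omega> u = (\<lambda>\<psi>. LINT z:\<Omega>|lebesgue. u z * \<psi> z)"

definition distr_eq :: "(complex \<times> complex) set \<Rightarrow> distr \<Rightarrow> distr \<Rightarrow> bool" where
  "distr_eq \<Omega> \<Lambda> \<Lambda>' \<longleftrightarrow> (\<forall>\<psi> \<in> test_functions \<Omega>. \<Lambda> \<psi> = \<Lambda>' \<psi>)"

text \<open>\<open>\<partial>/\<partial>z\<bar> = (\<partial>/\<partial>x + i \<partial>/\<partial>y)/2\<close>\<close>

definition wirtinger_bar :: "(complex \<Rightarrow> complex) \<Rightarrow> complex \<Rightarrow> complex" where
  "wirtinger_bar g z = (frechet_derivative g (at z) 1 + \<i> * frechet_derivative g (at z) \<i>) / 2"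

definition dbar1 :: "(complex \<times> complex \<Rightarrow> complex) \<Rightarrow> complex \<times> complex \<Rightarrow> complex" where
  "dbar1 \<psi> = (\<lambda>(z1, z2). wirtinger_bar (\<lambda>z. \<psi> (z, z2)) z1)"

definition dbar2 :: "(complex \<times> complex \<Rightarrow> complex) \<Rightarrow> complex \<times> complex \<Rightarrow> complex" where
  "dbar2 \<psi> = (\<lambda>(z1, z2). wirtinger_bar (\<lambda>z. \<psi> (z1, z)) z2)"

definition distr_dbar1 :: "distr \<Rightarrow> distr" where
  "distr_dbar1 \<Lambda> = (\<lambda>\<psi>. - \<Lambda> (dbar1 \<psi>))"

definition distr_dbar2 :: "distr \<Rightarrow> distr" where
  "distr_dbar2 \<Lambda> = (\<lambda>\<psi>. - \<Lambda> (dbar2 \<psi>))"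

subsection \<open>The \<open>\<partial>\<bar>\<close>-equation and \<open>L\<^sup>p\<close>\<close>

text \<open>A \<open>(0,1)\<close>-form is given by its two coefficient functions. Local integrability is what makes
  a function a distribution; without it the integrals in \<^const>\<open>regular_distr\<close> could
  be 0 by convention.\<close>

definition weakly_dbar_closed ::
  "(complex \<times> complex) set \<Rightarrow> (complex \<times> complex \<Rightarrow> complex) \<Rightarrow> (complex \<times> complex \<Rightarrow> complex) \<Rightarrow> bool" where
  "weakly_dbar_closed \<Omega> \<alpha>1 \<alpha>2 \<longleftrightarrow> loc_integrable \<Omega> \<alpha>1 \<and> loc_integrable \<Omega> \<alpha>2 \<and>
     distr_eq \<Omega> (distr_dbar2 (regular_distr \<Omega> \<alpha>1)) (distr_dbar1 (regular_distr \<Omega> \<alpha>2))"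

definition weak_dbar_solution ::
  "(complex \<times> complex) set \<Rightarrow> (complex \<times> complex \<Rightarrow> complex) \<Rightarrow>
   (complex \<times> complex \<Rightarrow> complex) \<Rightarrow> (complex \<times> complex \<Rightarrow> complex) \<Rightarrow> bool" where
  "weak_dbar_solution \<Omega> v \<alpha>1 \<alpha>2 \<longleftrightarrow> loc_integrable \<Omega> v \<and>
     loc_integrable \<Omega> \<alpha>1 \<and> loc_integrable \<Omega> \<alpha>2 \<and>
     distr_eq \<Omega> (distr_dbar1 (regular_distr \<Omega> v)) (regular_distr \<Omega> \<alpha>1) \<and>
     distr_eq \<Omega> (distr_dbar2 (regular_distr \<Omega> v)) (regular_distr \<Omega> \<alpha>2)"

definition in_Lp :: "real \<Rightarrow> (complex \<times> complex) set \<Rightarrow> (complex \<times> complex \<Rightarrow> complex) \<Rightarrow> bool" where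
  "in_Lp p \<Omega> u \<longleftrightarrow> u \<in> borel_measurable (lebesgue_on \<Omega>) \<and>
     integrable (lebesgue_on \<Omega>) (\<lambda>z. norm (u z) powr p)"

definition Lp_norm :: "real \<Rightarrow> (complex \<times> complex) set \<Rightarrow> (complex \<times> complex \<Rightarrow> complex) \<Rightarrow> real" where
  "Lp_norm p \<Omega> u = (LINT z|lebesgue_on \<Omega>. norm (u z) powr p) powr (1 / p)"

subsection \<open>The operator on \<^const>\<open>disc_prod\<close>\<close>

text \<open>A locally integrable representative of the distribution
  \<open>(\<partial>f1/\<partial>w2\<bar> + \<partial>f2/\<partial>w1\<bar>)/2\<close> on \<^const>\<open>disc_prod\<close>, provided there is one. It is unique up to a null set,
  so the integral in \<open>T_op\<close> does not depend on the choice.\<close>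

definition sym_dbar ::
  "(complex \<times> complex \<Rightarrow> complex) \<Rightarrow> (complex \<times> complex \<Rightarrow> complex) \<Rightarrow> complex \<times> complex \<Rightarrow> complex" where
  "sym_dbar f1 f2 = (SOME g. loc_integrable disc_prod g \<and>
     distr_eq disc_prod (regular_distr disc_prod g)
       (\<lambda>\<psi>. 1 / 2 * (distr_dbar2 (regular_distr disc_prod f1) \<psi> + distr_dbar1 (regular_distr disc_prod f2) \<psi>)))"

text \<open>Each area form \<open>d\<zeta>\<bar> \<and> d\<zeta>\<close> is \<open>2i\<close> times Lebesgue measure.\<close>

definition T_op ::
  "(complex \<times> complex \<Rightarrow> complex) \<Rightarrow> (complex \<times> complex \<Rightarrow> complex) \<Rightarrow> complex \<times> complex \<Rightarrow> complex" where
  "T_op f1 f2 = (\<lambda>(w1, w2).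
     - 1 / (2 * pi * \<i>) * (LINT \<zeta>2:punctured_disc|lebesgue. f2 (w1, \<zeta>2) / (\<zeta>2 - w2) * (2 * \<i>))
     + - 1 / (2 * pi * \<i>) * (LINT \<zeta>1:ball 0 1|lebesgue. f1 (\<zeta>1, w2) / (\<zeta>1 - w1) * (2 * \<i>))
     + - 1 / (2 * pi * \<i>)\<^sup>2 * (LINT \<zeta>:disc_prod|lebesgue.
          sym_dbar f1 f2 \<zeta> / ((fst \<zeta> - w1) * (snd \<zeta> - w2)) * (2 * \<i>)\<^sup>2))"

end

theory Submission
  imports Defs "HOL-Computational_Algebra.Polynomial" "HOL-Real_Asymp.Real_Asymp"
begin

text \<open>
  In the coordinates \<open>w = (z\<^sub>1/z\<^sub>2, z\<^sub>2)\<close> the relation between \<open>\<alpha>\<^sub>1\<close> and \<open>\<alpha>\<^sub>2\<close> says \<open>f\<^sub>2 = 0\<close>, and weak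
  closedness becomes \<open>\<partial>f\<^sub>1/\<partial>w\<bar>\<^sub>2 = 0\<close>. So \<open>T(f)\<close> is the Cauchy transform of \<open>f\<^sub>1\<close> on the discs
  \<open>w\<^sub>2 = const\<close>. By Cauchy-Pompeiu its \<open>\<partial>/\<partial>w\<bar>\<^sub>1\<close> is \<open>f\<^sub>1\<close>. Its \<open>\<partial>/\<partial>w\<bar>\<^sub>2\<close> vanishes because
  testing closedness with products \<open>\<chi>(\<zeta>) \<psi>(w\<^sub>1, w\<^sub>2)\<close>, where \<open>w\<^sub>1\<close> is a mere parameter, gives
  \<open>\<integral> f\<^sub>1(\<zeta>, w\<^sub>2) \<partial>\<psi>/\<partial>w\<bar>\<^sub>2(w\<^sub>1, w\<^sub>2) dA(w\<^sub>2) = 0\<close> for almost every \<open>\<zeta>\<close>, and this survives integration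
  against \<open>1/(\<zeta> - w\<^sub>1)\<close>. The estimate is Jensen's inequality on each disc, applied to the measure
  \<open>dA(\<zeta>)/\<bar>\<zeta> - w\<^sub>1\<bar>\<close>: the Jacobian \<open>\<bar>w\<^sub>2\<bar>\<^sup>2\<close> is constant there.
\<close>

text \<open>The Jacobian of the change of variables is |w2|^2 = w2 cnj w2, while f1 carries only the
  factor cnj w2. Hence f1 times w2 is integrable on the product domain, but f1 itself may fail to be
  integrable near w2 = 0. Test functions stay away from w2 = 0, so every Fubini argument runs with
  f1 cut off to |w2| >= \<delta>. The kernel 1/(\<zeta> - w1) is singular and cannot be put into the
  weak closedness directly; this is why closedness is first turned into a statement about almost
  every \<zeta>. The coefficient \<alpha>1 is only Lebesgue measurable and its relation to \<alpha>2
  holds almost everywhere. Fubini and the substitution are carried out for a Borel representative,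
  and T(f) for the given form is compared with the result at the end, again almost everywhere. The
  constant is \<open>kernel_mass + 1\<close>, a bound for the integral of dA(\<zeta>)/|\<zeta> - w1|
  over the disc that is uniform in w1 and the same for all p.\<close>

section \<open>Functions with continuous iterated directional derivatives on an open set\<close>

text \<open>Compared with \<^const>\<open>cont_diff\<close>, the local version allows gluing and quotients.\<close>

fun cont_diff_on :: "nat \<Rightarrow> 'a::real_normed_vector set \<Rightarrow> ('a \<Rightarrow> 'b::real_normed_vector) \<Rightarrow> bool" where
  "cont_diff_on 0 S f \<longleftrightarrow> continuous_on S f"
| "cont_diff_on (Suc k) S f \<longleftrightarrow> (\<forall>x\<in>S. f differentiable (at x)) \<and>
     (\<forall>v. cont_diff_on k S (\<lambda>x. frechet_derivative f (at x) v))"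

lemma cont_diff_on_UNIV: "cont_diff_on k UNIV f \<longleftrightarrow> cont_diff k f"
  by (induction k arbitrary: f) auto

lemma cont_diff_on_cong:
  assumes "open S" "\<And>x. x \<in> S \<Longrightarrow> f x = g x"
  shows "cont_diff_on k S f \<longleftrightarrow> cont_diff_on k S g"
  using assms(2)
proof (induction k arbitrary: f g)
  case 0
  then show ?case by (auto intro: continuous_on_cong)
next
  case (Suc k)
  have hd: "(f has_derivative D) (at x) \<longleftrightarrow> (g has_derivative D) (at x)" if "x \<in> S" for x D
    using assms(1) Suc.prems that
    by (intro iffI; elim has_derivative_transform_within_open[OF _ assms(1) that]) auto
  have fd: "frechet_derivative f (at x) = frechet_derivative g (at x)" if "x \<in> S" for x
    unfolding frechet_derivative_def using hd[OF that] by simp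
  have "f differentiable (at x) \<longleftrightarrow> g differentiable (at x)" if "x \<in> S" for x
    unfolding differentiable_def using hd[OF that] by simp
  then show ?case
    using Suc.IH[of "\<lambda>x. frechet_derivative f (at x) v" "\<lambda>x. frechet_derivative g (at x) v" for v] fd
    by simp
qed

text \<open>Derivatives are taken in the full neighbourhood filter, so on a union of open sets only
  the order-0 clause needs gluing. This is how a function is extended by zero beyond its
  support.\<close>

lemma cont_diff_on_Un:
  assumes "open S" "open T" "cont_diff_on k S f" "cont_diff_on k T f"
  shows "cont_diff_on k (S \<union> T) f"
  using assms(3,4)
  by (induction k arbitrary: f) (auto intro: continuous_on_open_Un assms)

lemma cont_diff_on_imp_continuous_on: "cont_diff_on k S f \<Longrightarrow> continuous_on S f"
  by (cases k) (auto intro!: continuous_at_imp_continuous_on differentiable_imp_continuous_within)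

lemma cont_diff_on_Suc_D: "cont_diff_on (Suc k) S f \<Longrightarrow> cont_diff_on k S f"
proof (induction k arbitrary: f)
  case 0
  then show ?case using cont_diff_on_imp_continuous_on by (metis cont_diff_on.simps(1))
qed auto

lemma cont_diff_on_const [simp]: "cont_diff_on k S (\<lambda>x. c)"
  by (induction k arbitrary: c) (auto simp: frechet_derivative_const)

lemma cont_diff_on_SucI:
  assumes S: "open S" and "\<And>x. x \<in> S \<Longrightarrow> (f has_derivative f' x) (at x)"
    and "\<And>v. cont_diff_on k S (\<lambda>x. f' x v)"
  shows "cont_diff_on (Suc k) S f"
proof -
  have "frechet_derivative f (at x) = f' x" if "x \<in> S" for x
    using assms(2)[OF that] frechet_derivative_at by force
  then show ?thesis
    using assms cont_diff_on_cong[OF S, of "\<lambda>x. frechet_derivative f (at x) v" "\<lambda>x. f' x v" for v]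
    by (auto simp: differentiable_def)
qed

lemma cont_diff_on_bounded_linear: "bounded_linear f \<Longrightarrow> open S \<Longrightarrow> cont_diff_on k S f"
proof (cases k)
  case 0
  assume "bounded_linear f"
  then show ?thesis using 0 by (simp add: linear_continuous_on)
next
  case (Suc k)
  assume "bounded_linear f" "open S"
  then show ?thesis unfolding Suc
    by (intro cont_diff_on_SucI[where f' = "\<lambda>_. f"] bounded_linear_imp_has_derivative) auto
qed

lemma cont_diff_on_SucE:
  assumes "cont_diff_on (Suc k) S f" "x \<in> S"
  shows "(f has_derivative frechet_derivative f (at x)) (at x)"
  using assms frechet_derivative_works by auto

lemma cont_diff_on_add:
  assumes S: "open S"
  shows "cont_diff_on k S f \<Longrightarrow> cont_diff_on k S g \<Longrightarrow> cont_diff_on k S (\<lambda>x. f x + g x)"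
proof (induction k arbitrary: f g)
  case (Suc k)
  show ?case
    by (rule cont_diff_on_SucI[OF S has_derivative_add[OF cont_diff_on_SucE[OF Suc.prems(1)] cont_diff_on_SucE[OF Suc.prems(2)]]])
       (use Suc in auto)
qed (auto intro: continuous_intros)

lemma cont_diff_on_bilinear:
  assumes S: "open S" and "bounded_bilinear pr"
  shows "cont_diff_on k S f \<Longrightarrow> cont_diff_on k S g \<Longrightarrow> cont_diff_on k S (\<lambda>x. pr (f x) (g x))"
proof (induction k arbitrary: f g)
  case 0
  then show ?case using bounded_bilinear.continuous_on[OF assms(2)] by auto
next
  case (Suc k)
  show ?case
    by (rule cont_diff_on_SucI[OF S bounded_bilinear.FDERIV[OF assms(2)
             cont_diff_on_SucE[OF Suc.prems(1)] cont_diff_on_SucE[OF Suc.prems(2)]]])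
       (use Suc.prems in \<open>auto intro!: cont_diff_on_add[OF S] Suc.IH
          intro: cont_diff_on_Suc_D[OF Suc.prems(1)] cont_diff_on_Suc_D[OF Suc.prems(2)]\<close>)
qed

lemmas cont_diff_on_mult = cont_diff_on_bilinear[OF _ bounded_bilinear_mult]
lemmas cont_diff_on_scaleR = cont_diff_on_bilinear[OF _ bounded_bilinear_scaleR]
lemmas cont_diff_on_inner = cont_diff_on_bilinear[OF _ bounded_bilinear_inner]

lemma cont_diff_on_linear_comp:
  assumes S: "open S" and L: "bounded_linear L"
  shows "cont_diff_on k S f \<Longrightarrow> cont_diff_on k S (\<lambda>x. L (f x))"
proof (induction k arbitrary: f)
  case 0
  then show ?case using bounded_linear.continuous_on[OF L] by auto
next
  case (Suc k)
  show ?case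
    by (rule cont_diff_on_SucI[OF S bounded_linear.has_derivative[OF L cont_diff_on_SucE[OF Suc.prems(1)]]])
       (use Suc in auto)
qed

lemma cont_diff_on_sum:
  assumes "open S" "\<And>i. i \<in> I \<Longrightarrow> cont_diff_on k S (f i)"
  shows "cont_diff_on k S (\<lambda>x. \<Sum>i\<in>I. f i x)"
  using assms(2) by (induction I rule: infinite_finite_induct) (auto intro: cont_diff_on_add[OF assms(1)])

lemma cont_diff_on_prod:
  fixes f :: "'i \<Rightarrow> 'a::real_normed_vector \<Rightarrow> 'b::real_normed_field"
  assumes "open S" "\<And>i. i \<in> I \<Longrightarrow> cont_diff_on k S (f i)"
  shows "cont_diff_on k S (\<lambda>x. \<Prod>i\<in>I. f i x)"
  using assms(2) by (induction I rule: infinite_finite_induct) (auto intro: cont_diff_on_mult[OF assms(1)])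

lemma cont_diff_on_inverse:
  fixes f :: "'a::real_normed_vector \<Rightarrow> 'b::real_normed_field"
  assumes S: "open S" and nz: "\<And>x. x \<in> S \<Longrightarrow> f x \<noteq> 0"
  shows "cont_diff_on k S f \<Longrightarrow> cont_diff_on k S (\<lambda>x. inverse (f x))"
proof (induction k)
  case 0
  then show ?case using nz by (auto intro: continuous_intros)
next
  case (Suc k)
  have mult: "cont_diff_on k S (\<lambda>x. - (inverse (f x) * frechet_derivative f (at x) v * inverse (f x)))" for v
    using Suc cont_diff_on_Suc_D[OF Suc.prems] S
    by (intro cont_diff_on_linear_comp[OF S bounded_linear_minus[OF bounded_linear_ident]] cont_diff_on_mult) auto
  show ?case
    by (rule cont_diff_on_SucI[OF S Deriv.has_derivative_inverse[OF nz cont_diff_on_SucE[OF Suc.prems]]])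
       (use mult in auto)
qed

text \<open>The chain rule yields the derivative of \<open>g\<close> in a direction that varies with
  \<open>x\<close>, whereas \<open>cont_diff_on\<close> speaks of fixed directions. Expanding that
  direction in \<open>Basis\<close> gives a finite sum of products covered by the induction
  hypothesis; hence \<open>f\<close> has values in a Euclidean space.\<close>

lemma cont_diff_on_compose:
  fixes f :: "'a::real_normed_vector \<Rightarrow> 'b::euclidean_space"
  assumes S: "open S" and T: "open T" and ST: "f ` S \<subseteq> T"
  shows "cont_diff_on k S f \<Longrightarrow> cont_diff_on k T g \<Longrightarrow> cont_diff_on k S (\<lambda>x. g (f x))"
proof (induction k arbitrary: g)
  case 0
  then show ?case using ST continuous_on_compose2[of T g S f] by auto
next
  case (Suc k)
  let ?D = "\<lambda>x v. \<Sum>b\<in>Basis. (frechet_derivative f (at x) v \<bullet> b) *\<^sub>R frechet_derivative g (at (f x)) b"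
  have 1: "((\<lambda>x. g (f x)) has_derivative ?D x) (at x)" if "x \<in> S" for x
  proof -
    have "(g has_derivative frechet_derivative g (at (f x))) (at (f x))"
      using cont_diff_on_SucE[OF Suc.prems(2)] ST that by auto
    from has_derivative_compose[OF cont_diff_on_SucE[OF Suc.prems(1) that] this]
    have "((\<lambda>x. g (f x)) has_derivative (\<lambda>v. frechet_derivative g (at (f x)) (frechet_derivative f (at x) v))) (at x)" .
    moreover have "frechet_derivative g (at (f x)) w = (\<Sum>b\<in>Basis. (w \<bullet> b) *\<^sub>R frechet_derivative g (at (f x)) b)" for w
    proof -
      have "linear (frechet_derivative g (at (f x)))"
        using \<open>(g has_derivative _) _\<close> has_derivative_linear by blast
      then have "frechet_derivative g (at (f x)) (\<Sum>b\<in>Basis. (w \<bullet> b) *\<^sub>R b) =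
         (\<Sum>b\<in>Basis. (w \<bullet> b) *\<^sub>R frechet_derivative g (at (f x)) b)"
        by (simp add: linear_sum linear_cmul)
      then show ?thesis by (simp only: euclidean_representation)
    qed
    ultimately show ?thesis by (metis (no_types, lifting) ext has_derivative_eq_rhs)
  qed
  show ?case
  proof (rule cont_diff_on_SucI[OF S 1])
    fix v
    have "cont_diff_on k S (\<lambda>x. frechet_derivative g (at (f x)) b)" for b
      using Suc.IH[OF cont_diff_on_Suc_D[OF Suc.prems(1)], of "\<lambda>y. frechet_derivative g (at y) b"] Suc.prems(2)
      by auto
    moreover have "cont_diff_on k S (\<lambda>x. frechet_derivative f (at x) v \<bullet> b)" for b
      using Suc.prems(1) by (intro cont_diff_on_inner[OF S]) auto
    ultimately show "cont_diff_on k S (\<lambda>x. ?D x v)"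
      by (intro cont_diff_on_sum[OF S] cont_diff_on_scaleR[OF S])
  qed
qed

section \<open>Smooth bump functions that increase to indicators of boxes\<close>

text \<open>Polynomials in \<open>1/x\<close> as a prefactor make the family closed under differentiation.\<close>

definition flat :: "real poly \<Rightarrow> real \<Rightarrow> real" where
  "flat p x = (if x > 0 then poly p (1/x) * exp (- (1/x)) else 0)"

lemma poly_exp_tendsto_0: "((\<lambda>x. poly p x * exp (- x)) \<longlongrightarrow> (0::real)) at_top"
proof -
  have "((\<lambda>x::real. x ^ k * exp (- x)) \<longlongrightarrow> 0) at_top" for k
    using tendsto_power_div_exp_0[of k] by (simp add: exp_minus divide_inverse)
  then have "((\<lambda>x. \<Sum>i\<le>degree p. coeff p i * (x ^ i * exp (- x))) \<longlongrightarrow> (\<Sum>i\<le>degree p. coeff p i * 0)) at_top"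
    by (intro tendsto_sum tendsto_mult tendsto_const)
  then show ?thesis by (simp add: poly_altdef sum_distrib_right mult.assoc)
qed

text \<open>With t = 1/x one has d/dx = - t^2 d/dt, so p(t) e^(-t) becomes t^2 (p - p')(t) e^(-t);
  the polynomial \<open>[:0,0,1:]\<close> is t^2. At x = 0 the right difference quotient is t p(t)
  e^(-t), which tends to 0 as t grows.\<close>

lemma flat_has_field_derivative:
  "(flat p has_real_derivative flat ([:0,0,1:] * (p - pderiv p)) x) (at x)"
proof -
  consider "x < 0" | "x > 0" | "x = 0" by linarith
  then show ?thesis
  proof cases
    case 1
    have "((\<lambda>x. 0) has_real_derivative 0) (at x)" by simp
    then have "(flat p has_real_derivative 0) (at x)"
      by (rule has_field_derivative_transform_within_open[where S = "{..<0}"]) (use 1 in \<open>auto simp: flat_def\<close>)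
    then show ?thesis using 1 by (simp add: flat_def)
  next
    case 2
    have "((\<lambda>x. poly p (1/x) * exp (- (1/x))) has_real_derivative
        (poly (pderiv p) (1/x) * (- (1/x^2)) * exp (-(1/x)) + poly p (1/x) * (exp (-(1/x)) * (1/x^2)))) (at x)"
      using 2 by (auto intro!: derivative_eq_intros poly_DERIV[THEN DERIV_chain2] simp: power2_eq_square field_simps)
    then have "(flat p has_real_derivative 
        (poly (pderiv p) (1/x) * (- (1/x^2)) * exp (-(1/x)) + poly p (1/x) * (exp (-(1/x)) * (1/x^2)))) (at x)"
      by (rule has_field_derivative_transform_within_open[where S = "{0<..}"]) (use 2 in \<open>auto simp: flat_def\<close>)
    then show ?thesis using 2 by (simp add: flat_def power2_eq_square field_simps)
  next
    case 3
    have "((\<lambda>h. flat p h / h) \<longlongrightarrow> 0) (at_left 0)"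
      by (rule tendsto_eventually) (auto simp: flat_def eventually_at_filter)
    moreover have "((\<lambda>h. flat p h / h) \<longlongrightarrow> 0) (at_right 0)"
    proof -
      have "((\<lambda>h. poly ([:0,1:]*p) (inverse h) * exp (- inverse h)) \<longlongrightarrow> 0) (at_right (0::real))"
        by (rule filterlim_compose[OF poly_exp_tendsto_0 filterlim_inverse_at_top_right])
      then show ?thesis
        by (rule Lim_transform_eventually) (auto simp: flat_def eventually_at_filter field_simps)
    qed
    ultimately have "((\<lambda>h. flat p h / h) \<longlongrightarrow> 0) (at 0)"
      by (simp add: filterlim_split_at)
    then show ?thesis using 3 by (simp add: DERIV_def flat_def)
  qed
qed

lemma cont_diff_flat: "cont_diff_on k UNIV (flat p)"
proof (induction k arbitrary: p)
  case 0
  have "isCont (flat p) x" for x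
    using DERIV_isCont[OF flat_has_field_derivative] .
  then show ?case by (simp add: continuous_at_imp_continuous_on)
next
  case (Suc k)
  show ?case
    by (rule cont_diff_on_SucI[OF open_UNIV flat_has_field_derivative[unfolded has_field_derivative_def]])
       (intro cont_diff_on_mult Suc open_UNIV cont_diff_on_const)
qed

text \<open>\<open>flat 1\<close> is the classical exp (- 1/x) for x > 0, so the product is smooth
  and positive exactly inside the open box.\<close>

definition bump_base :: "'a::euclidean_space \<Rightarrow> 'a \<Rightarrow> 'a \<Rightarrow> real" where
  "bump_base a b x = (\<Prod>i\<in>Basis. flat 1 ((x - a) \<bullet> i) * flat 1 ((b - x) \<bullet> i))"

text \<open>For h >= 0 the functions n h / (1 + n h) increase with n to the indicator of the set h >
  0, and they inherit the smoothness of h. They take the place of plateau functions and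
  mollifiers.\<close>

definition bump :: "'a::euclidean_space \<Rightarrow> 'a \<Rightarrow> nat \<Rightarrow> 'a \<Rightarrow> real" where
  "bump a b n x = real n * bump_base a b x * inverse (1 + real n * bump_base a b x)"

lemma bump_base_nonneg: "bump_base a b x \<ge> 0"
  unfolding bump_base_def by (intro prod_nonneg) (auto simp: flat_def)

lemma bump_base_eq_0_iff: "bump_base a b x = 0 \<longleftrightarrow> x \<notin> box a b"
  by (auto simp: bump_base_def mem_box flat_def inner_diff_left split: if_splits)

lemma cont_diff_bump: "cont_diff_on k UNIV (bump a b n)"
proof -
  have lin: "cont_diff_on k UNIV (\<lambda>x::'a. (x - a) \<bullet> i)" "cont_diff_on k UNIV (\<lambda>x::'a. (a - x) \<bullet> i)" for a i
  proof -
    have "cont_diff_on k UNIV (\<lambda>x::'a. x \<bullet> i + - (a \<bullet> i))" "cont_diff_on k UNIV (\<lambda>x::'a. a \<bullet> i + x \<bullet> (- i))"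
      by (intro cont_diff_on_add cont_diff_on_const cont_diff_on_bounded_linear
           bounded_linear_inner_left open_UNIV)+
    then show "cont_diff_on k UNIV (\<lambda>x::'a. (x - a) \<bullet> i)" "cont_diff_on k UNIV (\<lambda>x::'a. (a - x) \<bullet> i)"
      by (simp_all add: inner_diff_left)
  qed
  have flat_comp: "cont_diff_on k UNIV (\<lambda>x. flat 1 (h x))" if "cont_diff_on k UNIV h" for h :: "'a \<Rightarrow> real"
    by (rule cont_diff_on_compose[OF open_UNIV open_UNIV _ that cont_diff_flat]) simp
  have "cont_diff_on k UNIV (bump_base a b)"
    unfolding bump_base_def
    by (intro cont_diff_on_prod cont_diff_on_mult flat_comp lin open_UNIV)
  moreover have "1 + real n * bump_base a b x \<noteq> 0" for x
    using mult_nonneg_nonneg[OF of_nat_0_le_iff bump_base_nonneg[of a b x], of n] by linarith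
  ultimately show ?thesis
    unfolding bump_def
    by (intro cont_diff_on_mult cont_diff_on_inverse cont_diff_on_add cont_diff_on_const open_UNIV)
qed

lemma bump_eq_0: "x \<notin> box a b \<Longrightarrow> bump a b n x = 0"
  using bump_base_eq_0_iff[of a b x] by (simp add: bump_def)

lemma bump_bounds: "0 \<le> bump a b n x" "bump a b n x \<le> 1"
proof -
  have "0 \<le> real n * bump_base a b x" using bump_base_nonneg[of a b x] by simp
  then show "0 \<le> bump a b n x" "bump a b n x \<le> 1" by (simp_all add: bump_def divide_simps)
qed

lemma bump_tendsto: "(\<lambda>n. bump a b n x) \<longlonglongrightarrow> indicator (box a b) x"
proof (cases "x \<in> box a b")
  case True
  define t where "t = bump_base a b x"
  have t: "t > 0" using True bump_base_nonneg[of a b x] bump_base_eq_0_iff[of a b x] unfolding t_def by auto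
  have "(\<lambda>n. real n * t * inverse (1 + real n * t)) \<longlonglongrightarrow> 1"
    using t by real_asymp
  then show ?thesis using True by (simp add: bump_def t_def)
qed (simp add: bump_eq_0)

section \<open>Test functions detect integrable functions\<close>

lemma completion_ex_borel_measurable_complex:
  fixes g :: "'a \<Rightarrow> complex"
  assumes g: "g \<in> borel_measurable (completion M)"
  shows "\<exists>g'\<in>borel_measurable M. AE x in M. g x = g' x"
proof -
  have "(\<lambda>x. Re (g x)) \<in> borel_measurable (completion M)" "(\<lambda>x. Im (g x)) \<in> borel_measurable (completion M)"
    using g by simp_all
  then obtain r i where [measurable]: "r \<in> borel_measurable M" "i \<in> borel_measurable M"
    and ae: "AE x in M. Re (g x) = r x" "AE x in M. Im (g x) = i x"
    using completion_ex_borel_measurable_real by metis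
  show ?thesis
  proof (rule bexI[of _ "\<lambda>x. of_real (r x) + \<i> * of_real (i x)"])
    show "AE x in M. g x = of_real (r x) + \<i> * of_real (i x)"
      using ae by eventually_elim (simp add: complex_eq_iff)
  qed simp
qed

text \<open>A Dynkin-class argument: the Borel sets over which \<open>g\<close> integrates to 0 are
  closed under complements and countable disjoint unions, and boxes form an intersection-stable
  generator. The whole space is not a box, so \<open>total\<close> is what makes complements
  work.\<close>

lemma integrable_zero_on_boxes_imp_AE_0:
  fixes g :: "'a::euclidean_space \<Rightarrow> complex"
  assumes g: "integrable lborel g" and total: "(LINT x|lborel. g x) = 0"
    and box: "\<And>a b. (LINT x:box a b|lborel. g x) = 0"
  shows "AE x in lborel. g x = 0"
proof (rule sigma_finite_measure.density_zero[OF sigma_finite_lborel g])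
  fix A :: "'a set" assume "A \<in> sets lborel"
  then have A: "A \<in> sigma_sets UNIV (range (\<lambda>(a, b). box a b))"
    by (simp add: borel_eq_box)
  have sets: "sigma_sets UNIV (range (\<lambda>(a, b). box a b)) = sets (borel :: 'a measure)"
    by (simp add: borel_eq_box)
  have st: "Int_stable (range (\<lambda>(a :: 'a, b). box a b))"
    by (auto simp: Int_stable_def box_Int_box)
  have si: "set_integrable lborel A g" if "A \<in> sets borel" for A
    using integrable_mult_indicator[OF _ g, of A] that by (simp add: set_integrable_def)
  show "(LINT x:A|lborel. g x) = 0"
    using st _ A
  proof (rule sigma_sets_induct_disjoint)
    fix B :: "'a set" assume "B \<in> range (\<lambda>(a, b). box a b)"
    then show "(LINT x:B|lborel. g x) = 0" using box by auto
  next
    fix B :: "'a set" assume B: "B \<in> sigma_sets UNIV (range (\<lambda>(a, b). box a b))" "(LINT x:B|lborel. g x) = 0"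
    then have "(LINT x:(UNIV-B)|lborel. g x) + (LINT x:B|lborel. g x) = (LINT x:UNIV|lborel. g x)"
      by (subst set_integral_Un[symmetric]) (auto simp: sets intro!: si)
    then show "(LINT x:(UNIV-B)|lborel. g x) = 0" using B total by (simp add: set_lebesgue_integral_def)
  next
    fix B :: "nat \<Rightarrow> 'a set"
    assume B: "disjoint_family B" "range B \<subseteq> sigma_sets UNIV (range (\<lambda>(a, b). box a b))"
      "\<And>i. (LINT x:B i|lborel. g x) = 0"
    have "(LINT x:(\<Union>i. B i)|lborel. g x) = (\<Sum>i. (LINT x:B i|lborel. g x))"
      using B unfolding sets
      by (intro lebesgue_integral_countable_add) (auto simp: disjoint_family_on_def intro!: si)
    then show "(LINT x:\<Union>(range B)|lborel. g x) = 0" using B by simp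
  qed (auto simp: set_lebesgue_integral_def)
qed

text \<open>The fundamental lemma of the calculus of variations. On a closed box, dominated
  convergence turns bumps into indicators of smaller boxes; countably many closed boxes then exhaust
  \<Omega>. Only boxes inside \<Omega> are tested, since only their bumps are test functions
  there.\<close>

lemma integral_bump_0_imp_AE_0:
  fixes g :: "'a::euclidean_space \<Rightarrow> complex"
  assumes \<Omega>: "open \<Omega>"
    and int: "\<And>a b. cbox a b \<subseteq> \<Omega> \<Longrightarrow> set_integrable lebesgue (cbox a b) g"
    and zero: "\<And>a b n. cbox a b \<subseteq> \<Omega> \<Longrightarrow> (LINT x|lebesgue. bump a b n x *\<^sub>R g x) = 0"
  shows "AE x in lborel. x \<in> \<Omega> \<longrightarrow> g x = 0"
proof -
  have *: "AE x in lborel. x \<in> cbox a b \<longrightarrow> g x = 0" if ab: "cbox a b \<subseteq> \<Omega>" for a b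
  proof -
    let ?f = "\<lambda>x. indicat_real (cbox a b) x *\<^sub>R g x"
    have f_int: "integrable lebesgue ?f" using int[OF ab] by (simp add: set_integrable_def)
    then obtain g' where g': "g' \<in> borel_measurable lborel" and ae: "AE x in lborel. ?f x = g' x"
      using completion_ex_borel_measurable_complex[of ?f lborel] borel_measurable_integrable by blast
    have ae': "AE x in lebesgue. ?f x = g' x" using ae by (rule AE_completion)
    have g'm: "g' \<in> borel_measurable lebesgue" using g' by (simp add: measurable_completion)
    have "integrable lebesgue g'"
      using integrable_cong_AE_imp[OF f_int g'm ae'] .
    then have g'_int: "integrable lborel g'" using integrable_completion[OF g'] by blast
    have sub: "(LINT x:box c d|lborel. g' x) = 0" if cd: "box c d \<subseteq> cbox a b" for c d
    proof (cases "box c d = {}")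
      case False
      then have cd': "cbox c d \<subseteq> cbox a b"
        using cd closure_box[OF False] closure_minimal[OF cd closed_cbox] by simp
      have "(\<lambda>n. LINT x|lborel. bump c d n x *\<^sub>R g' x) \<longlonglongrightarrow> (LINT x|lborel. indicator (box c d) x *\<^sub>R g' x)"
      proof (rule integral_dominated_convergence)
        show "integrable lborel (\<lambda>x. norm (g' x))" using g'_int by simp
        have bm: "bump c d n \<in> borel_measurable borel" for n
          using cont_diff_on_imp_continuous_on[OF cont_diff_bump] by (rule borel_measurable_continuous_onI)
        show "(\<lambda>x. bump c d n x *\<^sub>R g' x) \<in> borel_measurable lborel" for n
          using g' bm by simp
        show "(\<lambda>x. indicat_real (box c d) x *\<^sub>R g' x) \<in> borel_measurable lborel"
          using g' by (intro borel_measurable_scaleR borel_measurable_indicator) auto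
        show "AE x in lborel. (\<lambda>n. bump c d n x *\<^sub>R g' x) \<longlonglongrightarrow> indicat_real (box c d) x *\<^sub>R g' x"
          by (intro AE_I2 tendsto_scaleR bump_tendsto tendsto_const)
        show "AE x in lborel. norm (bump c d n x *\<^sub>R g' x) \<le> norm (g' x)" for n
          using bump_bounds[of c d n] by (auto intro!: AE_I2 mult_left_le_one_le)
      qed
      moreover have "(LINT x|lborel. bump c d n x *\<^sub>R g' x) = 0" for n
      proof -
        have bm: "bump c d n \<in> borel_measurable borel"
          using cont_diff_on_imp_continuous_on[OF cont_diff_bump] by (rule borel_measurable_continuous_onI)
        \<comment> \<open>A bump over a subbox does not see the truncation of \<open>g\<close> to
          \<open>cbox a b\<close>, so the hypothesis on \<open>g\<close> applies to the truncated
          function.\<close>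
        have eq: "bump c d n x *\<^sub>R g x = bump c d n x *\<^sub>R ?f x" for x
          using cd bump_eq_0[of x c d n] by (auto simp: indicator_def)
        have "(LINT x|lborel. bump c d n x *\<^sub>R g' x) = (LINT x|lebesgue. bump c d n x *\<^sub>R g' x)"
          using g' bm by (intro integral_completion[symmetric]) simp
        also have "\<dots> = (LINT x|lebesgue. bump c d n x *\<^sub>R ?f x)"
        proof (rule integral_cong_AE)
          show "(\<lambda>x. bump c d n x *\<^sub>R g' x) \<in> borel_measurable lebesgue"
            using g' bm by (intro measurable_completion) simp
          show "(\<lambda>x. bump c d n x *\<^sub>R ?f x) \<in> borel_measurable lebesgue"
            using bm by (intro borel_measurable_scaleR borel_measurable_integrable[OF f_int] measurable_completion) simp
          show "AE x in lebesgue. bump c d n x *\<^sub>R g' x = bump c d n x *\<^sub>R ?f x"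
            using ae' by eventually_elim simp
        qed
        also have "\<dots> = 0" using zero[of c d n] cd' ab unfolding eq by auto
        finally show ?thesis .
      qed
      ultimately show ?thesis
        by (simp add: set_lebesgue_integral_def LIMSEQ_const_iff)
    qed (simp add: set_lebesgue_integral_def)
    \<comment> \<open>\<open>?f\<close> lives on the closed box, while the integrals known to vanish
      are over open ones; the boundary in between is a null set.\<close>
    have bd: "AE x in lborel. x \<notin> cbox a b - box a b"
    proof -
      have "cbox a b - box a b \<in> null_sets lborel"
        by (simp add: null_sets_def emeasure_Diff emeasure_lborel_cbox_eq emeasure_lborel_box_eq box_subset_cbox)
      then show ?thesis by (rule AE_not_in)
    qed
    have inbox: "(LINT x:B|lborel. g' x) = (LINT x:B \<inter> box a b|lborel. g' x)" if "B \<in> sets borel" for B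
      unfolding set_lebesgue_integral_def
    proof (rule integral_cong_AE)
      show "AE x in lborel. indicat_real B x *\<^sub>R g' x = indicat_real (B \<inter> box a b) x *\<^sub>R g' x"
        using ae bd by eventually_elim (auto simp: indicator_def split: if_splits)
    qed (use that g' in auto)
    have "AE x in lborel. g' x = 0"
    proof (rule integrable_zero_on_boxes_imp_AE_0[OF g'_int])
      have "(LINT x|lborel. g' x) = (LINT x:UNIV|lborel. g' x)" by (simp add: set_lebesgue_integral_def)
      also have "\<dots> = 0" using inbox[of UNIV] sub[OF box_subset_cbox] by simp
      finally show "(LINT x|lborel. g' x) = 0" .
      show "(LINT x:box c d|lborel. g' x) = 0" for c d
      proof -
        obtain u v where "box c d \<inter> box a b = box u v" unfolding box_Int_box by blast
        then show ?thesis using inbox[of "box c d"] sub[of u v] box_subset_cbox[of a b] by (simp add: le_infI2 flip: \<open>_ = box u v\<close>)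
      qed
    qed
    with ae show ?thesis by eventually_elim (auto simp: indicator_def split: if_splits)
  qed
  obtain \<D> where \<D>: "countable \<D>" "\<D> \<subseteq> Pow \<Omega>" "\<And>X. X \<in> \<D> \<Longrightarrow> \<exists>a b. X = cbox a b" "\<Union>\<D> = \<Omega>"
    using open_countable_Union_open_cbox[OF \<Omega>] by metis
  have "AE x in lborel. \<forall>X\<in>\<D>. x \<in> X \<longrightarrow> g x = 0"
    using \<D>(1)
  proof (rule AE_ball_countable[THEN iffD2], intro ballI)
    fix X assume X: "X \<in> \<D>"
    with \<D> obtain a b where "X = cbox a b" "cbox a b \<subseteq> \<Omega>" by blast
    then show "AE x in lborel. x \<in> X \<longrightarrow> g x = 0" using * by simp
  qed
  then show ?thesis by eventually_elim (use \<D>(4) in auto)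
qed

section \<open>The change of variables\<close>

lemma borel_measurable_Complex [measurable (raw)]:
  assumes "f \<in> borel_measurable M" "g \<in> borel_measurable M"
  shows "(\<lambda>p. Complex (f p) (g p)) \<in> borel_measurable M"
  using assms unfolding Complex_eq by measurable

lemma distr_lborel_Complex: "distr lborel borel (\<lambda>(x, y). Complex x y) = lborel"
proof (rule lborel_eqI[symmetric])
  have m [measurable]: "(\<lambda>(x, y). Complex x y) \<in> borel_measurable borel"
    by (simp add: case_prod_beta borel_prod[symmetric])
  fix l u :: complex assume le: "\<And>b. b \<in> Basis \<Longrightarrow> l \<bullet> b \<le> u \<bullet> b"
  have eq: "(\<lambda>(x, y). Complex x y) -` box l u = box (Re l) (Re u) \<times> box (Im l) (Im u)"
    by (auto simp: box_def Basis_complex_def inner_complex_def)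
  have "emeasure (distr lborel borel (\<lambda>(x, y). Complex x y)) (box l u) =
      emeasure (lborel \<Otimes>\<^sub>M lborel) (box (Re l) (Re u) \<times> box (Im l) (Im u))"
    by (simp add: emeasure_distr eq lborel_prod)
  also have "\<dots> = ennreal (\<Prod>b\<in>Basis. (u - l) \<bullet> b)"
    using le[of 1] le[of \<i>]
    by (subst lborel.emeasure_pair_measure_Times)
       (auto simp: Basis_complex_def inner_complex_def ennreal_mult)
  finally show "emeasure (distr lborel borel (\<lambda>(x, y). Complex x y)) (box l u) = ennreal (\<Prod>b\<in>Basis. (u - l) \<bullet> b)" .
qed simp

lemma nn_integral_lborel_complex:
  fixes h :: "complex \<Rightarrow> ennreal"
  assumes [measurable]: "h \<in> borel_measurable borel"
  shows "(\<integral>\<^sup>+z. h z \<partial>lborel) = (\<integral>\<^sup>+x. \<integral>\<^sup>+y. h (Complex x y) \<partial>lborel \<partial>lborel)" (is ?thesis1)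
    and "(\<integral>\<^sup>+z. h z \<partial>lborel) = (\<integral>\<^sup>+y. \<integral>\<^sup>+x. h (Complex x y) \<partial>lborel \<partial>lborel)" (is ?thesis2)
proof -
  have "(\<integral>\<^sup>+z. h z \<partial>lborel) = (\<integral>\<^sup>+p. h (case p of (x, y) \<Rightarrow> Complex x y) \<partial>(lborel \<Otimes>\<^sub>M lborel))"
    by (subst distr_lborel_Complex[symmetric], subst nn_integral_distr)
       (auto simp: lborel_prod case_prod_beta borel_prod[symmetric])
  then have eq: "(\<integral>\<^sup>+z. h z \<partial>lborel) = (\<integral>\<^sup>+(x,y). h (Complex x y) \<partial>(lborel \<Otimes>\<^sub>M lborel))"
    by (simp add: case_prod_beta')
  show ?thesis1 unfolding eq by (subst lborel.nn_integral_fst[symmetric]) auto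
  show ?thesis2 unfolding eq by (subst lborel_pair.nn_integral_snd[symmetric]) auto
qed

text \<open>Multiplication by c = a + ib has determinant a^2 + b^2. Only one-dimensional affine
  substitutions are used, so the real matrix is factored into maps that change a single coordinate;
  this needs the pivot a, and for a = 0 the two axes are merely exchanged and scaled.\<close>

lemma nn_integral_complex_mult:
  fixes h :: "complex \<Rightarrow> ennreal"
  assumes [measurable]: "h \<in> borel_measurable borel" and c: "c \<noteq> 0"
  shows "(\<integral>\<^sup>+z. h (z * c) * ennreal ((norm c)\<^sup>2) \<partial>lborel) = (\<integral>\<^sup>+z. h z \<partial>lborel)"
proof -
  define a b where "a = Re c" and "b = Im c"
  have nc: "(norm c)\<^sup>2 = a\<^sup>2 + b\<^sup>2" by (simp add: a_def b_def cmod_power2)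
  have pos: "a\<^sup>2 + b\<^sup>2 > 0" using c unfolding nc[symmetric] by simp
  have mult: "Complex x y * c = Complex (x * a - y * b) (x * b + y * a)" for x y
    by (simp add: complex_eq_iff a_def b_def)
  have "ennreal (a\<^sup>2 + b\<^sup>2) * (\<integral>\<^sup>+z. h (z * c) \<partial>lborel) = (\<integral>\<^sup>+z. h z \<partial>lborel)"
  proof (cases "a = 0")
    case True
    then have b: "b \<noteq> 0" using pos by auto
    have "(\<integral>\<^sup>+z. h z \<partial>lborel) = (\<integral>\<^sup>+y. \<integral>\<^sup>+x. h (Complex x y) \<partial>lborel \<partial>lborel)"
      by (rule nn_integral_lborel_complex) fact
    also have "\<dots> = (\<integral>\<^sup>+y. ennreal \<bar>b\<bar> * (\<integral>\<^sup>+x. h (Complex (- (x * b)) y) \<partial>lborel) \<partial>lborel)"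
      by (subst nn_integral_real_affine[where c="-b" and t=0]) (use b in \<open>auto simp: mult.commute\<close>)
    also have "\<dots> = ennreal \<bar>b\<bar> * (\<integral>\<^sup>+y. ennreal \<bar>b\<bar> * (\<integral>\<^sup>+x. h (Complex (- (x * b)) (y * b)) \<partial>lborel) \<partial>lborel)"
      by (subst nn_integral_real_affine[where c=b and t=0]) (use b in \<open>auto simp: mult.commute\<close>)
    also have "\<dots> = ennreal \<bar>b\<bar> * ennreal \<bar>b\<bar> * (\<integral>\<^sup>+y. \<integral>\<^sup>+x. h (Complex (- (x * b)) (y * b)) \<partial>lborel \<partial>lborel)"
      by (subst nn_integral_cmult) (auto simp: mult.assoc)
    also have "ennreal \<bar>b\<bar> * ennreal \<bar>b\<bar> = ennreal (a\<^sup>2 + b\<^sup>2)"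
      by (simp add: True ennreal_mult[symmetric] power2_eq_square)
    also have "(\<integral>\<^sup>+y. \<integral>\<^sup>+x. h (Complex (- (x * b)) (y * b)) \<partial>lborel \<partial>lborel) = (\<integral>\<^sup>+z. h (z * c) \<partial>lborel)"
      by (subst nn_integral_lborel_complex(1)) (auto simp: mult True)
    finally show ?thesis ..
  next
    case False
    \<comment> \<open>With u = a x - b y the imaginary part b x + a y equals (b/a) u + e y for this
      \<open>e\<close>. So v is replaced by y at fixed u, and then u by x at fixed y; the total
      factor is |a| |e| = a^2 + b^2.\<close>
    define e where "e = b\<^sup>2 / a + a"
    have e: "e \<noteq> 0" and ae: "\<bar>a\<bar> * \<bar>e\<bar> = a\<^sup>2 + b\<^sup>2"
    proof -
      have "a * e = a\<^sup>2 + b\<^sup>2" using False by (simp add: e_def field_simps power2_eq_square)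
      then show "e \<noteq> 0" "\<bar>a\<bar> * \<bar>e\<bar> = a\<^sup>2 + b\<^sup>2" using pos by (auto simp flip: abs_mult)
    qed
    have "(\<integral>\<^sup>+z. h z \<partial>lborel) = (\<integral>\<^sup>+u. \<integral>\<^sup>+v. h (Complex u v) \<partial>lborel \<partial>lborel)"
      by (rule nn_integral_lborel_complex) fact
    also have "\<dots> = (\<integral>\<^sup>+u. ennreal \<bar>e\<bar> * (\<integral>\<^sup>+y. h (Complex u (b / a * u + e * y)) \<partial>lborel) \<partial>lborel)"
      by (intro nn_integral_cong nn_integral_real_affine) (use e in auto)
    also have "\<dots> = ennreal \<bar>e\<bar> * (\<integral>\<^sup>+u. \<integral>\<^sup>+y. h (Complex u (b / a * u + e * y)) \<partial>lborel \<partial>lborel)"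
      by (subst nn_integral_cmult) auto
    also have "(\<integral>\<^sup>+u. \<integral>\<^sup>+y. h (Complex u (b / a * u + e * y)) \<partial>lborel \<partial>lborel) =
               (\<integral>\<^sup>+y. \<integral>\<^sup>+u. h (Complex u (b / a * u + e * y)) \<partial>lborel \<partial>lborel)"
      by (rule lborel_pair.Fubini'[symmetric]) auto
    also have "\<dots> = (\<integral>\<^sup>+y. ennreal \<bar>a\<bar> * (\<integral>\<^sup>+x. h (Complex (- (y * b) + a * x) (b / a * (- (y * b) + a * x) + e * y)) \<partial>lborel) \<partial>lborel)"
      by (intro nn_integral_cong nn_integral_real_affine) (use False in auto)
    also have "\<dots> = ennreal \<bar>a\<bar> * (\<integral>\<^sup>+y. \<integral>\<^sup>+x. h (Complex (- (y * b) + a * x) (b / a * (- (y * b) + a * x) + e * y)) \<partial>lborel \<partial>lborel)"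
      by (subst nn_integral_cmult) auto
    also have "(\<integral>\<^sup>+y. \<integral>\<^sup>+x. h (Complex (- (y * b) + a * x) (b / a * (- (y * b) + a * x) + e * y)) \<partial>lborel \<partial>lborel) =
       (\<integral>\<^sup>+y. \<integral>\<^sup>+x. h (Complex x y * c) \<partial>lborel \<partial>lborel)"
    proof -
      have "Complex (- (y * b) + a * x) (b / a * (- (y * b) + a * x) + e * y) = Complex x y * c" for x y
        unfolding mult using False by (simp add: e_def field_simps power2_eq_square)
      then show ?thesis by simp
    qed
    also have "\<dots> = (\<integral>\<^sup>+z. h (z * c) \<partial>lborel)"
      by (rule nn_integral_lborel_complex(2)[symmetric]) measurable
    finally show ?thesis using ae
      by (simp add: mult.assoc[symmetric] ennreal_mult[symmetric] mult.commute)
  qed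
  then show ?thesis by (simp add: nn_integral_multc nc mult.commute)
qed

text \<open>The inverse of \<^const>\<open>hartogs_map\<close>, extended to the whole plane.\<close>

definition twist :: "complex \<times> complex \<Rightarrow> complex \<times> complex" where
  "twist w = (fst w * snd w, snd w)"

lemma borel_measurable_twist [measurable]: "twist \<in> borel_measurable borel"
  unfolding twist_def by (simp add: borel_prod[symmetric])

text \<open>For fixed w2 the map scales the first coordinate by w2, which contributes |w2|^2; the
  line w2 = 0, where it collapses, is a null set.\<close>

lemma nn_integral_twist:
  assumes [measurable]: "h \<in> borel_measurable borel"
  shows "(\<integral>\<^sup>+w. h (twist w) * ennreal ((norm (snd w))\<^sup>2) \<partial>lborel) = (\<integral>\<^sup>+z. h z \<partial>lborel)"
proof -
  have h [measurable]: "h \<in> borel_measurable (lborel \<Otimes>\<^sub>M lborel)"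
    unfolding lborel_prod by simp
  have "(\<integral>\<^sup>+w. h (twist w) * ennreal ((norm (snd w))\<^sup>2) \<partial>lborel) =
     (\<integral>\<^sup>+w2. \<integral>\<^sup>+w1. h (w1 * w2, w2) * ennreal ((norm w2)\<^sup>2) \<partial>lborel \<partial>lborel)"
    unfolding lborel_prod[symmetric]
    by (subst lborel_pair.nn_integral_snd[symmetric])
       (auto simp: twist_def borel_prod[symmetric] case_prod_beta)
  also have "\<dots> = (\<integral>\<^sup>+z2. \<integral>\<^sup>+z1. h (z1, z2) \<partial>lborel \<partial>lborel)"
  proof (rule nn_integral_cong_AE)
    have "AE w2 in lborel. (w2 :: complex) \<noteq> 0"
      by (rule AE_lborel_singleton)
    then show "AE w2 in lborel. (\<integral>\<^sup>+w1. h (w1 * w2, w2) * ennreal ((norm w2)\<^sup>2) \<partial>lborel) = (\<integral>\<^sup>+z1. h (z1, w2) \<partial>lborel)"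
      by eventually_elim (rule nn_integral_complex_mult, auto)
  qed
  also have "\<dots> = (\<integral>\<^sup>+z. h z \<partial>lborel)"
    unfolding lborel_prod[symmetric]
    by (rule lborel_pair.nn_integral_snd[OF h])
  finally show ?thesis .
qed

text \<open>In pushforward form the substitution also transports null sets, integrability and
  Bochner integrals.\<close>

lemma distr_twist: "distr (density lborel (\<lambda>w. ennreal ((norm (snd w))\<^sup>2))) borel twist = lborel"
proof (rule measure_eqI)
  fix A assume "A \<in> sets (distr (density lborel (\<lambda>w. ennreal ((norm (snd w))\<^sup>2))) borel twist)"
  then have [measurable]: "A \<in> sets borel" by simp
  have "emeasure (distr (density lborel (\<lambda>w. ennreal ((norm (snd w))\<^sup>2))) borel twist) A =
      (\<integral>\<^sup>+w. indicator A (twist w) * ennreal ((norm (snd w))\<^sup>2) \<partial>lborel)"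
  proof (subst emeasure_distr)
    have m: "(\<lambda>w :: complex \<times> complex. ennreal ((norm (snd w))\<^sup>2)) \<in> borel_measurable lborel"
      by (simp add: borel_prod[symmetric])
    have "twist -` A \<in> sets lborel"
      using measurable_sets[OF borel_measurable_twist, of A] by simp
    then show "emeasure (density lborel (\<lambda>w. ennreal ((norm (snd w))\<^sup>2)))
        (twist -` A \<inter> space (density lborel (\<lambda>w. ennreal ((norm (snd w))\<^sup>2)))) =
       (\<integral>\<^sup>+w. indicator A (twist w) * ennreal ((norm (snd w))\<^sup>2) \<partial>lborel)"
      using m by (auto simp: emeasure_density mult.commute indicator_def intro!: nn_integral_cong)
  qed auto
  also have "\<dots> = emeasure lborel A" by (subst nn_integral_twist) auto
  finally show "emeasure (distr (density lborel (\<lambda>w. ennreal ((norm (snd w))\<^sup>2))) borel twist) A = emeasure lborel A" .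
qed simp

section \<open>The Cauchy transform on \<open>L\<^sup>p\<close> of the disc\<close>

lemma sets_borel_ball [measurable, simp]: "ball a r \<in> sets borel"
  by simp

text \<open>The radius is 2 because the unit disc, translated by a point of the closed unit disc,
  stays in this ball; so one number bounds the integral of the kernel for every pole.\<close>

definition kernel_mass :: ennreal where
  "kernel_mass = (\<integral>\<^sup>+z. indicator (ball 0 2) z * ennreal (1 / norm z) \<partial>(lborel :: complex measure))"

text \<open>Dyadic domination: if k is least with 2^(-k) <= |z|, then |z| < 2 / 2^k and 1/|z| <=
  2^k. The k-th dominating term has integral 4 pi / 2^k. At z = 0 the convention 1/0 = 0 leaves
  nothing to bound.\<close>

lemma kernel_mass_finite: "kernel_mass < \<infinity>"
proof -
  let ?a = "\<lambda>k z. ennreal (2 ^ k) * indicator (ball 0 (2 / 2 ^ k)) (z :: complex)"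
  have "indicator (ball 0 2) z * ennreal (1 / norm z) \<le> (\<Sum>k. ?a k z)" for z :: complex
  proof (cases "z \<in> ball 0 2 \<and> z \<noteq> 0")
    case True
    then have z: "0 < norm z" "norm z < 2" by auto
    have "\<exists>k. 1 / 2 ^ k \<le> norm z"
      using real_arch_pow_inv[OF z(1), of "1/2"] by (auto simp: power_one_over intro: less_imp_le)
    then have ex: "\<exists>k. 1 / 2 ^ k \<le> norm z" .
    define k where "k = (LEAST k. 1 / 2 ^ k \<le> norm z)"
    have k: "1 / 2 ^ k \<le> norm z" unfolding k_def by (rule LeastI_ex[OF ex])
    have "norm z < 2 / 2 ^ k"
    proof (cases k)
      case (Suc j)
      then have "\<not> 1 / 2 ^ j \<le> norm z" using not_less_Least[of j "\<lambda>k. 1 / 2 ^ k \<le> norm z"] k_def by auto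
      then show ?thesis using Suc by simp
    qed (use z in auto)
    moreover have "1 / norm z \<le> 2 ^ k" using k z by (simp add: field_simps)
    ultimately have "indicator (ball 0 2) z * ennreal (1 / norm z) \<le> ?a k z"
      using True by (auto simp: indicator_def intro!: ennreal_leI)
    also have "\<dots> \<le> (\<Sum>k. ?a k z)" 
    proof -
      have single: "f k \<le> (\<Sum>k. f k)" for f :: "nat \<Rightarrow> ennreal"
        using sum_le_suminf[of f "{k}"] by simp
      show ?thesis by (rule single)
    qed
    finally show ?thesis .
  qed auto
  then have "kernel_mass \<le> (\<integral>\<^sup>+z. (\<Sum>k. ?a k z) \<partial>lborel)"
    unfolding kernel_mass_def by (rule nn_integral_mono)
  also have "\<dots> = (\<Sum>k. (\<integral>\<^sup>+z. ?a k z \<partial>lborel))"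
    by (rule nn_integral_suminf) measurable
  also have "\<dots> = (\<Sum>k. ennreal (4 * pi * (1/2) ^ k))"
  proof (rule suminf_cong)
    fix k :: nat
    have "emeasure lborel (ball (0::complex) (2 / 2 ^ k)) = ennreal (pi * (2 / 2 ^ k)\<^sup>2)"
      by (simp add: emeasure_ball unit_ball_vol_2 DIM_complex)
    then have "(\<integral>\<^sup>+z. ?a k z \<partial>lborel) = ennreal (2 ^ k * (pi * (2 / 2 ^ k)\<^sup>2))"
      by (simp add: nn_integral_cmult ennreal_mult)
    also have "2 ^ k * (pi * (2 / 2 ^ k)\<^sup>2) = 4 * pi * (1/2) ^ k"
      by (simp add: field_simps power2_eq_square)
    finally show "(\<integral>\<^sup>+z. ?a k z \<partial>lborel) = ennreal (4 * pi * (1/2) ^ k)" .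
  qed
  also have "\<dots> < \<infinity>"
  proof -
    have "summable (\<lambda>k. 4 * pi * (1/2) ^ k :: real)" by (intro summable_mult summable_geometric) simp
    then show ?thesis by (subst suminf_ennreal2) auto
  qed
  finally show ?thesis .
qed

lemma kernel_mass_bound:
  fixes w :: complex
  assumes "norm w \<le> 1"
  shows "(\<integral>\<^sup>+z. indicator (ball 0 1) z * ennreal (1 / norm (z - w)) \<partial>lborel) \<le> kernel_mass"
proof -
  have "(\<integral>\<^sup>+z. indicator (ball 0 1) z * ennreal (1 / norm (z - w)) \<partial>lborel)
      \<le> (\<integral>\<^sup>+z. indicator (ball 0 2) (z - w) * ennreal (1 / norm (z - w)) \<partial>lborel)"
  proof (intro nn_integral_mono mult_right_mono)
    fix z
    have "norm (z - w) < 2" if "norm z < 1" using norm_triangle_ineq4[of z w] assms that by linarith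
    then show "indicator (ball 0 1) z \<le> (indicator (ball 0 2) (z - w) :: ennreal)"
      by (auto simp: indicator_def)
  qed simp
  also have "\<dots> = (\<integral>\<^sup>+z. indicator (ball 0 2) z * ennreal (1 / norm z) \<partial>(distr lborel borel (\<lambda>z. - w + z)))"
    by (subst nn_integral_distr) measurable
  also have "\<dots> = kernel_mass"
    unfolding lborel_distr_plus kernel_mass_def ..
  finally show ?thesis .
qed

text \<open>The tangent at \<open>s\<close> lies below the convex function x^p. Convexity is used on
  the open half-line, so t = 0 is checked by hand.\<close>

lemma powr_tangent:
  fixes p s t :: real
  assumes "1 \<le> p" "0 < s" "0 \<le> t"
  shows "s powr p + p * s powr (p - 1) * (t - s) \<le> t powr p"
proof (cases "t = 0")
  case True
  have "s powr (p - 1) * s = s powr p" using assms by (simp add: powr_mult_base powr_diff)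
  then have "s powr p + p * s powr (p - 1) * (t - s) = (1 - p) * s powr p"
    using True by (simp add: algebra_simps)
  also have "\<dots> \<le> 0" using assms by (simp add: mult_nonpos_nonneg)
  finally show ?thesis using True by simp
next
  case False
  then have t: "t > 0" using assms by simp
  have "p * s powr (p - 1) * (t - s) \<le> t powr p - s powr p"
  proof (rule convex_on_imp_above_tangent[OF powr_convex[OF assms(1)]])
    show "((\<lambda>x. x powr p) has_real_derivative p * s powr (p - 1)) (at s within {0<..})"
      using assms by (auto intro!: derivative_eq_intros)
  qed (use t assms in \<open>auto simp: interior_open\<close>)
  then show ?thesis by simp
qed

text \<open>Jensen's inequality, obtained by integrating a tangent line. This form accepts mere
  bounds for the mass and for the integral of \<open>f\<close>, and infinite integrals, so it can be
  applied before any convergence is known.\<close>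

lemma nn_integral_Jensen_powr:
  fixes p y m :: real
  assumes p: "1 \<le> p" and m: "0 < m" "emeasure N (space N) \<le> ennreal m"
    and f [measurable]: "f \<in> borel_measurable N" and f0: "\<And>x. 0 \<le> f x"
    and y: "0 \<le> y" "ennreal y \<le> (\<integral>\<^sup>+x. ennreal (f x) \<partial>N)"
  shows "ennreal (y powr p) \<le> ennreal (m powr (p - 1)) * (\<integral>\<^sup>+x. ennreal (f x powr p) \<partial>N)"
proof (cases "y = 0 \<or> (\<integral>\<^sup>+x. ennreal (f x powr p) \<partial>N) = \<infinity>")
  case True
  then show ?thesis using m p by (auto simp: ennreal_mult_eq_top_iff ennreal_mult_top)
next
  case False
  then obtain j where j: "(\<integral>\<^sup>+x. ennreal (f x powr p) \<partial>N) = ennreal j" "0 \<le> j"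
    by (metis ennreal_cases infinity_ennreal_def)
  \<comment> \<open>\<open>y / m\<close> would be the mean of \<open>f\<close> if its integral were
    \<open>y\<close> and the mass \<open>m\<close>. There p s^(p-1) y = p s^p m, and the integrated
    tangent inequality collapses to s^p m <= j.\<close>
  define s where "s = y / m"
  have s: "s > 0" "s * m = y" using False y m by (auto simp: s_def)
  have sp: "s powr p = s powr (p - 1) * s" using s by (simp add: powr_mult_base powr_diff)
  have "ennreal (p * s powr (p - 1) * y) = ennreal (p * s powr (p - 1)) * ennreal y"
    using p y by (simp add: ennreal_mult)
  also have "\<dots> \<le> ennreal (p * s powr (p - 1)) * (\<integral>\<^sup>+x. ennreal (f x) \<partial>N)"
    using y by (intro mult_left_mono) auto
  also have "\<dots> = (\<integral>\<^sup>+x. ennreal (p * s powr (p - 1)) * ennreal (f x) \<partial>N)"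
    by (rule nn_integral_cmult[symmetric]) measurable
  also have "\<dots> \<le> (\<integral>\<^sup>+x. ennreal (f x powr p) + ennreal ((p - 1) * s powr p) \<partial>N)"
  proof (rule nn_integral_mono)
    fix x
    have "p * s powr (p - 1) * f x \<le> f x powr p + (p - 1) * s powr p"
      using powr_tangent[OF p s(1) f0[of x]] by (simp add: sp algebra_simps)
    then show "ennreal (p * s powr (p - 1)) * ennreal (f x) \<le> ennreal (f x powr p) + ennreal ((p - 1) * s powr p)"
      using p f0[of x] by (simp add: ennreal_mult[symmetric] ennreal_plus[symmetric] ennreal_leI del: ennreal_plus)
  qed
  also have "\<dots> = ennreal j + ennreal ((p - 1) * s powr p) * emeasure N (space N)"
    by (subst nn_integral_add) (auto simp: j(1))
  also have "\<dots> \<le> ennreal j + ennreal ((p - 1) * s powr p) * ennreal m"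
    by (intro add_left_mono mult_left_mono m) simp
  also have "\<dots> = ennreal (j + (p - 1) * s powr p * m)"
    using j p m by (simp add: ennreal_mult ennreal_plus)
  finally have "p * s powr (p - 1) * y \<le> j + (p - 1) * s powr p * m"
    using j p m by (subst (asm) ennreal_le_iff) auto
  then have "s powr p * m \<le> j"
    by (simp add: sp s(2)[symmetric] algebra_simps)
  then have "m powr (p - 1) * (s powr p * m) \<le> m powr (p - 1) * j"
    by (intro mult_left_mono) auto
  also have "m powr (p - 1) * (s powr p * m) = y powr p"
  proof -
    have "m powr (p - 1) * m = m powr p" using m by (simp add: powr_mult_base powr_diff)
    moreover have "y powr p = s powr p * m powr p" using s m by (simp flip: s(2) add: powr_mult)
    ultimately show ?thesis by (simp add: mult_ac)
  qed
  finally show ?thesis using j by (simp add: ennreal_mult[symmetric] ennreal_leI)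
qed

text \<open>A non-integrable function has integral 0 by convention. So the Cauchy transform can be
  estimated at every pole, convergent or not.\<close>

lemma norm_lebesgue_integral_le_nn_integral:
  fixes f :: "'a \<Rightarrow> 'b::{banach, second_countable_topology}"
  shows "ennreal (norm (integral\<^sup>L M f)) \<le> (\<integral>\<^sup>+x. ennreal (norm (f x)) \<partial>M)"
proof (cases "integrable M f")
  case True then show ?thesis by (rule integral_norm_bound_ennreal)
qed (simp add: not_integrable_integral_eq)

text \<open>The kernel mass enters twice: Jensen in \<open>z\<close> for the density 1/|z - w| gives
  m^(p-1), and after exchanging the integrals the symmetric kernel, integrated in \<open>w\<close>,
  gives one more factor m.\<close>

lemma cauchy_transform_Lp_bound:
  fixes p :: real and \<phi> :: "complex \<Rightarrow> complex"
  assumes p: "1 \<le> p" and [measurable]: "\<phi> \<in> borel_measurable borel" and supp: "\<And>z. z \<notin> ball 0 1 \<Longrightarrow> \<phi> z = 0"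
    and m: "0 < m" "kernel_mass \<le> ennreal m"
  shows "(\<integral>\<^sup>+w. indicator (ball 0 1) w * ennreal (norm (LINT z|lborel. \<phi> z / (z - w)) powr p) \<partial>lborel)
    \<le> ennreal (m powr p) * (\<integral>\<^sup>+z. ennreal (norm (\<phi> z) powr p) \<partial>lborel)"
proof -
  let ?I = "indicator (ball 0 1) :: complex \<Rightarrow> ennreal"
  let ?k = "\<lambda>w z. ?I z * ennreal (1 / norm (z - w))"
  have [measurable]: "ball (0::complex) 1 \<in> sets borel" by simp
  have "?I w * ennreal (norm (LINT z|lborel. \<phi> z / (z - w)) powr p)
     \<le> ennreal (m powr (p - 1)) * (\<integral>\<^sup>+z. ?I w * ?k w z * ennreal (norm (\<phi> z) powr p) \<partial>lborel)" for w
  proof (cases "w \<in> ball 0 1")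
    case True
    have "ennreal (norm (LINT z|lborel. \<phi> z / (z - w)) powr p)
      \<le> ennreal (m powr (p - 1)) * (\<integral>\<^sup>+z. ennreal (norm (\<phi> z) powr p) \<partial>density lborel (?k w))"
    proof (rule nn_integral_Jensen_powr[OF p m(1)])
      have "emeasure (density lborel (?k w)) (space (density lborel (?k w))) = (\<integral>\<^sup>+z. ?k w z \<partial>lborel)"
        by (simp add: emeasure_density)
      also have "\<dots> \<le> ennreal m"
        using kernel_mass_bound[of w] True m(2) by (auto intro: order_trans)
      finally show "emeasure (density lborel (?k w)) (space (density lborel (?k w))) \<le> ennreal m" .
      have "ennreal (norm (LINT z|lborel. \<phi> z / (z - w))) \<le> (\<integral>\<^sup>+z. ennreal (norm (\<phi> z / (z - w))) \<partial>lborel)"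
        by (rule norm_lebesgue_integral_le_nn_integral)
      also have "\<dots> = (\<integral>\<^sup>+z. ?k w z * ennreal (norm (\<phi> z)) \<partial>lborel)"
        using supp by (intro nn_integral_cong) (auto simp: indicator_def norm_divide ennreal_mult[symmetric])
      also have "\<dots> = (\<integral>\<^sup>+z. ennreal (norm (\<phi> z)) \<partial>density lborel (?k w))"
        by (subst nn_integral_density) auto
      finally show "ennreal (norm (LINT z|lborel. \<phi> z / (z - w))) \<le> (\<integral>\<^sup>+z. ennreal (norm (\<phi> z)) \<partial>density lborel (?k w))" .
    qed auto
    then show ?thesis using True by (simp add: nn_integral_density)
  qed simp
  then have "(\<integral>\<^sup>+w. ?I w * ennreal (norm (LINT z|lborel. \<phi> z / (z - w)) powr p) \<partial>lborel)
    \<le> (\<integral>\<^sup>+w. ennreal (m powr (p - 1)) * (\<integral>\<^sup>+z. ?I w * ?k w z * ennreal (norm (\<phi> z) powr p) \<partial>lborel) \<partial>lborel)"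
    by (rule nn_integral_mono)
  also have "\<dots> = ennreal (m powr (p - 1)) * (\<integral>\<^sup>+w. (\<integral>\<^sup>+z. ?I w * ?k w z * ennreal (norm (\<phi> z) powr p) \<partial>lborel) \<partial>lborel)"
    by (rule nn_integral_cmult) measurable
  also have "(\<integral>\<^sup>+w. (\<integral>\<^sup>+z. ?I w * ?k w z * ennreal (norm (\<phi> z) powr p) \<partial>lborel) \<partial>lborel)
     = (\<integral>\<^sup>+z. (\<integral>\<^sup>+w. ?I w * ?k w z * ennreal (norm (\<phi> z) powr p) \<partial>lborel) \<partial>lborel)"
    by (rule lborel_pair.Fubini') measurable
  also have "\<dots> \<le> (\<integral>\<^sup>+z. ennreal m * ennreal (norm (\<phi> z) powr p) \<partial>lborel)"
  proof (rule nn_integral_mono)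
    fix z :: complex
    have "(\<integral>\<^sup>+w. ?I w * ?k w z * ennreal (norm (\<phi> z) powr p) \<partial>lborel) =
       (\<integral>\<^sup>+w. ?I w * ennreal (1 / norm (w - z)) \<partial>lborel) * (?I z * ennreal (norm (\<phi> z) powr p))"
    proof (subst nn_integral_multc[symmetric])
      show "(\<integral>\<^sup>+w. ?I w * ?k w z * ennreal (norm (\<phi> z) powr p) \<partial>lborel) =
        (\<integral>\<^sup>+w. ?I w * ennreal (1 / norm (w - z)) * (?I z * ennreal (norm (\<phi> z) powr p)) \<partial>lborel)"
        by (intro nn_integral_cong) (simp only: norm_minus_commute[of _ z] mult_ac)
    qed measurable
    also have "\<dots> \<le> ennreal m * ennreal (norm (\<phi> z) powr p)"
    proof (cases "z \<in> ball 0 1")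
      case True
      then have "norm z \<le> 1" by simp
      then show ?thesis using order_trans[OF kernel_mass_bound[of z] m(2)] True by (simp add: mult_right_mono)
    qed simp
    finally show "(\<integral>\<^sup>+w. ?I w * ?k w z * ennreal (norm (\<phi> z) powr p) \<partial>lborel) \<le> ennreal m * ennreal (norm (\<phi> z) powr p)" .
  qed
  also have "\<dots> = ennreal m * (\<integral>\<^sup>+z. ennreal (norm (\<phi> z) powr p) \<partial>lborel)"
    by (rule nn_integral_cmult) measurable
  finally have "(\<integral>\<^sup>+w. ?I w * ennreal (norm (LINT z|lborel. \<phi> z / (z - w)) powr p) \<partial>lborel)
    \<le> ennreal (m powr (p - 1)) * (ennreal m * (\<integral>\<^sup>+z. ennreal (norm (\<phi> z) powr p) \<partial>lborel))"
    by (simp add: mult_left_mono)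
  also have "\<dots> = ennreal (m powr p) * (\<integral>\<^sup>+z. ennreal (norm (\<phi> z) powr p) \<partial>lborel)"
  proof -
    have "m powr (p - 1) * m = m powr p" using m by (simp add: powr_mult_base powr_diff)
    then show ?thesis using m by (simp add: mult.assoc[symmetric] ennreal_mult[symmetric])
  qed
  finally show ?thesis .
qed

section \<open>The Cauchy-Pompeiu formula\<close>

lemma integrable_bounded_support:
  fixes f :: "'a::euclidean_space \<Rightarrow> 'b::{banach, second_countable_topology}"
  assumes f: "f \<in> borel_measurable borel" and B: "\<And>x. norm (f x) \<le> B" and K: "bounded K" "\<And>x. x \<notin> K \<Longrightarrow> f x = 0"
  shows "integrable lborel f"
proof -
  obtain R where R: "K \<subseteq> cball 0 R" using K(1) unfolding bounded_any_center[of K 0] by (auto simp: subset_iff)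
  have "integrable lborel (\<lambda>x. indicat_real (cball 0 R) x *\<^sub>R B)"
    by (intro integrable_scaleR_left integrable_real_indicator) (simp_all add: emeasure_lborel_cball_finite[unfolded infinity_ennreal_def])
  then show ?thesis
  proof (rule Bochner_Integration.integrable_bound)
    show "AE x in lborel. norm (f x) \<le> norm (indicat_real (cball 0 R) x *\<^sub>R B)"
    proof (intro AE_I2)
      fix x show "norm (f x) \<le> norm (indicat_real (cball 0 R) x *\<^sub>R B)"
      proof (cases "x \<in> K")
        case True
        then have "x \<in> cball 0 R" using R by blast
        then show ?thesis using B[of x] by simp
      qed (simp add: K(2))
    qed
  qed (use f in simp)
qed

lemma lborel_integral_complex:
  fixes h :: "complex \<Rightarrow> complex"
  assumes h: "integrable lborel h"
  shows "(LINT z|lborel. h z) = (LINT x|lborel. LINT y|lborel. h (Complex x y))" (is ?thesis1)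
    and "(LINT z|lborel. h z) = (LINT y|lborel. LINT x|lborel. h (Complex x y))" (is ?thesis2)
    and "AE x in lborel. integrable lborel (\<lambda>y. h (Complex x y))" (is ?thesis3)
    and "AE y in lborel. integrable lborel (\<lambda>x. h (Complex x y))" (is ?thesis4)
proof -
  have m: "(\<lambda>(x, y). Complex x y) \<in> (lborel \<Otimes>\<^sub>M lborel) \<rightarrow>\<^sub>M borel"
    by (simp add: case_prod_beta)
  have d: "distr (lborel \<Otimes>\<^sub>M lborel) borel (\<lambda>(x, y). Complex x y) = lborel"
    unfolding lborel_prod by (rule distr_lborel_Complex)
  have [measurable]: "h \<in> borel_measurable borel" using h by simp
  have "integrable (lborel \<Otimes>\<^sub>M lborel) (\<lambda>p. h ((\<lambda>(x, y). Complex x y) p))"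
    using h unfolding d[symmetric] by (subst (asm) integrable_distr_eq[OF m]) auto
  then have int: "integrable (lborel \<Otimes>\<^sub>M lborel) (\<lambda>(x, y). h (Complex x y))"
    by (simp add: case_prod_beta')
  have eq: "(LINT z|lborel. h z) = (LINT (x, y)|(lborel \<Otimes>\<^sub>M lborel). h (Complex x y))"
    by (subst d[symmetric], subst integral_distr[OF m]) (auto simp: case_prod_beta')
  show ?thesis1 unfolding eq using lborel_pair.integral_fst[OF int] by simp
  show ?thesis2 unfolding eq using lborel_pair.integral_snd[OF int] by simp
  show ?thesis3 using lborel_pair.AE_integrable_fst[OF int] by simp
  show ?thesis4 using lborel_pair.AE_integrable_snd[OF int] by simp
qed

text \<open>The fundamental theorem tolerates that \<open>u'\<close> is a derivative only off a
  finite set. Outside [-R,R] the function \<open>u\<close> is locally 0, so uniqueness of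
  derivatives forces u' = 0 there, again off \<open>S\<close>.\<close>

lemma integral_derivative_compact_support:
  fixes u :: "real \<Rightarrow> complex"
  assumes int: "integrable lborel u'" and u: "continuous_on UNIV u" and S: "finite S"
    and d: "\<And>x. x \<notin> S \<Longrightarrow> (u has_vector_derivative u' x) (at x)"
    and R: "R > 0" and supp: "\<And>x. \<bar>x\<bar> \<ge> R \<Longrightarrow> u x = 0"
  shows "(LINT x|lborel. u' x) = 0"
proof -
  have int': "integrable lborel (\<lambda>x. if x \<in> {-R..R} then u' x else 0)"
  proof -
    have "(\<lambda>x. if x \<in> {-R..R} then u' x else 0) = (\<lambda>x. indicat_real {-R..R} x *\<^sub>R u' x)" by (auto simp: fun_eq_iff)
    then show ?thesis using integrable_mult_indicator[OF _ int, of "{-R..R}"] by simp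
  qed
  have z: "u' x = 0" if "x \<notin> {-R..R}" "x \<notin> S" for x
  proof -
    have "(u has_vector_derivative 0) (at x)"
    proof (rule has_vector_derivative_transform_within_open[of "\<lambda>_. 0"])
      show "open (- {-R..R})" by (simp add: open_Compl)
    qed (use that supp in \<open>auto simp: abs_if\<close>)
    then show ?thesis using vector_derivative_unique_at[OF d[OF that(2)]] by simp
  qed
  have "AE x in lborel. x \<notin> S"
    using finite_imp_null_set_lborel[OF S] AE_not_in by blast
  then have ae: "AE x in lborel. u' x = (if x \<in> {-R..R} then u' x else 0)"
    by eventually_elim (use z in auto)
  have "(u' has_integral (u R - u (- R))) {-R..R}"
    by (rule fundamental_theorem_of_calculus_strong[OF S _ d]) (use R u in \<open>auto intro: continuous_on_subset\<close>)
  then have "(u' has_integral 0) {-R..R}" using supp R by simp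
  then have "((\<lambda>x. if x \<in> {-R..R} then u' x else 0) has_integral 0) UNIV"
    by (simp only: has_integral_restrict_UNIV)
  moreover have "((\<lambda>x. if x \<in> {-R..R} then u' x else 0) has_integral (LINT x|lborel. (if x \<in> {-R..R} then u' x else 0))) UNIV"
    by (rule has_integral_integral_lborel[OF int'])
  ultimately have "(LINT x|lborel. (if x \<in> {-R..R} then u' x else 0)) = 0"
    using has_integral_unique by blast
  moreover have "(LINT x|lborel. u' x) = (LINT x|lborel. (if x \<in> {-R..R} then u' x else 0))"
    by (rule integral_cong_AE[OF _ _ ae]) (use int int' in \<open>auto dest: borel_measurable_integrable\<close>)
  ultimately show ?thesis by simp
qed

text \<open>The exceptional set is a circle below, where the truncated Cauchy kernel has a corner.\<close>

lemma integral_dbar_compact_support: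
  fixes u :: "complex \<Rightarrow> complex"
  assumes u: "continuous_on UNIV u"
    and d: "\<And>z. z \<notin> E \<Longrightarrow> (u has_derivative u' z) (at z)"
    and E: "\<And>x. finite {y. Complex x y \<in> E}" "\<And>y. finite {x. Complex x y \<in> E}"
    and int: "integrable lborel (\<lambda>z. u' z 1)" "integrable lborel (\<lambda>z. u' z \<i>)"
    and supp: "\<And>z. z \<notin> ball 0 R \<Longrightarrow> u z = 0" and R: "R > 0"
  shows "(LINT z|lborel. u' z 1 + \<i> * u' z \<i>) = 0"
proof -
  have "(LINT z|lborel. u' z 1) = 0"
  proof -
    have "AE y in lborel. (LINT x|lborel. u' (Complex x y) 1) = 0"
      using lborel_integral_complex(4)[OF int(1)]
    proof eventually_elim
      fix y assume "integrable lborel (\<lambda>x. u' (Complex x y) 1)"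
      then show "(LINT x|lborel. u' (Complex x y) 1) = 0"
      proof (rule integral_derivative_compact_support[OF _ _ E(2)[of y] _ R])
        show "continuous_on UNIV (\<lambda>x. u (Complex x y))"
          by (rule continuous_on_compose2[OF u]) (auto simp: Complex_eq intro!: continuous_intros)
        show "((\<lambda>x. u (Complex x y)) has_vector_derivative u' (Complex x y) 1) (at x)"
          if "x \<notin> {x. Complex x y \<in> E}" for x
        proof -
          have l: "((\<lambda>x. Complex x y) has_derivative (\<lambda>t. of_real t)) (at x)"
            unfolding Complex_eq by (auto intro!: derivative_eq_intros)
          have D: "(u has_derivative u' (Complex x y)) (at (Complex x y))" using d that by simp
          have "linear (u' (Complex x y))" using D has_derivative_linear by blast
          then have "u' (Complex x y) (of_real t) = t *\<^sub>R u' (Complex x y) 1" for t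
            using linear_cmul[of "u' (Complex x y)" t 1] by (simp add: scaleR_conv_of_real)
          then show ?thesis
            using has_derivative_compose[OF l D] by (simp add: has_vector_derivative_def)
        qed
        show "u (Complex x y) = 0" if "\<bar>x\<bar> \<ge> R" for x
          using supp[of "Complex x y"] abs_Re_le_cmod[of "Complex x y"] that by auto
      qed
    qed
    then have "(LINT y|lborel. LINT x|lborel. u' (Complex x y) 1) = (LINT y|(lborel::real measure). 0 :: complex)"
      using int(1) by (intro integral_cong_AE) auto
    then show ?thesis using lborel_integral_complex(2)[OF int(1)] by simp
  qed
  moreover have "(LINT z|lborel. u' z \<i>) = 0"
  proof -
    have "AE x in lborel. (LINT y|lborel. u' (Complex x y) \<i>) = 0"
      using lborel_integral_complex(3)[OF int(2)]
    proof eventually_elim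
      fix x assume "integrable lborel (\<lambda>y. u' (Complex x y) \<i>)"
      then show "(LINT y|lborel. u' (Complex x y) \<i>) = 0"
      proof (rule integral_derivative_compact_support[OF _ _ E(1)[of x] _ R])
        show "continuous_on UNIV (\<lambda>y. u (Complex x y))"
          by (rule continuous_on_compose2[OF u]) (auto simp: Complex_eq intro!: continuous_intros)
        show "((\<lambda>y. u (Complex x y)) has_vector_derivative u' (Complex x y) \<i>) (at y)"
          if "y \<notin> {y. Complex x y \<in> E}" for y
        proof -
          have l: "((\<lambda>y. Complex x y) has_derivative (\<lambda>t. \<i> * of_real t)) (at y)"
            unfolding Complex_eq by (auto intro!: derivative_eq_intros)
          have D: "(u has_derivative u' (Complex x y)) (at (Complex x y))" using d that by simp
          have "linear (u' (Complex x y))" using D has_derivative_linear by blast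
          then have "u' (Complex x y) (\<i> * of_real t) = t *\<^sub>R u' (Complex x y) \<i>" for t
            using linear_cmul[of "u' (Complex x y)" t \<i>] by (simp add: scaleR_conv_of_real mult.commute)
          then show ?thesis
            using has_derivative_compose[OF l D] by (simp add: has_vector_derivative_def)
        qed
        show "u (Complex x y) = 0" if "\<bar>y\<bar> \<ge> R" for y
          using supp[of "Complex x y"] abs_Im_le_cmod[of "Complex x y"] that by auto
      qed
    qed
    then have "(LINT x|lborel. LINT y|lborel. u' (Complex x y) \<i>) = (LINT x|(lborel::real measure). 0 :: complex)"
      using int(2) by (intro integral_cong_AE) auto
    then show ?thesis using lborel_integral_complex(1)[OF int(2)] by simp
  qed
  ultimately show ?thesis using int by simp
qed


section \<open>The truncated kernel and its limit, the Cauchy-Pompeiu formula\<close>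

text \<open>The Cauchy kernel \<open>1/z\<close> truncated to \<open>cnj z / r\<^sup>2\<close> on the disc of radius \<open>r\<close>, where its
  \<open>\<partial>/\<partial>z\<bar>\<close> is constant.\<close>

definition trunc_kernel :: "real \<Rightarrow> complex \<Rightarrow> complex" where
  "trunc_kernel r z = cnj z / of_real (max ((norm z)\<^sup>2) (r\<^sup>2))"

text \<open>On the circle |z| = r, where the truncated kernel has a corner, the value is a
  convention; the circle goes into the exceptional set.\<close>

definition trunc_kernel_deriv :: "real \<Rightarrow> complex \<Rightarrow> complex \<Rightarrow> complex" where
  "trunc_kernel_deriv r z v = (if norm z < r then cnj v / of_real (r\<^sup>2) else - v / z\<^sup>2)"

lemma trunc_kernel_inside: "norm z \<le> r \<Longrightarrow> trunc_kernel r z = cnj z / of_real (r\<^sup>2)"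
  using power_mono[of "norm z" r 2] by (simp add: trunc_kernel_def max_def)

lemma trunc_kernel_outside: 
  assumes "r > 0" "norm z \<ge> r"
  shows "trunc_kernel r z = 1 / z"
proof -
  have z: "z \<noteq> 0" using assms by auto
  have "trunc_kernel r z = cnj z / of_real ((norm z)\<^sup>2)"
    using power_mono[of r "norm z" 2] assms by (simp add: trunc_kernel_def max_def)
  also have "of_real ((norm z)\<^sup>2) = z * cnj z" by (rule complex_norm_square)
  finally show ?thesis using z by simp
qed

text \<open>The first bound is uniform in \<open>r\<close> and dominates the limit r -> 0. The
  second, for fixed \<open>r\<close>, makes products with bounded functions of bounded support
  integrable.\<close>

lemma norm_trunc_kernel:
  assumes r: "r > 0"
  shows "norm (trunc_kernel r z) \<le> 1 / norm z" "norm (trunc_kernel r z) \<le> 1 / r"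
proof -
  have "norm (trunc_kernel r z) \<le> 1 / norm z \<and> norm (trunc_kernel r z) \<le> 1 / r"
  proof (cases "norm z \<le> r")
    case True
    have "norm z * norm z \<le> r * r" "norm z * r \<le> r * r" using True r by (auto intro: mult_mono)
    moreover have eq: "norm (trunc_kernel r z) = norm z / (r * r)"
      using r by (simp add: trunc_kernel_inside[OF True] norm_divide norm_power power2_eq_square norm_mult)
    ultimately show ?thesis unfolding eq using r by (cases "z = 0") (auto simp: field_simps)
  next
    case False
    then show ?thesis using r by (auto simp: trunc_kernel_outside norm_divide divide_simps)
  qed
  then show "norm (trunc_kernel r z) \<le> 1 / norm z" "norm (trunc_kernel r z) \<le> 1 / r" by auto
qed

lemma continuous_on_trunc_kernel: "r > 0 \<Longrightarrow> continuous_on UNIV (trunc_kernel r)"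
  unfolding trunc_kernel_def
  by (intro continuous_intros) (auto simp: max_def not_le intro: zero_less_power)

lemma trunc_kernel_has_derivative:
  assumes r: "r > 0" and z: "norm z \<noteq> r"
  shows "(trunc_kernel r has_derivative trunc_kernel_deriv r z) (at z)"
proof (cases "norm z < r")
  case True
  have "((\<lambda>z. cnj z / of_real (r\<^sup>2)) has_derivative (\<lambda>v. cnj v / of_real (r\<^sup>2))) (at z)"
    by (rule bounded_linear_imp_has_derivative)
       (rule bounded_linear_compose[OF bounded_linear_divide bounded_linear_cnj])
  then have "(trunc_kernel r has_derivative (\<lambda>v. cnj v / of_real (r\<^sup>2))) (at z)"
    by (rule has_derivative_transform_within_open[of _ _ _ _ "ball 0 r"])
       (use True in \<open>auto simp: trunc_kernel_inside\<close>)
  moreover have "trunc_kernel_deriv r z = (\<lambda>v. cnj v / of_real (r\<^sup>2))"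
    using True by (simp add: trunc_kernel_deriv_def fun_eq_iff)
  ultimately show ?thesis by simp
next
  case False
  then have zr: "norm z > r" "z \<noteq> 0" using z r by auto
  have "((\<lambda>z. 1 / z) has_field_derivative (- 1 / z\<^sup>2)) (at z)"
    using zr by (auto intro!: derivative_eq_intros simp: power2_eq_square)
  then have "((\<lambda>z. 1 / z) has_derivative (\<lambda>v. - v / z\<^sup>2)) (at z)"
    unfolding has_field_derivative_def by (rule has_derivative_eq_rhs) (auto simp: fun_eq_iff)
  then have "(trunc_kernel r has_derivative (\<lambda>v. - v / z\<^sup>2)) (at z)"
  proof (rule has_derivative_transform_within_open[of _ _ _ _ "- cball 0 r"])
    show "open (- cball (0::complex) r)" by (simp add: open_Compl)
  qed (use zr r in \<open>auto simp: trunc_kernel_outside\<close>)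
  moreover have "trunc_kernel_deriv r z = (\<lambda>v. - v / z\<^sup>2)"
    using False by (simp add: trunc_kernel_deriv_def fun_eq_iff)
  ultimately show ?thesis by simp
qed

lemma norm_trunc_kernel_deriv:
  assumes r: "r > 0"
  shows "norm (trunc_kernel_deriv r z v) \<le> norm v / r\<^sup>2"
proof (cases "norm z < r")
  case False
  then have "r\<^sup>2 \<le> (norm z)\<^sup>2" using r by (intro power_mono) auto
  then show ?thesis using False r by (auto simp: trunc_kernel_deriv_def norm_divide norm_power intro!: divide_left_mono mult_pos_pos)
qed (simp add: trunc_kernel_deriv_def norm_divide norm_power)

text \<open>A line parallel to an axis meets a circle in at most two points, as
  \<open>integral_dbar_compact_support\<close> requires of its exceptional set. The quadratic
  equation for the free coordinate shows it.\<close>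

lemma finite_circle_section:
  "finite {y. norm (Complex x y - \<zeta>) = r}" "finite {x. norm (Complex x y - \<zeta>) = r}"
proof -
  have sq: "finite {t::real. (t - a)\<^sup>2 = b}" for a b
  proof (rule finite_subset)
    show "{t. (t - a)\<^sup>2 = b} \<subseteq> {a + sqrt b, a - sqrt b}"
    proof
      fix t assume "t \<in> {t. (t - a)\<^sup>2 = b}"
      then have "sqrt b = \<bar>t - a\<bar>" by auto
      then show "t \<in> {a + sqrt b, a - sqrt b}" by (auto simp: abs_if split: if_splits)
    qed
  qed simp
  have n: "(x - Re \<zeta>)\<^sup>2 + (y - Im \<zeta>)\<^sup>2 = r\<^sup>2" if "norm (Complex x y - \<zeta>) = r" for x y
    using that cmod_power2[of "Complex x y - \<zeta>"] by simp
  have "{y. norm (Complex x y - \<zeta>) = r} \<subseteq> {y. (y - Im \<zeta>)\<^sup>2 = r\<^sup>2 - (x - Re \<zeta>)\<^sup>2}"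
  proof clarify
    fix y assume "r = norm (Complex x y - \<zeta>)"
    from n[OF this[symmetric]] show "(y - Im \<zeta>)\<^sup>2 = (norm (Complex x y - \<zeta>))\<^sup>2 - (x - Re \<zeta>)\<^sup>2"
      by (simp add: \<open>r = _\<close>)
  qed
  then show "finite {y. norm (Complex x y - \<zeta>) = r}"
    by (rule finite_subset) (rule sq)
  have "{x. norm (Complex x y - \<zeta>) = r} \<subseteq> {x. (x - Re \<zeta>)\<^sup>2 = r\<^sup>2 - (y - Im \<zeta>)\<^sup>2}"
  proof clarify
    fix x assume "r = norm (Complex x y - \<zeta>)"
    from n[OF this[symmetric]] show "(x - Re \<zeta>)\<^sup>2 = (norm (Complex x y - \<zeta>))\<^sup>2 - (y - Im \<zeta>)\<^sup>2"
      by (simp add: \<open>r = _\<close>)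
  qed
  then show "finite {x. norm (Complex x y - \<zeta>) = r}"
    by (rule finite_subset) (rule sq)
qed

lemma bounded_of_compact_support:
  fixes f :: "'a::euclidean_space \<Rightarrow> 'b::real_normed_vector"
  assumes f: "continuous_on UNIV f" and K: "bounded K" "\<And>x. x \<notin> K \<Longrightarrow> f x = 0"
  obtains B where "B > 0" "\<And>x. norm (f x) \<le> B"
proof -
  have "compact (f ` closure K)"
    using f K(1) by (intro compact_continuous_image) (auto intro: continuous_on_subset)
  then obtain B where B: "B > 0" "\<And>y. y \<in> f ` closure K \<Longrightarrow> norm y \<le> B"
    using compact_imp_bounded bounded_pos by metis
  show ?thesis
  proof (rule that[OF B(1)])
    fix x show "norm (f x) \<le> B"
      using B K(2)[of x] closure_subset[of K] by (cases "x \<in> K") auto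
  qed
qed

lemma integrable_div_kernel:
  fixes f :: "complex \<Rightarrow> complex"
  assumes [measurable]: "f \<in> borel_measurable borel" and B: "\<And>z. norm (f z) \<le> B"
    and supp: "\<And>z. z \<notin> ball 0 1 \<Longrightarrow> f z = 0" and w: "norm w \<le> 1"
  shows "integrable lborel (\<lambda>z. f z / (z - w))"
proof (rule integrableI_bounded)
  have B0: "0 \<le> B" using order_trans[OF norm_ge_zero B] .
  have "(\<integral>\<^sup>+z. ennreal (norm (f z / (z - w))) \<partial>lborel)
     \<le> (\<integral>\<^sup>+z. ennreal B * (indicator (ball 0 1) z * ennreal (1 / norm (z - w))) \<partial>lborel)"
  proof (rule nn_integral_mono)
    fix z
    show "ennreal (norm (f z / (z - w))) \<le> ennreal B * (indicator (ball 0 1) z * ennreal (1 / norm (z - w)))"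
    proof (cases "z \<in> ball 0 1")
      case True
      have "norm (f z / (z - w)) \<le> B * (1 / norm (z - w))"
        unfolding norm_divide using mult_right_mono[OF B[of z], of "1 / norm (z - w)"] by simp
      then show ?thesis using True B0 by (simp add: ennreal_mult[symmetric] ennreal_leI)
    qed (simp add: supp)
  qed
  also have "\<dots> = ennreal B * (\<integral>\<^sup>+z. indicator (ball 0 1) z * ennreal (1 / norm (z - w)) \<partial>lborel)"
    by (rule nn_integral_cmult) measurable
  also have "\<dots> \<le> ennreal B * kernel_mass"
    by (intro mult_left_mono kernel_mass_bound w) simp
  also have "\<dots> < \<infinity>" using kernel_mass_finite by (simp add: ennreal_mult_less_top)
  finally show "(\<integral>\<^sup>+z. ennreal (norm (f z / (z - w))) \<partial>lborel) < \<infinity>" .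
qed measurable

text \<open>The dbar of \<phi> times the kernel truncated at radius r about \<zeta> integrates to 0.
  That kernel is holomorphic outside the small disc and has constant dbar 1/r^2 inside, so it
  contributes pi times the mean of \<phi> over the disc, which tends to pi \<phi>(\<zeta>) as r ->
  0. An area mean thus replaces the boundary integral of the classical proof.\<close>

theorem Cauchy_Pompeiu_compact_support:
  fixes \<phi> :: "complex \<Rightarrow> complex"
  assumes d: "\<And>z. (\<phi> has_derivative \<phi>' z) (at z)"
    and c: "\<And>v. continuous_on UNIV (\<lambda>z. \<phi>' z v)"
    and supp: "\<And>z. z \<notin> ball 0 1 \<Longrightarrow> \<phi> z = 0" "\<And>z v. z \<notin> ball 0 1 \<Longrightarrow> \<phi>' z v = 0"
    and \<zeta>: "norm \<zeta> \<le> 1"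
  shows "(LINT z|lborel. (\<phi>' z 1 + \<i> * \<phi>' z \<i>) / 2 / (z - \<zeta>)) = - of_real pi * \<phi> \<zeta>"
proof -
  define b where "b z = (\<phi>' z 1 + \<i> * \<phi>' z \<i>) / 2" for z
  have cont\<phi>: "continuous_on UNIV \<phi>"
    using d has_derivative_continuous by (intro continuous_at_imp_continuous_on) blast
  have contb: "continuous_on UNIV b" unfolding b_def by (intro continuous_intros c) simp
  have bsupp: "b z = 0" if "z \<notin> ball 0 1" for z using supp(2)[OF that] by (simp add: b_def)
  have [measurable]: "\<phi> \<in> borel_measurable borel" "b \<in> borel_measurable borel" "\<And>v. (\<lambda>z. \<phi>' z v) \<in> borel_measurable borel"
    using cont\<phi> contb c by (auto intro: borel_measurable_continuous_onI)
  obtain B where B: "B > 0" "\<And>x. norm (\<phi> x) \<le> B"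
    using bounded_of_compact_support[OF cont\<phi> bounded_ball supp(1)] by blast
  obtain B2 where B2: "B2 > 0" "\<And>x. norm (b x) \<le> B2"
    using bounded_of_compact_support[OF contb bounded_ball bsupp] by blast
  have tk [measurable]: "trunc_kernel r \<in> borel_measurable borel" if "r > 0" for r
    using continuous_on_trunc_kernel[OF that] by (rule borel_measurable_continuous_onI)
  have tkd [measurable]: "(\<lambda>z. trunc_kernel_deriv r z v) \<in> borel_measurable borel" for r v
    unfolding trunc_kernel_deriv_def by measurable
  have ibp: "(LINT z|lborel. b z * trunc_kernel r (z - \<zeta>)) = - (LINT z|lborel. indicat_real (ball \<zeta> r) z *\<^sub>R \<phi> z) / of_real (r\<^sup>2)"
    if r: "r > 0" for r
  proof -
    note tk [OF r, measurable]
    let ?u = "\<lambda>z. \<phi> z * trunc_kernel r (z - \<zeta>)"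
    let ?u' = "\<lambda>z v. \<phi> z * trunc_kernel_deriv r (z - \<zeta>) v + \<phi>' z v * trunc_kernel r (z - \<zeta>)"
    have int1: "integrable lborel (\<lambda>z. \<phi> z * trunc_kernel_deriv r (z - \<zeta>) v)" for v
    proof (rule integrable_bounded_support[OF _ _ bounded_ball[of 0 1]])
      show "norm (\<phi> z * trunc_kernel_deriv r (z - \<zeta>) v) \<le> B * (norm v / r\<^sup>2)" for z
        unfolding norm_mult using B r by (intro mult_mono norm_trunc_kernel_deriv) auto
    qed (use supp(1) in auto)
    have int2: "integrable lborel (\<lambda>z. \<phi>' z v * trunc_kernel r (z - \<zeta>))" for v
    proof -
      obtain B' where B': "B' > 0" "\<And>x. norm (\<phi>' x v) \<le> B'"
        using bounded_of_compact_support[OF c bounded_ball supp(2)] by blast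
      show ?thesis
      proof (rule integrable_bounded_support[OF _ _ bounded_ball[of 0 1]])
        show "norm (\<phi>' z v * trunc_kernel r (z - \<zeta>)) \<le> B' * (1 / r)" for z
          unfolding norm_mult using B' r by (intro mult_mono norm_trunc_kernel) auto
      qed (use supp(2) in auto)
    qed
    \<comment> \<open>Twice the dbar is written out; dbar of \<open>cnj z / r^2\<close> is 1/r^2,
      whence the factor 2 / r^2 on the disc.\<close>
    have eq: "?u' z 1 + \<i> * ?u' z \<i> = 2 * (b z * trunc_kernel r (z - \<zeta>)) + 2 / of_real (r\<^sup>2) * (indicat_real (ball \<zeta> r) z *\<^sub>R \<phi> z)" for z
      by (auto simp: trunc_kernel_deriv_def b_def indicator_def dist_norm norm_minus_commute field_simps)
    have "(LINT z|lborel. ?u' z 1 + \<i> * ?u' z \<i>) = 0"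
    proof (rule integral_dbar_compact_support[where E = "{z. norm (z - \<zeta>) = r}" and R = 1])
      show "continuous_on UNIV ?u"
        by (intro continuous_intros cont\<phi> continuous_on_compose2[OF continuous_on_trunc_kernel[OF r]]) auto
      show "(?u has_derivative ?u' z) (at z)" if "z \<notin> {z. norm (z - \<zeta>) = r}" for z
      proof (rule has_derivative_mult[OF d])
        have "((\<lambda>z. z - \<zeta>) has_derivative (\<lambda>v. v)) (at z)" by (auto intro!: derivative_eq_intros)
        from has_derivative_compose[OF this, of "trunc_kernel r" "trunc_kernel_deriv r (z - \<zeta>)"]
        show "((\<lambda>z. trunc_kernel r (z - \<zeta>)) has_derivative trunc_kernel_deriv r (z - \<zeta>)) (at z)"
          using trunc_kernel_has_derivative[OF r] that by auto
      qed
      show "finite {y. Complex x y \<in> {z. norm (z - \<zeta>) = r}}" "finite {y. Complex y x \<in> {z. norm (z - \<zeta>) = r}}" for x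
        using finite_circle_section by simp_all
    qed (use int1 int2 supp in \<open>auto\<close>)
    then have "(LINT z|lborel. 2 * (b z * trunc_kernel r (z - \<zeta>)) + 2 / of_real (r\<^sup>2) * (indicat_real (ball \<zeta> r) z *\<^sub>R \<phi> z)) = 0"
      unfolding eq .
    moreover have "integrable lborel (\<lambda>z. b z * trunc_kernel r (z - \<zeta>))"
    proof (rule integrable_bounded_support[OF _ _ bounded_ball[of 0 1]])
      show "norm (b z * trunc_kernel r (z - \<zeta>)) \<le> B2 * (1 / r)" for z
        unfolding norm_mult using B2 r by (intro mult_mono norm_trunc_kernel) auto
    qed (use bsupp in auto)
    moreover have "integrable lborel (\<lambda>z. indicat_real (ball \<zeta> r) z *\<^sub>R \<phi> z)"
    proof (rule integrable_bounded_support[OF _ _ bounded_ball[of 0 1]])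
      show "norm (indicat_real (ball \<zeta> r) z *\<^sub>R \<phi> z) \<le> B" for z
        using B by (auto simp: indicator_def intro: less_imp_le)
    qed (use supp(1) in auto)
    ultimately have "2 * (LINT z|lborel. b z * trunc_kernel r (z - \<zeta>)) + 2 / of_real (r\<^sup>2) * (LINT z|lborel. indicat_real (ball \<zeta> r) z *\<^sub>R \<phi> z) = 0"
      by (simp only: Bochner_Integration.integral_add integrable_mult_right integral_mult_right_zero)
    moreover have "X = - Y / c" if "2 * X + 2 / c * Y = 0" for X Y c :: complex
    proof -
      have "2 * (X + Y / c) = 0" using that by (simp add: distrib_left)
      then have "X + Y / c = 0" by (metis mult_eq_0_iff zero_neq_numeral)
      then show ?thesis by (simp add: eq_neg_iff_add_eq_0)
    qed
    ultimately show ?thesis by blast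
  qed
  define R where "R n = 1 / real (Suc n)" for n
  have R: "R n > 0" for n by (simp add: R_def)
  have R0: "R \<longlonglongrightarrow> 0" unfolding R_def using LIMSEQ_inverse_real_of_nat by (simp add: inverse_eq_divide)
  have "(\<lambda>n. LINT z|lborel. b z * trunc_kernel (R n) (z - \<zeta>)) \<longlonglongrightarrow> (LINT z|lborel. b z / (z - \<zeta>))"
  proof (rule integral_dominated_convergence)
    show "integrable lborel (\<lambda>z. norm (b z / (z - \<zeta>)))"
      using integrable_div_kernel[OF _ B2(2) bsupp \<zeta>] by (intro integrable_norm) simp
    show "(\<lambda>z. b z * trunc_kernel (R n) (z - \<zeta>)) \<in> borel_measurable lborel" for n
      using tk[OF R, measurable] by simp
    show "AE z in lborel. norm (b z * trunc_kernel (R n) (z - \<zeta>)) \<le> norm (b z / (z - \<zeta>))" for n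
    proof (intro AE_I2)
      fix z show "norm (b z * trunc_kernel (R n) (z - \<zeta>)) \<le> norm (b z / (z - \<zeta>))"
        using mult_left_mono[OF norm_trunc_kernel(1)[OF R, of n "z - \<zeta>"], of "norm (b z)"] by (simp add: norm_mult norm_divide)
    qed
    show "AE z in lborel. (\<lambda>n. b z * trunc_kernel (R n) (z - \<zeta>)) \<longlonglongrightarrow> b z / (z - \<zeta>)"
    proof (intro AE_I2)
      fix z
      show "(\<lambda>n. b z * trunc_kernel (R n) (z - \<zeta>)) \<longlonglongrightarrow> b z / (z - \<zeta>)"
      \<comment> \<open>At z = \<zeta> both sides are 0: the truncated kernel vanishes at 0, and x /
        0 = 0.\<close>
      proof (cases "z = \<zeta>")
        case False
        then have "eventually (\<lambda>n. R n < norm (z - \<zeta>)) sequentially"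
          using order_tendstoD(2)[OF R0, of "norm (z - \<zeta>)"] by simp
        then have "eventually (\<lambda>n. b z * trunc_kernel (R n) (z - \<zeta>) = b z / (z - \<zeta>)) sequentially"
          by eventually_elim (use R in \<open>simp add: trunc_kernel_outside\<close>)
        then show ?thesis by (rule tendsto_eventually)
      qed (simp add: trunc_kernel_def)
    qed
  qed measurable
  moreover have "(\<lambda>n. LINT z|lborel. b z * trunc_kernel (R n) (z - \<zeta>)) \<longlonglongrightarrow> - of_real pi * \<phi> \<zeta>"
  proof (rule LIMSEQ_I)
    fix e :: real assume e: "e > 0"
    \<comment> \<open>The integral over the disc carries the area pi r^2 and is divided by r^2, so
      an oscillation of e / (2 pi) costs e / 2.\<close>
    define e' where "e' = e / (2 * pi)"
    have e': "e' > 0" using e by (simp add: e'_def)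
    have "isCont \<phi> \<zeta>" using cont\<phi> by (simp add: continuous_on_eq_continuous_at)
    then obtain \<delta> where \<delta>: "\<delta> > 0" "\<And>z. dist z \<zeta> < \<delta> \<Longrightarrow> dist (\<phi> z) (\<phi> \<zeta>) < e'"
      using e' unfolding continuous_at_eps_delta by blast
    obtain N where N: "\<And>n. n \<ge> N \<Longrightarrow> R n < \<delta>"
      using order_tendstoD(2)[OF R0 \<delta>(1)] by (auto simp: eventually_sequentially)
    show "\<exists>N. \<forall>n\<ge>N. norm ((LINT z|lborel. b z * trunc_kernel (R n) (z - \<zeta>)) - - of_real pi * \<phi> \<zeta>) < e"
    proof (intro exI allI impI)
      fix n assume n: "n \<ge> N"
      let ?i = "indicat_real (ball \<zeta> (R n))"
      have area: "measure lborel (ball \<zeta> (R n)) = pi * (R n)\<^sup>2"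
        using R[of n] by (simp add: content_ball unit_ball_vol_2)
      have fin: "emeasure lborel (ball \<zeta> (R n)) < \<infinity>" by (rule emeasure_lborel_ball_finite)
      have ii: "integrable lborel (\<lambda>z. ?i z *\<^sub>R c)" for c :: "'z::{banach, second_countable_topology}"
        using fin by (intro integrable_scaleR_left integrable_real_indicator) simp_all
      have i\<phi>: "integrable lborel (\<lambda>z. ?i z *\<^sub>R \<phi> z)"
      proof (rule integrable_bounded_support[OF _ _ bounded_ball[of 0 1]])
        show "norm (?i z *\<^sub>R \<phi> z) \<le> B" for z
          using B by (auto simp: indicator_def intro: less_imp_le)
      qed (use supp(1) in auto)
      have c: "(LINT z|lborel. ?i z *\<^sub>R c) = of_real (pi * (R n)\<^sup>2) * c" for c :: complex
        using fin area by (simp add: scaleR_conv_of_real)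
      have "(LINT z|lborel. ?i z *\<^sub>R \<phi> z) - of_real (pi * (R n)\<^sup>2) * \<phi> \<zeta> = (LINT z|lborel. ?i z *\<^sub>R (\<phi> z - \<phi> \<zeta>))"
        unfolding c[symmetric] scaleR_diff_right using Bochner_Integration.integral_diff[OF i\<phi> ii] by simp
      also have "norm \<dots> \<le> (LINT z|lborel. ?i z *\<^sub>R e')"
      proof (rule order_trans[OF integral_norm_bound Bochner_Integration.integral_mono])
        show "integrable lborel (\<lambda>z. norm (?i z *\<^sub>R (\<phi> z - \<phi> \<zeta>)))"
          unfolding scaleR_diff_right by (intro integrable_norm Bochner_Integration.integrable_diff i\<phi> ii)
        show "norm (?i z *\<^sub>R (\<phi> z - \<phi> \<zeta>)) \<le> ?i z *\<^sub>R e'" for z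
          using \<delta>(2)[of z] N[OF n] by (auto simp: indicator_def dist_norm norm_minus_commute)
      qed (rule ii)
      also have "\<dots> = pi * (R n)\<^sup>2 * e'"
        using fin area by simp
      finally have *: "norm ((LINT z|lborel. ?i z *\<^sub>R \<phi> z) - of_real (pi * (R n)\<^sup>2) * \<phi> \<zeta>) \<le> pi * (R n)\<^sup>2 * e'" .
      have "(LINT z|lborel. b z * trunc_kernel (R n) (z - \<zeta>)) - - of_real pi * \<phi> \<zeta> =
        - (((LINT z|lborel. ?i z *\<^sub>R \<phi> z) - of_real (pi * (R n)\<^sup>2) * \<phi> \<zeta>) / of_real ((R n)\<^sup>2))"
        unfolding ibp[OF R] using R[of n] by (simp add: field_simps)
      then have "norm ((LINT z|lborel. b z * trunc_kernel (R n) (z - \<zeta>)) - - of_real pi * \<phi> \<zeta>)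
         = norm ((LINT z|lborel. ?i z *\<^sub>R \<phi> z) - of_real (pi * (R n)\<^sup>2) * \<phi> \<zeta>) / (R n)\<^sup>2"
        using R[of n] by (simp only: norm_minus_cancel norm_divide norm_of_real) simp
      also have "\<dots> \<le> pi * (R n)\<^sup>2 * e' / (R n)\<^sup>2"
        by (intro divide_right_mono *) simp
      also have "\<dots> = e / 2" using R[of n] by (simp add: e'_def)
      also have "\<dots> < e" using e by simp
      finally show "norm ((LINT z|lborel. b z * trunc_kernel (R n) (z - \<zeta>)) - - of_real pi * \<phi> \<zeta>) < e" .
    qed
  qed
  ultimately have "(LINT z|lborel. b z / (z - \<zeta>)) = - of_real pi * \<phi> \<zeta>"
    using LIMSEQ_unique by blast
  then show ?thesis by (simp add: b_def)
qed

section \<open>Null sets and the Hartogs triangle\<close>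

lemma AE_lborel_swap_pair:
  fixes P :: "'a::euclidean_space \<times> 'b::euclidean_space \<Rightarrow> bool"
  assumes "AE w in lborel. P w"
  shows "AE y in lborel. AE x in lborel. P (x, y)"
proof -
  obtain N where N: "\<And>w. w \<in> space lborel - N \<Longrightarrow> P w" "N \<in> null_sets lborel"
    using AE_E3[OF assms] by metis
  have sets: "N \<in> sets (lborel \<Otimes>\<^sub>M lborel)" using N(2) unfolding lborel_prod by auto
  have "AE w in lborel \<Otimes>\<^sub>M lborel. w \<notin> N" using AE_not_in[OF N(2)] unfolding lborel_prod .
  then have "AE x in lborel. AE y in lborel. (x, y) \<notin> N"
    by (rule lborel_pair.AE_pair)
  then have "AE y in lborel. AE x in lborel. (x, y) \<notin> N"
    by (subst (asm) lborel_pair.AE_commute) (use sets.compl_sets[OF sets] in \<open>simp add: set_diff_eq\<close>)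
  then show ?thesis
    by (auto elim!: eventually_mono intro: N(1))
qed

lemma AE_lborel_fst:
  fixes P :: "'a::euclidean_space \<Rightarrow> bool"
  assumes "AE x in lborel. P x"
  shows "AE w in lborel. P (fst (w :: 'a \<times> 'b::euclidean_space))"
proof -
  obtain N where N: "\<And>x. x \<in> space lborel - N \<Longrightarrow> P x" "N \<in> null_sets lborel"
    using AE_E3[OF assms] by metis
  have "N \<times> UNIV \<in> null_sets (lborel \<Otimes>\<^sub>M (lborel :: 'b measure))"
    using N(2) by (auto simp: null_sets_def lborel.emeasure_pair_measure_Times)
  then have "AE w in lborel. w \<notin> N \<times> (UNIV :: 'b set)"
    unfolding lborel_prod by (rule AE_not_in)
  then show ?thesis by (auto elim!: eventually_mono intro: N(1))
qed

lemma AE_lborel_snd: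
  fixes P :: "'a::euclidean_space \<Rightarrow> bool"
  assumes "AE x in lborel. P x"
  shows "AE w in lborel. P (snd (w :: 'b::euclidean_space \<times> 'a))"
proof -
  obtain N where N: "\<And>x. x \<in> space lborel - N \<Longrightarrow> P x" "N \<in> null_sets lborel"
    using AE_E3[OF assms] by metis
  have "UNIV \<times> N \<in> null_sets ((lborel :: 'b measure) \<Otimes>\<^sub>M lborel)"
    using N(2) by (auto simp: null_sets_def lborel.emeasure_pair_measure_Times)
  then have "AE w in lborel. w \<notin> (UNIV :: 'b set) \<times> N"
    unfolding lborel_prod by (rule AE_not_in)
  then show ?thesis by (auto elim!: eventually_mono intro: N(1))
qed

text \<open>The bridge between the Lebesgue-measurable data, known up to null sets, and Borel
  representatives extended by 0, on which Fubini and the substitution are carried out.\<close>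

lemma set_integral_lebesgue_eq_lborel:
  fixes u U :: "'a::euclidean_space \<Rightarrow> 'b::euclidean_space"
  assumes \<Omega>: "\<Omega> \<in> sets borel" and U: "U \<in> borel_measurable borel" "\<And>x. x \<notin> \<Omega> \<Longrightarrow> U x = 0"
    and ae: "AE x in lborel. x \<in> \<Omega> \<longrightarrow> u x = U x"
  shows "(\<lambda>x. indicat_real \<Omega> x *\<^sub>R u x) \<in> borel_measurable lebesgue"
    and "(LINT x:\<Omega>|lebesgue. u x) = (LINT x|lborel. U x)"
    and "integrable lborel U \<Longrightarrow> set_integrable lebesgue \<Omega> u"
proof -
  have U': "U \<in> borel_measurable lebesgue" using U by (simp add: measurable_completion)
  have ae': "AE x in lebesgue. U x = indicat_real \<Omega> x *\<^sub>R u x"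
    by (rule AE_completion) (use ae U(2) in \<open>auto elim!: eventually_mono simp: indicator_def\<close>)
  show m: "(\<lambda>x. indicat_real \<Omega> x *\<^sub>R u x) \<in> borel_measurable lebesgue"
    by (rule borel_measurable_AE[OF U' ae'])
  have "(LINT x:\<Omega>|lebesgue. u x) = (LINT x|lebesgue. U x)"
    unfolding set_lebesgue_integral_def by (rule integral_cong_AE[OF m U']) (use ae' in \<open>auto elim!: eventually_mono\<close>)
  then show "(LINT x:\<Omega>|lebesgue. u x) = (LINT x|lborel. U x)"
    using U by (simp add: integral_completion)
  assume "integrable lborel U"
  then have "integrable lebesgue U" using integrable_completion[of U lborel] U by simp
  then show "set_integrable lebesgue \<Omega> u"
    unfolding set_integrable_def by (rule integrable_cong_AE_imp[OF _ m ae'])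
qed

lemma open_punctured_disc: "open punctured_disc"
proof -
  have eq: "punctured_disc = ball 0 1 - {0}" by (auto simp: punctured_disc_def)
  show ?thesis unfolding eq by (intro open_delete open_ball)
qed

lemma open_disc_prod: "open disc_prod"
  unfolding disc_prod_def by (intro open_Times open_ball open_punctured_disc)

lemma open_hartogs: "open hartogs"
proof -
  have eq: "hartogs = {z. norm (fst z) < norm (snd z)} \<inter> {z. norm (snd z) < 1}"
    by (auto simp: hartogs_def)
  have "open {z :: complex \<times> complex. norm (fst z) < norm (snd z)}" "open {z :: complex \<times> complex. norm (snd z) < 1}"
    by (intro open_Collect_less continuous_intros)+
  then show ?thesis unfolding eq by (rule open_Int)
qed

lemma sets_hartogs [measurable, simp]: "hartogs \<in> sets borel" "disc_prod \<in> sets borel"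
  "punctured_disc \<in> sets borel"
  using open_hartogs open_disc_prod open_punctured_disc by auto

lemma twist_in_hartogs_iff: "snd w \<noteq> 0 \<Longrightarrow> twist w \<in> hartogs \<longleftrightarrow> w \<in> disc_prod"
  by (cases w) (auto simp: twist_def hartogs_def disc_prod_def punctured_disc_def norm_mult)

lemma twist_hartogs_map: "snd z \<noteq> 0 \<Longrightarrow> twist (hartogs_map z) = z"
  by (cases z) (auto simp: twist_def hartogs_map_def)

lemma hartogs_map_twist: "snd w \<noteq> 0 \<Longrightarrow> hartogs_map (twist w) = w"
  by (cases w) (auto simp: twist_def hartogs_map_def)

lemma snd_hartogs_nonzero: "z \<in> hartogs \<Longrightarrow> snd z \<noteq> 0"
  using norm_ge_zero[of "fst z"] by (auto simp: hartogs_def)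

lemma snd_disc_prod_nonzero: "w \<in> disc_prod \<Longrightarrow> snd w \<noteq> 0"
  by (auto simp: disc_prod_def punctured_disc_def)

lemma hartogs_map_in_disc_prod_iff: "snd z \<noteq> 0 \<Longrightarrow> hartogs_map z \<in> disc_prod \<longleftrightarrow> z \<in> hartogs"
  using twist_in_hartogs_iff[of "hartogs_map z"] twist_hartogs_map[of z]
  by (cases z) (auto simp: hartogs_map_def)

lemma borel_measurable_hartogs_map [measurable]: "hartogs_map \<in> borel_measurable borel"
  unfolding hartogs_map_def by (simp add: borel_prod[symmetric] case_prod_beta')

lemma inv_hartogs_map_eq_twist: "w \<in> disc_prod \<Longrightarrow> inv_into hartogs hartogs_map w = twist w"
  by (simp add: inv_hartogs_map twist_def)

lemma borel_measurable_snd_norm [measurable]: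
  "(\<lambda>w :: complex \<times> complex. ennreal ((norm (snd w))\<^sup>2)) \<in> borel_measurable borel"
  "(\<lambda>w :: complex \<times> complex. (norm (snd w))\<^sup>2) \<in> borel_measurable borel"
  by (simp_all add: borel_prod[symmetric])

text \<open>The density |w2|^2 is 0 on the line w2 = 0, so the pushforward gives no information
  there; this explains the premise \<open>snd w \<noteq> 0\<close>.\<close>

lemma AE_twist:
  assumes "AE z in lborel. P z"
  shows "AE w in lborel. snd w \<noteq> 0 \<longrightarrow> P (twist w)"
proof -
  have "AE z in distr (density lborel (\<lambda>w. ennreal ((norm (snd w))\<^sup>2))) borel twist. P z"
    using assms unfolding distr_twist .
  then have "AE w in density lborel (\<lambda>w. ennreal ((norm (snd w))\<^sup>2)). P (twist w)"
    by (rule AE_distrD[rotated]) simp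
  then show ?thesis by (subst (asm) AE_density) (auto elim!: eventually_mono)
qed

lemma AE_snd_nonzero: "AE w in lborel. snd (w :: complex \<times> complex) \<noteq> 0"
  by (rule AE_lborel_snd) (rule AE_lborel_singleton)

text \<open>Preimages of null sets are null, by \<open>nn_integral_twist\<close> for the indicator
  of the preimage. It is applied to \<open>T_op f1 f2\<close>, which is known only almost everywhere
  before it is composed with \<open>hartogs_map\<close>.\<close>

lemma AE_hartogs_map:
  assumes "AE w in lborel. P w"
  shows "AE z in lborel. P (hartogs_map z)"
proof -
  obtain N where N: "\<And>x. x \<in> space lborel - N \<Longrightarrow> P x" "N \<in> null_sets lborel"
    using AE_E3[OF assms] by metis
  have [measurable]: "N \<in> sets borel" using N by auto
  have "emeasure lborel (hartogs_map -` N) = (\<integral>\<^sup>+z. indicator N (hartogs_map z) \<partial>lborel)"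
    by (subst nn_integral_indicator[symmetric])
       (auto simp: indicator_def intro!: nn_integral_cong measurable_sets_borel[OF borel_measurable_hartogs_map])
  also have "\<dots> = (\<integral>\<^sup>+w. indicator N (hartogs_map (twist w)) * ennreal ((norm (snd w))\<^sup>2) \<partial>lborel)"
    by (rule nn_integral_twist[symmetric]) measurable
  also have "\<dots> = (\<integral>\<^sup>+w. 0 \<partial>(lborel :: (complex \<times> complex) measure))"
  proof (rule nn_integral_cong_AE)
    show "AE w in lborel. indicator N (hartogs_map (twist w)) * ennreal ((norm (snd w))\<^sup>2) = 0"
      using AE_snd_nonzero AE_not_in[OF N(2)] by eventually_elim (auto simp: hartogs_map_twist)
  qed
  finally have "hartogs_map -` N \<in> null_sets lborel"
    using measurable_sets_borel[OF borel_measurable_hartogs_map, of N] by (simp add: null_sets_def)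
  then have "AE z in lborel. z \<notin> hartogs_map -` N" by (rule AE_not_in)
  then show ?thesis by (auto elim!: eventually_mono intro: N(1))
qed

lemma integral_twist:
  fixes h :: "complex \<times> complex \<Rightarrow> complex"
  assumes [measurable]: "h \<in> borel_measurable borel"
  shows "(LINT w|lborel. (norm (snd w))\<^sup>2 *\<^sub>R h (twist w)) = (LINT z|lborel. h z)" (is ?thesis1)
    and "integrable lborel (\<lambda>w. (norm (snd w))\<^sup>2 *\<^sub>R h (twist w)) \<longleftrightarrow> integrable lborel h" (is ?thesis2)
proof -
  have m: "twist \<in> measurable (density lborel (\<lambda>w. ennreal ((norm (snd w))\<^sup>2))) borel" by simp
  have "(LINT z|lborel. h z) = (LINT z|distr (density lborel (\<lambda>w. ennreal ((norm (snd w))\<^sup>2))) borel twist. h z)"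
    by (simp add: distr_twist)
  also have "\<dots> = (LINT w|lborel. (norm (snd w))\<^sup>2 *\<^sub>R h (twist w))"
    by (subst integral_distr[OF m]) (auto simp: integral_density)
  finally show ?thesis1 ..
  have "integrable lborel h \<longleftrightarrow> integrable (distr (density lborel (\<lambda>w. ennreal ((norm (snd w))\<^sup>2))) borel twist) h"
    by (simp add: distr_twist)
  also have "\<dots> \<longleftrightarrow> integrable lborel (\<lambda>w. (norm (snd w))\<^sup>2 *\<^sub>R h (twist w))"
    by (subst integrable_distr_eq[OF m]) (auto simp: integrable_density)
  finally show ?thesis2 ..
qed

section \<open>The \<open>\<partial>\<bar>\<close>-operators on test functions\<close>

lemma test_functionsI:
  assumes "\<And>k. cont_diff_on k UNIV \<psi>" "compact K" "K \<subseteq> \<Omega>" "\<And>z. z \<notin> K \<Longrightarrow> \<psi> z = 0"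
  shows "\<psi> \<in> test_functions \<Omega>"
proof -
  have "closure {z. \<psi> z \<noteq> 0} \<subseteq> K"
    using assms(2,4) by (intro closure_minimal compact_imp_closed) auto
  moreover from this have "compact (closure {z. \<psi> z \<noteq> 0})"
    using assms(2) compact_Int_closed[of K "closure {z. \<psi> z \<noteq> 0}"] by (simp add: inf.absorb2)
  ultimately show ?thesis
    using assms(1,3) by (auto simp: test_functions_def cont_diff_on_UNIV)
qed

lemma test_functionsE:
  assumes "\<psi> \<in> test_functions \<Omega>"
  obtains K where "compact K" "K \<subseteq> \<Omega>" "\<And>z. z \<notin> K \<Longrightarrow> \<psi> z = 0" "\<And>k. cont_diff_on k UNIV \<psi>"
proof (rule that)
  show "\<psi> z = 0" if "z \<notin> closure {z. \<psi> z \<noteq> 0}" for z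
    using that subsetD[OF closure_subset, of z "{z. \<psi> z \<noteq> 0}"] by blast
qed (use assms in \<open>simp_all add: test_functions_def cont_diff_on_UNIV\<close>)

lemma test_functions_has_derivative:
  assumes "\<psi> \<in> test_functions \<Omega>"
  shows "(\<psi> has_derivative frechet_derivative \<psi> (at z)) (at z)"
proof -
  obtain K where "\<And>k. cont_diff_on k UNIV \<psi>" using test_functionsE[OF assms] by metis
  then show ?thesis by (rule cont_diff_on_SucE[where k = 0]) simp
qed

lemma has_derivative_slice1:
  fixes \<psi> :: "complex \<times> complex \<Rightarrow> complex"
  assumes "(\<psi> has_derivative D) (at z)"
  shows "((\<lambda>\<zeta>. \<psi> (\<zeta>, snd z)) has_derivative (\<lambda>v. D (v, 0))) (at (fst z))"
proof -
  have "((\<lambda>\<zeta>. (\<zeta>, snd z)) has_derivative (\<lambda>v. (v, 0))) (at (fst z))"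
    by (auto intro!: derivative_eq_intros)
  from has_derivative_compose[OF this, of \<psi> D] assms show ?thesis by simp
qed

lemma has_derivative_slice2:
  fixes \<psi> :: "complex \<times> complex \<Rightarrow> complex"
  assumes "(\<psi> has_derivative D) (at z)"
  shows "((\<lambda>\<zeta>. \<psi> (fst z, \<zeta>)) has_derivative (\<lambda>v. D (0, v))) (at (snd z))"
proof -
  have "((\<lambda>\<zeta>. (fst z, \<zeta>)) has_derivative (\<lambda>v. (0, v))) (at (snd z))"
    by (auto intro!: derivative_eq_intros)
  from has_derivative_compose[OF this, of \<psi> D] assms show ?thesis by simp
qed

lemma wirtinger_bar_eq: "(g has_derivative D) (at z) \<Longrightarrow> wirtinger_bar g z = (D 1 + \<i> * D \<i>) / 2"
  using frechet_derivative_at[of g D z] by (simp add: wirtinger_bar_def)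

lemma dbar_eq:
  assumes "(\<psi> has_derivative D) (at z)"
  shows "dbar1 \<psi> z = (D (1, 0) + \<i> * D (\<i>, 0)) / 2" "dbar2 \<psi> z = (D (0, 1) + \<i> * D (0, \<i>)) / 2"
  using wirtinger_bar_eq[OF has_derivative_slice1[OF assms]] wirtinger_bar_eq[OF has_derivative_slice2[OF assms]]
  by (simp_all add: dbar1_def dbar2_def case_prod_beta)

lemma dbar_mult:
  assumes "(f has_derivative f') (at z)" "(g has_derivative g') (at z)"
  shows "dbar1 (\<lambda>z. f z * g z) z = f z * dbar1 g z + dbar1 f z * g z"
    "dbar2 (\<lambda>z. f z * g z) z = f z * dbar2 g z + dbar2 f z * g z"
  by (simp_all add: dbar_eq[OF has_derivative_mult[OF assms]] dbar_eq[OF assms(1)] dbar_eq[OF assms(2)] field_simps)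

text \<open>The left side is twice the antilinear part of \<open>L\<close> at \<open>c\<close>: for
  L(z) = a z + b cnj z it is 2 b cnj c.\<close>

lemma real_linear_dbar:
  fixes L :: "complex \<Rightarrow> complex"
  assumes "linear L"
  shows "L c + \<i> * L (\<i> * c) = cnj c * (L 1 + \<i> * L \<i>)"
proof -
  have "L (of_real a + \<i> * of_real b) = of_real a * L 1 + of_real b * L \<i>" for a b
    using linear_add[OF assms, of "of_real a" "\<i> * of_real b"] linear_cmul[OF assms, of a 1] linear_cmul[OF assms, of b \<i>]
    by (simp add: scaleR_conv_of_real mult.commute)
  from this[of "Re c" "Im c"] this[of "- Im c" "Re c"]
  have "L c = of_real (Re c) * L 1 + of_real (Im c) * L \<i>" "L (\<i> * c) = - of_real (Im c) * L 1 + of_real (Re c) * L \<i>"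
    using complex_eq[of c] complex_eq[of "\<i> * c"] by simp_all
  then have "L c + \<i> * L (\<i> * c) = (of_real (Re c) * L 1 + of_real (Im c) * L \<i>) + \<i> * (- of_real (Im c) * L 1 + of_real (Re c) * L \<i>)"
    by (simp only:)
  also have "\<dots> = (of_real (Re c) - \<i> * of_real (Im c)) * (L 1 + \<i> * L \<i>)"
    by (simp add: algebra_simps)
  also have "of_real (Re c) - \<i> * of_real (Im c) = cnj c"
    by (simp add: complex_eq_iff)
  finally show ?thesis .
qed

text \<open>No \<open>\<partial>/\<partial>w\<close>-terms of the outer function occur, since the partial derivatives of \<open>f\<close> are complex-linear.\<close>

lemma dbar_compose_holomorphic:
  fixes \<psi> :: "complex \<times> complex \<Rightarrow> complex"
  assumes \<psi>: "(\<psi> has_derivative D) (at (f z))"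
    and f: "(f has_derivative (\<lambda>v. (a * fst v + b * snd v, c * fst v + d * snd v))) (at z)"
  shows "dbar1 (\<lambda>z. \<psi> (f z)) z = cnj a * dbar1 \<psi> (f z) + cnj c * dbar2 \<psi> (f z)"
    "dbar2 (\<lambda>z. \<psi> (f z)) z = cnj b * dbar1 \<psi> (f z) + cnj d * dbar2 \<psi> (f z)"
proof -
  have lin: "linear D" using \<psi> has_derivative_linear by blast
  have l1: "linear (\<lambda>v. D (v, 0))" and l2: "linear (\<lambda>v. D (0, v))"
    using has_derivative_linear[OF has_derivative_slice1[OF \<psi>]] has_derivative_linear[OF has_derivative_slice2[OF \<psi>]] by auto
  have split: "D (u, v) = D (u, 0) + D (0, v)" for u v
    using linear_add[OF lin, of "(u, 0)" "(0, v)"] by simp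
  have comb: "(D (s, t) + \<i> * D (\<i> * s, \<i> * t)) / 2 = cnj s * dbar1 \<psi> (f z) + cnj t * dbar2 \<psi> (f z)" for s t
  proof -
    have "(D (s, t) + \<i> * D (\<i> * s, \<i> * t)) / 2 = ((D (s, 0) + \<i> * D (\<i> * s, 0)) + (D (0, t) + \<i> * D (0, \<i> * t))) / 2"
      by (subst (1 2) split) (simp add: algebra_simps)
    also have "\<dots> = cnj s * dbar1 \<psi> (f z) + cnj t * dbar2 \<psi> (f z)"
      unfolding real_linear_dbar[OF l1, of s] real_linear_dbar[OF l2, of t] dbar_eq[OF \<psi>]
      by (simp add: field_simps)
    finally show ?thesis .
  qed
  show "dbar1 (\<lambda>z. \<psi> (f z)) z = cnj a * dbar1 \<psi> (f z) + cnj c * dbar2 \<psi> (f z)"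
    "dbar2 (\<lambda>z. \<psi> (f z)) z = cnj b * dbar1 \<psi> (f z) + cnj d * dbar2 \<psi> (f z)"
    using comb[of a c] comb[of b d]
    by (simp_all add: dbar_eq[OF has_derivative_compose[OF f \<psi>]] mult.commute)
qed

lemma dbar_test_function:
  assumes \<psi>: "\<psi> \<in> test_functions \<Omega>"
  shows "continuous_on UNIV (dbar1 \<psi>)" "continuous_on UNIV (dbar2 \<psi>)"
proof -
  obtain K where K: "compact K" "K \<subseteq> \<Omega>" "\<And>z. z \<notin> K \<Longrightarrow> \<psi> z = 0" and s: "\<And>k. cont_diff_on k UNIV \<psi>"
    using test_functionsE[OF \<psi>] by metis
  have c: "continuous_on UNIV (\<lambda>z. frechet_derivative \<psi> (at z) v)" for v
    using s[of "Suc 0"] unfolding cont_diff_on.simps by blast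
  have e: "dbar1 \<psi> = (\<lambda>z. (frechet_derivative \<psi> (at z) (1, 0) + \<i> * frechet_derivative \<psi> (at z) (\<i>, 0)) / 2)"
    "dbar2 \<psi> = (\<lambda>z. (frechet_derivative \<psi> (at z) (0, 1) + \<i> * frechet_derivative \<psi> (at z) (0, \<i>)) / 2)"
    using dbar_eq[OF test_functions_has_derivative[OF \<psi>]] by auto
  show "continuous_on UNIV (dbar1 \<psi>)" "continuous_on UNIV (dbar2 \<psi>)"
    unfolding e by (intro continuous_intros c; simp)+
qed

lemma has_derivative_zero_off_support:
  assumes "compact K" "\<And>z. z \<notin> K \<Longrightarrow> \<psi> z = 0" "z \<notin> K"
  shows "(\<psi> has_derivative (\<lambda>_. 0)) (at z)"
proof (rule has_derivative_transform_within_open[of "\<lambda>_. 0"])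
  show "open (- K)" using assms(1) by (simp add: open_Compl compact_imp_closed)
qed (use assms in auto)

lemma dbar_zero_off_support:
  fixes \<psi> :: "complex \<times> complex \<Rightarrow> complex"
  assumes "compact K" "\<And>z. z \<notin> K \<Longrightarrow> \<psi> z = 0" "z \<notin> K"
  shows "dbar1 \<psi> z = 0" "dbar2 \<psi> z = 0"
  using dbar_eq[OF has_derivative_zero_off_support[OF assms]] by simp_all

lemma cont_diff_on_Pair:
  assumes "open S" "cont_diff_on k S f" "cont_diff_on k S g"
  shows "cont_diff_on k S (\<lambda>x. (f x, g x))"
proof -
  have "bounded_linear (\<lambda>x. (x, 0))" "bounded_linear (\<lambda>x. (0, x))"
    by (auto intro!: bounded_linear_Pair bounded_linear_ident bounded_linear_zero)
  then have "cont_diff_on k S (\<lambda>x. (f x, 0) + (0, g x))"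
    using assms by (intro cont_diff_on_add cont_diff_on_linear_comp[of S "\<lambda>x. (x, 0)"] cont_diff_on_linear_comp[of S "\<lambda>x. (0, x)"])
  then show ?thesis by simp
qed

lemma bounded_test_function:
  assumes \<psi>: "\<psi> \<in> test_functions \<Omega>"
  obtains B where "B > 0" "\<And>z. norm (\<psi> z) \<le> B" "\<And>z. norm (dbar1 \<psi> z) \<le> B" "\<And>z. norm (dbar2 \<psi> z) \<le> B"
proof -
  obtain K where K: "compact K" "K \<subseteq> \<Omega>" "\<And>z. z \<notin> K \<Longrightarrow> \<psi> z = 0" and s: "\<And>k. cont_diff_on k UNIV \<psi>"
    using test_functionsE[OF \<psi>] by metis
  note z = dbar_zero_off_support[OF K(1,3)]
  obtain B0 B1 B2 where "B0 > 0" "\<And>z. norm (\<psi> z) \<le> B0" "\<And>z. norm (dbar1 \<psi> z) \<le> B1" "\<And>z. norm (dbar2 \<psi> z) \<le> B2"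
    using bounded_of_compact_support[OF cont_diff_on_imp_continuous_on[OF s] compact_imp_bounded[OF K(1)] K(3)]
      bounded_of_compact_support[OF dbar_test_function(1)[OF \<psi>] compact_imp_bounded[OF K(1)] z(1)]
      bounded_of_compact_support[OF dbar_test_function(2)[OF \<psi>] compact_imp_bounded[OF K(1)] z(2)]
    by metis
  then show ?thesis
    by (intro that[of "max B0 (max B1 B2)"]) (auto intro: order_trans[OF _ max.cobounded1] simp: le_max_iff_disj)
qed

section \<open>The equation on the product domain\<close>

text \<open>The bound is asked only where \<open>f\<close> is nonzero. With \<open>A\<close> for
  \<open>f\<close> this admits the quotient z1 / z2, which is bounded on the Hartogs triangle but
  not on the whole space.\<close>

lemma integrable_mult_bounded:
  fixes f g :: "'a \<Rightarrow> complex"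
  assumes f: "integrable M f" and g: "g \<in> borel_measurable M" "\<And>x. f x \<noteq> 0 \<Longrightarrow> norm (g x) \<le> B"
  shows "integrable M (\<lambda>x. f x * g x)"
proof (rule Bochner_Integration.integrable_bound[OF integrable_mult_right[OF integrable_norm[OF f], of B]])
  show "AE x in M. norm (f x * g x) \<le> norm (B * norm (f x))"
  proof (intro AE_I2)
    fix x show "norm (f x * g x) \<le> norm (B * norm (f x))"
    proof (cases "f x = 0")
      case False
      then have "norm (f x * g x) \<le> B * norm (f x)"
        using mult_right_mono[OF g(2)[OF False], of "norm (f x)"] by (simp add: norm_mult mult.commute)
      then show ?thesis by simp
    qed simp
  qed
qed (use f g in \<open>auto dest: borel_measurable_integrable\<close>)

lemma borel_measurable_fst_snd_complex [measurable]:
  "fst \<in> borel_measurable (borel :: (complex \<times> complex) measure)"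
  "snd \<in> borel_measurable (borel :: (complex \<times> complex) measure)"
  by (simp_all add: borel_prod[symmetric])

lemma borel_measurable_cnj [measurable (raw)]:
  assumes "f \<in> borel_measurable M"
  shows "(\<lambda>x. cnj (f x)) \<in> borel_measurable M"
  using measurable_compose[OF assms, of cnj] borel_measurable_continuous_onI[of cnj] by (simp add: continuous_on_cnj)

lemma hartogs_map_has_derivative:
  assumes "snd z \<noteq> 0"
  shows "(hartogs_map has_derivative (\<lambda>v. (1 / snd z * fst v + (- fst z / (snd z)\<^sup>2) * snd v, 0 * fst v + 1 * snd v))) (at z)"
proof -
  have eq: "hartogs_map = (\<lambda>z. (fst z / snd z, snd z))" by (auto simp: hartogs_map_def fun_eq_iff)
  show ?thesis unfolding eq
    by (rule has_derivative_eq_rhs, (rule derivative_intros | use assms in force)+)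
       (use assms in \<open>auto simp: fun_eq_iff field_simps power2_eq_square\<close>)
qed

lemma inverse_snd_has_derivative:
  fixes z :: "complex \<times> complex"
  assumes "snd z \<noteq> 0"
  shows "((\<lambda>z. inverse (snd z)) has_derivative (\<lambda>v. - (inverse (snd z) * snd v * inverse (snd z)))) (at z)"
  using assms by (auto intro!: derivative_eq_intros)

text \<open>\<open>A\<close> is a Borel representative of \<open>\<alpha>\<^sub>1\<close>, extended by 0, and \<open>\<alpha>\<^sub>2\<close> is eliminated by
  \<open>\<alpha>\<^sub>2 = - (z\<bar>\<^sub>1/z\<bar>\<^sub>2) \<alpha>\<^sub>1\<close>.\<close>

locale radial_form =
  fixes A :: "complex \<times> complex \<Rightarrow> complex"
  assumes A_meas [measurable]: "A \<in> borel_measurable borel"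
    and A_supp: "\<And>z. z \<notin> hartogs \<Longrightarrow> A z = 0"
    and A_int: "integrable lborel A"
    and A_closed: "\<And>\<psi>. \<psi> \<in> test_functions hartogs \<Longrightarrow>
      (LINT z|lborel. A z * dbar2 \<psi> z) = (LINT z|lborel. - (cnj (fst z) / cnj (snd z)) * A z * dbar1 \<psi> z)"
begin

text \<open>A Borel version of the coefficient f1, since \<open>twist\<close> inverts
  \<open>hartogs_map\<close>.\<close>

definition F :: "complex \<times> complex \<Rightarrow> complex" where
  "F w = cnj (snd w) * A (twist w)"

text \<open>The second term of \<open>T_op\<close>: -1/(2 pi i) times the factor 2i of the area form
  is -1/pi.\<close>

definition V :: "complex \<times> complex \<Rightarrow> complex" where
  "V w = - (1 / pi) * (LINT \<zeta>|lborel. F (\<zeta>, snd w) / (\<zeta> - fst w))"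

lemma F_meas [measurable]: "F \<in> borel_measurable borel" "F \<in> borel_measurable (borel \<Otimes>\<^sub>M borel)"
proof -
  show "F \<in> borel_measurable borel" 
    unfolding F_def using measurable_compose[OF borel_measurable_twist A_meas] by measurable
  then show "F \<in> borel_measurable (borel \<Otimes>\<^sub>M borel)" by (simp add: borel_prod)
qed

lemma F_supp: "w \<notin> disc_prod \<Longrightarrow> F w = 0"
  using A_supp twist_in_hartogs_iff[of w] by (cases "snd w = 0") (auto simp: F_def)

text \<open>The Jacobian is w2 cnj w2, and \<open>F\<close> already contains cnj w2. Without the
  factor w2 integrability can fail, for instance when F = 1 / w2^2 on
  \<open>disc_prod\<close>.\<close>

lemma F_int: "integrable lborel (\<lambda>w. F w * snd w)"
proof -
  have "F w * snd w = (norm (snd w))\<^sup>2 *\<^sub>R A (twist w)" for w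
    by (simp add: F_def scaleR_conv_of_real complex_norm_square mult_ac del: of_real_power)
  then show ?thesis using integral_twist(2)[OF A_meas] A_int by simp
qed

text \<open>The substitute for integrability of \<open>F\<close>: the support of a test function is
  compact in \<open>disc_prod\<close>, so it lies in |w2| >= \<delta> for some \<delta> > 0.\<close>

lemma F_int_cut:
  assumes "\<delta> > 0"
  shows "integrable lborel (\<lambda>w. indicat_real {w. \<delta> \<le> norm (snd w)} w *\<^sub>R F w)"
proof (rule Bochner_Integration.integrable_bound[OF integrable_mult_right[OF integrable_norm[OF F_int], of "1 / \<delta>"]])
  show "AE w in lborel. norm (indicat_real {w. \<delta> \<le> norm (snd w)} w *\<^sub>R F w) \<le> norm (1 / \<delta> * norm (F w * snd w))"
  proof (intro AE_I2)
    fix w :: "complex \<times> complex"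
    show "norm (indicat_real {w. \<delta> \<le> norm (snd w)} w *\<^sub>R F w) \<le> norm (1 / \<delta> * norm (F w * snd w))"
    proof (cases "\<delta> \<le> norm (snd w)")
      case True
      then have "\<delta> * norm (F w) \<le> norm (snd w) * norm (F w)" by (rule mult_right_mono) simp
      then show ?thesis using True assms by (simp add: norm_mult field_simps)
    qed simp
  qed
qed measurable

text \<open>Closedness is tested with \<eta>(z) = \<psi>(z1/z2, z2) / z2. The factor 1/z2 is
  holomorphic and passes through dbar, and |w2|^2 / w2 = cnj w2 converts \<open>A\<close> into
  \<open>F\<close>. The \<open>dbar1 \<psi>\<close> terms cancel because \<alpha>2 = - (cnj z1 / cnj
  z2) \<alpha>1 matches the chain rule for z1/z2.\<close>

lemma F_closed:
  assumes \<psi>: "\<psi> \<in> test_functions disc_prod"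
  shows "(LINT w|lborel. F w * dbar2 \<psi> w) = 0"
proof -
  obtain K where K: "compact K" "K \<subseteq> disc_prod" "\<And>z. z \<notin> K \<Longrightarrow> \<psi> z = 0" and s: "\<And>k. cont_diff_on k UNIV \<psi>"
    using test_functionsE[OF \<psi>] by metis
  have [measurable]: "dbar1 \<psi> \<in> borel_measurable borel" "dbar2 \<psi> \<in> borel_measurable borel"
    using dbar_test_function[OF \<psi>] by (auto intro: borel_measurable_continuous_onI)
  define \<eta> where "\<eta> z = \<psi> (hartogs_map z) * inverse (snd z)" for z
  define S where "S = {z :: complex \<times> complex. snd z \<noteq> 0}"
  have oS: "open S" unfolding S_def by (intro open_Collect_neq continuous_intros)
  have contw: "continuous_on UNIV twist" unfolding twist_def by (intro continuous_intros)
  have K': "compact (twist ` K)"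
    using K(1) contw by (intro compact_continuous_image) (auto intro: continuous_on_subset)
  have K'h: "twist ` K \<subseteq> hartogs"
    using K(2) twist_in_hartogs_iff snd_disc_prod_nonzero by blast
  have eta0: "\<eta> z = 0" if "z \<notin> twist ` K" for z
  \<comment> \<open>Where z2 = 0, the convention inverse 0 = 0 gives \<eta> = 0.\<close>
  proof (cases "snd z = 0")
    case False
    then have "hartogs_map z \<notin> K" using that twist_hartogs_map[OF False] by (metis imageI)
    then show ?thesis by (simp add: \<eta>_def K(3))
  qed (simp add: \<eta>_def)
  have eta_test: "\<eta> \<in> test_functions hartogs"
  proof (rule test_functionsI[OF _ K' K'h eta0])
    fix k
    have sndl: "cont_diff_on k S snd" and fstl: "cont_diff_on k S fst"
      by (auto intro!: cont_diff_on_bounded_linear oS bounded_linear_fst bounded_linear_snd)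
    have inv: "cont_diff_on k S (\<lambda>z. inverse (snd z))"
      by (rule cont_diff_on_inverse[OF oS _ sndl]) (simp add: S_def)
    have "cont_diff_on k S (\<lambda>z. (fst z * inverse (snd z), snd z))"
      by (intro cont_diff_on_Pair oS cont_diff_on_mult fstl sndl inv)
    moreover have "(\<lambda>z. (fst z * inverse (snd z), snd z)) = hartogs_map"
      by (auto simp: hartogs_map_def fun_eq_iff divide_inverse)
    ultimately have "cont_diff_on k S hartogs_map" by simp
    then have "cont_diff_on k S (\<lambda>z. \<psi> (hartogs_map z))"
      using cont_diff_on_compose[OF oS open_UNIV _ _ s] by blast
    then have 1: "cont_diff_on k S \<eta>" unfolding \<eta>_def by (intro cont_diff_on_mult oS inv)
    \<comment> \<open>The set z2 \<noteq> 0 and the complement of the compact set containing the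
      support of \<eta> cover everything, because that compact set lies in the Hartogs triangle;
      \<eta> is smooth on each.\<close>
    have oK: "open (- (twist ` K))" using K' by (simp add: open_Compl compact_imp_closed)
    have "cont_diff_on k (- (twist ` K)) \<eta>"
      using cont_diff_on_cong[OF oK, of \<eta> "\<lambda>_. 0" k] eta0 by simp
    from cont_diff_on_Un[OF oS oK 1 this] show "cont_diff_on k UNIV \<eta>"
    proof -
      have "S \<union> - (twist ` K) = UNIV" using K'h snd_hartogs_nonzero by (auto simp: S_def)
      then show ?thesis using \<open>cont_diff_on k (S \<union> - (twist ` K)) \<eta>\<close> by simp
    qed
  qed
  obtain B where B: "B > 0" "\<And>z. norm (dbar1 \<eta> z) \<le> B" "\<And>z. norm (dbar2 \<eta> z) \<le> B"
    using bounded_test_function[OF eta_test] by metis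
  have [measurable]: "dbar1 \<eta> \<in> borel_measurable borel" "dbar2 \<eta> \<in> borel_measurable borel"
    using dbar_test_function[OF eta_test] by (auto intro: borel_measurable_continuous_onI)
  have dbar_eta: "dbar1 \<eta> z = cnj (1 / snd z) * dbar1 \<psi> (hartogs_map z) * inverse (snd z)"
    "dbar2 \<eta> z = (cnj (- fst z / (snd z)\<^sup>2) * dbar1 \<psi> (hartogs_map z) + dbar2 \<psi> (hartogs_map z)) * inverse (snd z)"
    if z: "snd z \<noteq> 0" for z
  proof -
    note h = hartogs_map_has_derivative[OF z]
    note dpsi = test_functions_has_derivative[OF \<psi>, of "hartogs_map z"]
    note i = inverse_snd_has_derivative[OF z]
    have "dbar1 (\<lambda>z. inverse (snd z)) z = 0" "dbar2 (\<lambda>z. inverse (snd z)) z = 0"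
      using dbar_eq[OF i] by (simp_all add: algebra_simps)
    then show "dbar1 \<eta> z = cnj (1 / snd z) * dbar1 \<psi> (hartogs_map z) * inverse (snd z)"
      "dbar2 \<eta> z = (cnj (- fst z / (snd z)\<^sup>2) * dbar1 \<psi> (hartogs_map z) + dbar2 \<psi> (hartogs_map z)) * inverse (snd z)"
      unfolding \<eta>_def dbar_mult[OF has_derivative_compose[OF h dpsi] i] dbar_compose_holomorphic[OF dpsi h]
      by simp_all
  qed
  have int2: "integrable lborel (\<lambda>z. A z * dbar2 \<eta> z)"
    by (rule integrable_mult_bounded[OF A_int _ B(3)]) simp
  have int1: "integrable lborel (\<lambda>z. - (cnj (fst z) / cnj (snd z)) * A z * dbar1 \<eta> z)"
  proof -
    have "integrable lborel (\<lambda>z. A z * (- (cnj (fst z) / cnj (snd z)) * dbar1 \<eta> z))"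
    proof (rule integrable_mult_bounded[OF A_int])
      show "norm (- (cnj (fst z) / cnj (snd z)) * dbar1 \<eta> z) \<le> 1 * B" if "A z \<noteq> 0" for z
      proof -
        have "norm (fst z) < norm (snd z)" using that A_supp[of z] by (cases z) (auto simp: hartogs_def)
        then have "norm (fst z) / norm (snd z) \<le> 1" by (simp add: divide_simps)
        then show ?thesis unfolding norm_mult norm_minus_cancel norm_divide complex_mod_cnj
          by (intro mult_mono B) auto
      qed
    qed measurable
    then show ?thesis by (simp add: mult_ac)
  qed
  have "(LINT z|lborel. A z * dbar2 \<eta> z - - (cnj (fst z) / cnj (snd z)) * A z * dbar1 \<eta> z) = 0"
    unfolding Bochner_Integration.integral_diff[OF int2 int1] using A_closed[OF eta_test] by simp
  moreover have "A z * dbar2 \<eta> z - - (cnj (fst z) / cnj (snd z)) * A z * dbar1 \<eta> z = A z * dbar2 \<psi> (hartogs_map z) * inverse (snd z)" for z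
  proof (cases "A z = 0")
    case False
    then have z: "snd z \<noteq> 0" using A_supp snd_hartogs_nonzero by blast
    have eq: "cnj (- fst z / (snd z)\<^sup>2) = - (cnj (fst z) / cnj (snd z) * cnj (1 / snd z))"
      by (simp add: power2_eq_square)
    have cancel: "a * ((- (q * c) * d1 + d2) * i) - - q * a * (c * d1 * i) = a * d2 * i" for a q c d1 d2 i :: complex
      by (simp add: algebra_simps)
    show ?thesis unfolding dbar_eta[OF z] eq cancel ..
  qed simp
  ultimately have "0 = (LINT z|lborel. A z * dbar2 \<psi> (hartogs_map z) * inverse (snd z))" by simp
  also have "\<dots> = (LINT w|lborel. (norm (snd w))\<^sup>2 *\<^sub>R (A (twist w) * dbar2 \<psi> (hartogs_map (twist w)) * inverse (snd (twist w))))"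
    by (rule integral_twist(1)[symmetric]) measurable
  also have "\<dots> = (LINT w|lborel. F w * dbar2 \<psi> w)"
  proof (rule integral_cong_AE)
    show "AE w in lborel. (norm (snd w))\<^sup>2 *\<^sub>R (A (twist w) * dbar2 \<psi> (hartogs_map (twist w)) * inverse (snd (twist w))) = F w * dbar2 \<psi> w"
      using AE_snd_nonzero
    proof eventually_elim
      fix w :: "complex \<times> complex" assume w: "snd w \<noteq> 0"
      have "of_real ((norm (snd w))\<^sup>2) * inverse (snd w) = cnj (snd w)"
        using w by (simp add: complex_norm_square del: of_real_power)
      moreover have "snd (twist w) = snd w" by (simp add: twist_def)
      ultimately show "(norm (snd w))\<^sup>2 *\<^sub>R (A (twist w) * dbar2 \<psi> (hartogs_map (twist w)) * inverse (snd (twist w))) = F w * dbar2 \<psi> w"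
        unfolding hartogs_map_twist[OF w] F_def scaleR_conv_of_real by (metis (no_types, opaque_lifting) mult.assoc mult.commute)
    qed
  qed measurable
  finally show ?thesis ..
qed

lemma V_meas [measurable]: "V \<in> borel_measurable borel"
proof -
  have "(\<lambda>w. LINT \<zeta>|lborel. F (\<zeta>, snd w) / (\<zeta> - fst w)) \<in> borel_measurable (borel \<Otimes>\<^sub>M borel)"
    by measurable
  then show ?thesis unfolding V_def by (simp add: borel_prod)
qed

section \<open>Fubini for the Cauchy transform paired with a bounded function supported away from w2
  = 0\<close>

context
  fixes b :: "complex \<times> complex \<Rightarrow> complex" and B \<delta> :: real
  assumes b_meas [measurable]: "b \<in> borel_measurable borel"
    and b_bound: "\<And>w. norm (b w) \<le> B" and \<delta>: "\<delta> > 0"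
    and b_supp: "\<And>w. b w = 0 \<or> w \<in> disc_prod \<and> \<delta> \<le> norm (snd w)"
begin

text \<open>The integrand in the variables w1 and u = (\<zeta>, w2), with \<open>b\<close> standing
  for \<open>dbar1 \<psi>\<close> or \<open>dbar2 \<psi>\<close>. Grouped like this, integrating w1
  at fixed \<open>u\<close> leads to Cauchy-Pompeiu, and integrating \<open>u\<close> at fixed w1
  leads to the closedness of \<open>F\<close>.\<close>

definition P :: "complex \<Rightarrow> complex \<times> complex \<Rightarrow> complex" where
  "P w1 u = F u * b (w1, snd u) / (fst u - w1)"

lemma P_meas [measurable]: "(\<lambda>p. P (fst p) (snd p)) \<in> borel_measurable (borel \<Otimes>\<^sub>M borel)"
proof -
  have [measurable]: "b \<in> borel_measurable (borel \<Otimes>\<^sub>M borel)"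
    using b_meas by (simp add: borel_prod)
  show ?thesis unfolding P_def by measurable
qed

text \<open>For fixed \<open>u\<close> the integral over w1 costs only the kernel mass. The cut-off
  appears because \<open>b (w1, snd u)\<close> can be nonzero only if |snd u| >= \<delta>.\<close>

lemma P_bound:
  "(\<integral>\<^sup>+w1. ennreal (norm (P w1 u)) \<partial>lborel)
    \<le> ennreal (norm (indicat_real {w. \<delta> \<le> norm (snd w)} u *\<^sub>R F u)) * (ennreal B * kernel_mass)"
proof (cases "F u = 0 \<or> \<not> \<delta> \<le> norm (snd u)")
  case True
  then have "P w1 u = 0" for w1 using b_supp[of "(w1, snd u)"] by (auto simp: P_def)
  then show ?thesis by simp
next
  case False
  then have u: "F u \<noteq> 0" "\<delta> \<le> norm (snd u)" by auto
  have B0: "0 \<le> B" using order_trans[OF norm_ge_zero b_bound] .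
  have "u \<in> disc_prod" using u F_supp by blast
  then have fu: "norm (fst u) \<le> 1" by (auto simp: disc_prod_def)
  have "(\<integral>\<^sup>+w1. ennreal (norm (P w1 u)) \<partial>lborel)
     \<le> (\<integral>\<^sup>+w1. ennreal (norm (F u) * B) * (indicator (ball 0 1) w1 * ennreal (1 / norm (w1 - fst u))) \<partial>lborel)"
  proof (rule nn_integral_mono)
    fix w1
    show "ennreal (norm (P w1 u)) \<le> ennreal (norm (F u) * B) * (indicator (ball 0 1) w1 * ennreal (1 / norm (w1 - fst u)))"
    proof (cases "b (w1, snd u) = 0")
      case False
      then have w1: "w1 \<in> ball 0 1" using b_supp[of "(w1, snd u)"] by (auto simp: disc_prod_def)
      have "norm (P w1 u) = norm (F u) * norm (b (w1, snd u)) * (1 / norm (w1 - fst u))"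
        by (simp add: P_def norm_mult norm_divide norm_minus_commute)
      also have "\<dots> \<le> norm (F u) * B * (1 / norm (w1 - fst u))"
        by (intro mult_right_mono mult_left_mono b_bound) auto
      finally show ?thesis using w1 B0 by (simp add: ennreal_mult[symmetric] ennreal_leI)
    qed (simp add: P_def)
  qed
  also have "\<dots> = ennreal (norm (F u) * B) * (\<integral>\<^sup>+w1. indicator (ball 0 1) w1 * ennreal (1 / norm (w1 - fst u)) \<partial>lborel)"
    by (rule nn_integral_cmult) measurable
  also have "\<dots> \<le> ennreal (norm (F u) * B) * kernel_mass"
    by (intro mult_left_mono kernel_mass_bound fu) simp
  also have "\<dots> = ennreal (norm (indicat_real {w. \<delta> \<le> norm (snd w)} u *\<^sub>R F u)) * (ennreal B * kernel_mass)"
    using u B0 by (simp add: ennreal_mult mult.assoc)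
  finally show ?thesis .
qed

lemma P_finite: "(\<integral>\<^sup>+p. ennreal (norm (P (fst p) (snd p))) \<partial>(lborel \<Otimes>\<^sub>M lborel)) < \<infinity>"
proof -
  let ?c = "\<lambda>u. indicat_real {w. \<delta> \<le> norm (snd w)} u *\<^sub>R F u"
  have m: "(\<lambda>p. ennreal (norm (P (fst p) (snd p)))) \<in> borel_measurable (lborel \<Otimes>\<^sub>M lborel)"
    by measurable
  have "(\<integral>\<^sup>+p. ennreal (norm (P (fst p) (snd p))) \<partial>(lborel \<Otimes>\<^sub>M lborel)) = (\<integral>\<^sup>+u. \<integral>\<^sup>+w1. ennreal (norm (P w1 u)) \<partial>lborel \<partial>lborel)"
    by (subst lborel_pair.nn_integral_snd[symmetric, OF m]) simp
  also have "\<dots> \<le> (\<integral>\<^sup>+u. ennreal (norm (?c u)) * (ennreal B * kernel_mass) \<partial>lborel)"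
    by (intro nn_integral_mono P_bound)
  also have "\<dots> = (\<integral>\<^sup>+u. ennreal (norm (?c u)) \<partial>lborel) * (ennreal B * kernel_mass)"
    by (rule nn_integral_multc) measurable
  also have "\<dots> < \<infinity>"
    using F_int_cut[OF \<delta>] kernel_mass_finite by (simp add: integrable_iff_bounded ennreal_mult_less_top)
  finally show ?thesis .
qed

lemma P_integrable: "integrable (lborel \<Otimes>\<^sub>M lborel) (\<lambda>(w1, u). P w1 u)"
  unfolding case_prod_beta' by (rule integrableI_bounded[OF _ P_finite]) measurable

lemma V_mult_eq: "V w * b w = - (1 / pi) * (LINT \<zeta>|lborel. P (fst w) (\<zeta>, snd w))"
proof -
  have "(LINT \<zeta>|lborel. P (fst w) (\<zeta>, snd w)) = (LINT \<zeta>|lborel. F (\<zeta>, snd w) / (\<zeta> - fst w) * b w)"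
    by (intro Bochner_Integration.integral_cong) (auto simp: P_def)
  also have "\<dots> = (LINT \<zeta>|lborel. F (\<zeta>, snd w) / (\<zeta> - fst w)) * b w"
    by (rule integral_mult_left_zero)
  finally show ?thesis by (simp add: V_def)
qed

lemma V_mult_integrable: "integrable lborel (\<lambda>w. V w * b w)"
proof (rule integrableI_bounded)
  have [measurable]: "(\<lambda>p. P (f p) (g p)) \<in> borel_measurable M"
    if "f \<in> M \<rightarrow>\<^sub>M borel" "g \<in> M \<rightarrow>\<^sub>M borel" for f g and M :: "'z measure"
    using measurable_compose[OF measurable_Pair[OF that] P_meas] by simp
  have "(\<integral>\<^sup>+w. ennreal (norm (V w * b w)) \<partial>lborel) \<le> (\<integral>\<^sup>+w. (\<integral>\<^sup>+\<zeta>. ennreal (norm (P (fst w) (\<zeta>, snd w))) \<partial>lborel) \<partial>lborel)"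
  proof (rule nn_integral_mono)
    fix w
    have "norm (V w * b w) = norm (LINT \<zeta>|lborel. P (fst w) (\<zeta>, snd w)) / pi"
      by (simp add: V_mult_eq norm_divide norm_mult)
    also have "\<dots> \<le> norm (LINT \<zeta>|lborel. P (fst w) (\<zeta>, snd w)) / 1"
      using pi_ge_two by (intro divide_left_mono) auto
    finally have "norm (V w * b w) \<le> norm (LINT \<zeta>|lborel. P (fst w) (\<zeta>, snd w))" by simp
    then have "ennreal (norm (V w * b w)) \<le> ennreal (norm (LINT \<zeta>|lborel. P (fst w) (\<zeta>, snd w)))" by (rule ennreal_leI)
    also have "\<dots> \<le> (\<integral>\<^sup>+\<zeta>. ennreal (norm (P (fst w) (\<zeta>, snd w))) \<partial>lborel)"
      by (rule norm_lebesgue_integral_le_nn_integral)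
    finally show "ennreal (norm (V w * b w)) \<le> (\<integral>\<^sup>+\<zeta>. ennreal (norm (P (fst w) (\<zeta>, snd w))) \<partial>lborel)" .
  qed
  also have "\<dots> = (\<integral>\<^sup>+w1. \<integral>\<^sup>+w2. \<integral>\<^sup>+\<zeta>. ennreal (norm (P w1 (\<zeta>, w2))) \<partial>lborel \<partial>lborel \<partial>lborel)"
    unfolding lborel_prod[symmetric]
    by (subst lborel.nn_integral_fst[symmetric]) (auto simp: borel_prod)
  also have "\<dots> = (\<integral>\<^sup>+w1. \<integral>\<^sup>+u. ennreal (norm (P w1 u)) \<partial>lborel \<partial>lborel)"
  proof (intro nn_integral_cong)
    fix w1
    have "(\<lambda>u. ennreal (norm (P w1 u))) \<in> borel_measurable (lborel \<Otimes>\<^sub>M lborel)"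
      unfolding lborel_prod by measurable
    from lborel_pair.nn_integral_snd[OF this]
    show "(\<integral>\<^sup>+w2. \<integral>\<^sup>+\<zeta>. ennreal (norm (P w1 (\<zeta>, w2))) \<partial>lborel \<partial>lborel) = (\<integral>\<^sup>+u. ennreal (norm (P w1 u)) \<partial>lborel)"
      unfolding lborel_prod .
  qed
  also have "\<dots> = (\<integral>\<^sup>+p. ennreal (norm (P (fst p) (snd p))) \<partial>(lborel \<Otimes>\<^sub>M lborel))"
    by (subst lborel.nn_integral_fst[symmetric]) auto
  also note P_finite
  finally show "(\<integral>\<^sup>+w. ennreal (norm (V w * b w)) \<partial>lborel) < \<infinity>" .
qed measurable

lemma V_mult_integral: "(LINT w|lborel. V w * b w) = - (1 / pi) * (LINT w1|lborel. LINT u|lborel. P w1 u)"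
proof -
  have [measurable]: "(\<lambda>p. P (f p) (g p)) \<in> borel_measurable M"
    if "f \<in> M \<rightarrow>\<^sub>M borel" "g \<in> M \<rightarrow>\<^sub>M borel" for f g and M :: "'z measure"
    using measurable_compose[OF measurable_Pair[OF that] P_meas] by simp
  have "(LINT w|lborel. V w * b w) = (LINT w1|lborel. LINT w2|lborel. V (w1, w2) * b (w1, w2))"
    using lborel_pair.integral_fst'[of "\<lambda>w. V w * b w"] V_mult_integrable by (simp add: lborel_prod)
  also have "\<dots> = (LINT w1|lborel. - (1 / pi) * (LINT w2|lborel. LINT \<zeta>|lborel. P w1 (\<zeta>, w2)))"
    unfolding V_mult_eq by simp
  also have "\<dots> = - (1 / pi) * (LINT w1|lborel. LINT w2|lborel. LINT \<zeta>|lborel. P w1 (\<zeta>, w2))"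
    by simp
  also have "(LINT w1|lborel. LINT w2|lborel. LINT \<zeta>|lborel. P w1 (\<zeta>, w2)) = (LINT w1|lborel. LINT u|lborel. P w1 u)"
  proof (rule integral_cong_AE)
    \<comment> \<open>The inner Fubini uses integrability of the slice \<open>P w1\<close>, which is
      available for almost every w1.\<close>
    show "AE w1 in lborel. (LINT w2|lborel. LINT \<zeta>|lborel. P w1 (\<zeta>, w2)) = (LINT u|lborel. P w1 u)"
      using lborel_pair.AE_integrable_fst[OF P_integrable]
    proof eventually_elim
      fix w1 assume "integrable lborel (P w1)"
      then have "integrable (lborel \<Otimes>\<^sub>M lborel) (\<lambda>(\<zeta>, w2). P w1 (\<zeta>, w2))" by (simp add: lborel_prod)
      from lborel_pair.integral_snd[OF this]
      show "(LINT w2|lborel. LINT \<zeta>|lborel. P w1 (\<zeta>, w2)) = (LINT u|lborel. P w1 u)" by (simp add: lborel_prod)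
    qed
    show "(\<lambda>w1. LINT w2|lborel. LINT \<zeta>|lborel. P w1 (\<zeta>, w2)) \<in> borel_measurable lborel"
      by (intro lborel.borel_measurable_lebesgue_integral) (auto simp: borel_prod)
    show "(\<lambda>w1. LINT u|lborel. P w1 u) \<in> borel_measurable lborel"
      by (intro lborel.borel_measurable_lebesgue_integral) auto
  qed
  finally show ?thesis .
qed

end

text \<open>On a compact subset of \<open>disc_prod\<close> the modulus of w2 has a positive
  minimum, which supplies the \<delta> of the cut-off.\<close>

lemma test_function_cut:
  assumes \<psi>: "\<psi> \<in> test_functions disc_prod"
  obtains K B \<delta> where "compact K" "K \<subseteq> disc_prod" "\<And>z. z \<notin> K \<Longrightarrow> \<psi> z = 0" "\<And>k. cont_diff_on k UNIV \<psi>"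
    "\<delta> > 0" "\<And>w. w \<in> K \<Longrightarrow> \<delta> \<le> norm (snd w)" "\<And>z. norm (\<psi> z) \<le> B" "\<And>z. norm (dbar1 \<psi> z) \<le> B" "\<And>z. norm (dbar2 \<psi> z) \<le> B"
proof -
  obtain K where K: "compact K" "K \<subseteq> disc_prod" "\<And>z. z \<notin> K \<Longrightarrow> \<psi> z = 0" and s: "\<And>k. cont_diff_on k UNIV \<psi>"
    using test_functionsE[OF \<psi>] by metis
  have "\<exists>\<delta>>0. \<forall>w\<in>K. \<delta> \<le> norm (snd w)"
  proof (cases "K = {}")
    case False
    have "continuous_on K (\<lambda>w. norm (snd w))" by (intro continuous_intros)
    from continuous_attains_inf[OF K(1) False this]
    obtain w where "w \<in> K" "\<And>x. x \<in> K \<Longrightarrow> norm (snd w) \<le> norm (snd x)" by blast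
    moreover have "snd w \<noteq> 0" using \<open>w \<in> K\<close> K(2) snd_disc_prod_nonzero by blast
    ultimately show ?thesis by (intro exI[of _ "norm (snd w)"]) simp
  qed (auto intro: exI[of _ 1])
  then obtain \<delta> where "\<delta> > 0" "\<And>w. w \<in> K \<Longrightarrow> \<delta> \<le> norm (snd w)" by blast
  moreover obtain B where "\<And>z. norm (\<psi> z) \<le> B" "\<And>z. norm (dbar1 \<psi> z) \<le> B" "\<And>z. norm (dbar2 \<psi> z) \<le> B"
    using bounded_test_function[OF \<psi>] by metis
  ultimately show ?thesis using that[OF K s] by blast
qed

text \<open>Fubini moves the w1 integral inside, where Cauchy-Pompeiu on the disc w2 = const gives -
  pi \<psi>. Its kernel is 1/(w1 - \<zeta>) against 1/(\<zeta> - w1) in \<open>P\<close>; this sign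
  and the -1/pi of \<open>V\<close> leave - F \<psi>.\<close>

lemma V_dbar1:
  assumes \<psi>: "\<psi> \<in> test_functions disc_prod"
  shows "integrable lborel (\<lambda>w. V w * dbar1 \<psi> w)" "(LINT w|lborel. V w * dbar1 \<psi> w) = - (LINT w|lborel. F w * \<psi> w)"
proof -
  obtain K B \<delta> where K: "compact K" "K \<subseteq> disc_prod" "\<And>z. z \<notin> K \<Longrightarrow> \<psi> z = 0" and s: "\<And>k. cont_diff_on k UNIV \<psi>"
    and \<delta>: "\<delta> > 0" "\<And>w. w \<in> K \<Longrightarrow> \<delta> \<le> norm (snd w)" and B: "\<And>z. norm (dbar1 \<psi> z) \<le> B"
    using test_function_cut[OF \<psi>] by metis
  have m: "dbar1 \<psi> \<in> borel_measurable borel"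
    using dbar_test_function[OF \<psi>] by (auto intro: borel_measurable_continuous_onI)
  have supp: "dbar1 \<psi> w = 0 \<or> w \<in> disc_prod \<and> \<delta> \<le> norm (snd w)" for w
    using dbar_zero_off_support(1)[OF K(1), of \<psi> w] K(2,3) \<delta>(2) by blast
  note hyps = m B \<delta>(1) supp
  show "integrable lborel (\<lambda>w. V w * dbar1 \<psi> w)" by (rule V_mult_integrable[OF hyps])
  have "(LINT w|lborel. V w * dbar1 \<psi> w) = - (1 / pi) * (LINT w1|lborel. LINT u|lborel. P (dbar1 \<psi>) w1 u)"
    by (rule V_mult_integral[OF hyps])
  also have "(LINT w1|lborel. LINT u|lborel. P (dbar1 \<psi>) w1 u) = (LINT u|lborel. LINT w1|lborel. P (dbar1 \<psi>) w1 u)"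
    by (rule lborel_pair.Fubini_integral[symmetric, OF P_integrable[OF hyps]])
  also have "\<dots> = (LINT u|lborel. pi * (F u * \<psi> u))"
  proof (rule Bochner_Integration.integral_cong[OF refl])
    fix u :: "complex \<times> complex"
    show "(LINT w1|lborel. P (dbar1 \<psi>) w1 u) = pi * (F u * \<psi> u)"
    proof (cases "F u = 0")
      case False
      then have "u \<in> disc_prod" using F_supp by blast
      then have fu: "norm (fst u) \<le> 1" by (auto simp: disc_prod_def)
      let ?d = "\<lambda>z. frechet_derivative \<psi> (at (z, snd u))"
      note d = test_functions_has_derivative[OF \<psi>]
      have off: "(z, snd u) \<notin> K" if "z \<notin> ball 0 1" for z using that K(2) by (auto simp: disc_prod_def)
      have "(LINT z|lborel. (?d z (1, 0) + \<i> * ?d z (\<i>, 0)) / 2 / (z - fst u)) = - of_real pi * \<psi> (fst u, snd u)"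
      proof (rule Cauchy_Pompeiu_compact_support[OF _ _ _ _ fu])
        show "((\<lambda>z. \<psi> (z, snd u)) has_derivative (\<lambda>v. ?d z (v, 0))) (at z)" for z
          using has_derivative_slice1[OF d[of "(z, snd u)"]] by simp
        have c: "continuous_on UNIV (\<lambda>z. frechet_derivative \<psi> (at z) v)" for v
          using s[of "Suc 0"] unfolding cont_diff_on.simps by blast
        show "continuous_on UNIV (\<lambda>z. ?d z (v, 0))" for v
          by (rule continuous_on_compose2[OF c]) (auto intro!: continuous_intros)
        show "\<psi> (z, snd u) = 0" if "z \<notin> ball 0 1" for z using off[OF that] K(3) by blast
        show "?d z (v, 0) = 0" if "z \<notin> ball 0 1" for z v
        proof -
          have "(\<psi> has_derivative (\<lambda>_. 0)) (at (z, snd u))"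
            by (rule has_derivative_zero_off_support[OF K(1) _ off[OF that]]) (rule K(3))
          from frechet_derivative_at[OF this] have "frechet_derivative \<psi> (at (z, snd u)) = (\<lambda>_. 0)" by (rule sym)
          then show ?thesis by simp
        qed
      qed
      moreover have "(?d z (1, 0) + \<i> * ?d z (\<i>, 0)) / 2 = dbar1 \<psi> (z, snd u)" for z
        using dbar_eq(1)[OF d] by simp
      ultimately have cp: "(LINT z|lborel. dbar1 \<psi> (z, snd u) / (z - fst u)) = - of_real pi * \<psi> u" by simp
      have "P (dbar1 \<psi>) w1 u = - F u * (dbar1 \<psi> (w1, snd u) / (w1 - fst u))" for w1
        unfolding P_def[OF hyps] using minus_divide_right[of "F u * dbar1 \<psi> (w1, snd u)" "w1 - fst u"] by simp
      then have "(LINT w1|lborel. P (dbar1 \<psi>) w1 u) = - F u * (LINT w1|lborel. dbar1 \<psi> (w1, snd u) / (w1 - fst u))"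
        by (simp only: integral_mult_right_zero)
      then show ?thesis unfolding cp by simp
    qed (simp add: P_def[OF hyps])
  qed
  also have "- (1 / pi) * (LINT u|lborel. pi * (F u * \<psi> u)) = - (LINT w|lborel. F w * \<psi> w)"
    by simp
  finally show "(LINT w|lborel. V w * dbar1 \<psi> w) = - (LINT w|lborel. F w * \<psi> w)" .
qed

text \<open>The weight 1/(\<zeta> - w1) is singular, so \<open>F_closed\<close> cannot be applied to
  it. Smooth bumps in \<zeta> show instead that the inner w2 integral \<open>g\<close> vanishes for
  almost every \<zeta>, and then any weight in \<zeta> is harmless.\<close>

lemma V_dbar2:
  assumes \<psi>: "\<psi> \<in> test_functions disc_prod"
  shows "integrable lborel (\<lambda>w. V w * dbar2 \<psi> w)" "(LINT w|lborel. V w * dbar2 \<psi> w) = 0"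
proof -
  obtain K B \<delta> where K: "compact K" "K \<subseteq> disc_prod" "\<And>z. z \<notin> K \<Longrightarrow> \<psi> z = 0" and s: "\<And>k. cont_diff_on k UNIV \<psi>"
    and \<delta>: "\<delta> > 0" "\<And>w. w \<in> K \<Longrightarrow> \<delta> \<le> norm (snd w)" and B: "\<And>z. norm (dbar2 \<psi> z) \<le> B"
    using test_function_cut[OF \<psi>] by metis
  have m [measurable]: "dbar2 \<psi> \<in> borel_measurable borel"
    using dbar_test_function[OF \<psi>] by (auto intro: borel_measurable_continuous_onI)
  then have [measurable]: "dbar2 \<psi> \<in> borel_measurable (borel \<Otimes>\<^sub>M borel)" by (simp add: borel_prod)
  have supp: "dbar2 \<psi> w = 0 \<or> w \<in> disc_prod \<and> \<delta> \<le> norm (snd w)" for w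
    using dbar_zero_off_support(2)[OF K(1), of \<psi> w] K(2,3) \<delta>(2) by blast
  note hyps = m B \<delta>(1) supp
  show "integrable lborel (\<lambda>w. V w * dbar2 \<psi> w)" by (rule V_mult_integrable[OF hyps])
  have "AE w1 in lborel. (LINT u|lborel. P (dbar2 \<psi>) w1 u) = 0"
    using lborel_pair.AE_integrable_fst[OF P_integrable[OF hyps]]
  proof eventually_elim
    fix w1 assume int: "integrable lborel (P (dbar2 \<psi>) w1)"
    \<comment> \<open>Without the kernel the integrand is integrable whatever w1 is, since the
      support of \<psi> cuts \<open>F\<close> off near w2 = 0.\<close>
    define h where "h u = F u * dbar2 \<psi> (w1, snd u)" for u
    define g where "g \<zeta> = (LINT w2|lborel. h (\<zeta>, w2))" for \<zeta>
    have h_int: "integrable lborel h"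
    proof -
      have "integrable lborel (\<lambda>u. indicat_real {w. \<delta> \<le> norm (snd w)} u *\<^sub>R F u * dbar2 \<psi> (w1, snd u))"
        by (rule integrable_mult_bounded[OF F_int_cut[OF \<delta>(1)] _ B]) measurable
      moreover have "h = (\<lambda>u. indicat_real {w. \<delta> \<le> norm (snd w)} u *\<^sub>R F u * dbar2 \<psi> (w1, snd u))"
        using supp by (force simp: h_def indicator_def fun_eq_iff)
      ultimately show ?thesis by simp
    qed
    have h_int': "integrable (lborel \<Otimes>\<^sub>M lborel) (\<lambda>(\<zeta>, w2). h (\<zeta>, w2))" using h_int by (simp add: lborel_prod)
    have g_int: "integrable lborel g"
      using lborel_pair.integrable_fst[OF h_int'] by (simp add: g_def[abs_def])
    have "AE \<zeta> in lborel. \<zeta> \<in> ball 0 1 \<longrightarrow> g \<zeta> = 0"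
    proof (rule integral_bump_0_imp_AE_0[OF open_ball])
      have "integrable lebesgue g" using integrable_completion[of g lborel] g_int by auto
      then show "set_integrable lebesgue (cbox a b) g" for a b
        unfolding set_integrable_def by (intro integrable_mult_indicator) auto
      fix a b :: complex and n assume ab: "cbox a b \<subseteq> ball 0 1"
      let ?\<beta> = "\<lambda>\<zeta>. complex_of_real (bump a b n \<zeta>)"
      have bm [measurable]: "bump a b n \<in> borel_measurable borel"
        using cont_diff_on_imp_continuous_on[OF cont_diff_bump] by (rule borel_measurable_continuous_onI)
      define \<eta> where "\<eta> u = ?\<beta> (fst u) * \<psi> (w1, snd u)" for u
      have \<eta>_test: "\<eta> \<in> test_functions disc_prod"
      proof (rule test_functionsI)
        \<comment> \<open>Freezing w1 leaves a w2-support inside the projection of \<open>K\<close>,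
          and the box keeps \<zeta> in the disc; their product is compact in
          \<open>disc_prod\<close>.\<close>
        have "compact (snd ` K)" by (intro compact_continuous_image K(1) continuous_intros)
        then show "compact (cbox a b \<times> snd ` K)" by (intro compact_Times compact_cbox)
        show "cbox a b \<times> snd ` K \<subseteq> disc_prod" using ab K(2) by (auto simp: disc_prod_def)
        show "\<eta> z = 0" if "z \<notin> cbox a b \<times> snd ` K" for z
        proof -
          have "fst z \<notin> cbox a b \<or> snd z \<notin> snd ` K" using that by (cases z) auto
          moreover have "(w1, snd z) \<in> K \<Longrightarrow> snd z \<in> snd ` K"
            using image_eqI[of "snd z" snd "(w1, snd z)" K] by simp
          ultimately have "fst z \<notin> box a b \<or> (w1, snd z) \<notin> K" using box_subset_cbox[of a b] by blast
          then show ?thesis using bump_eq_0 K(3) by (auto simp: \<eta>_def)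
        qed
        fix k
        have "cont_diff_on k UNIV (\<lambda>u :: complex \<times> complex. bump a b n (fst u))"
          by (rule cont_diff_on_compose[OF open_UNIV open_UNIV subset_UNIV
                cont_diff_on_bounded_linear[OF bounded_linear_fst open_UNIV] cont_diff_bump])
        then have 1: "cont_diff_on k UNIV (\<lambda>u :: complex \<times> complex. ?\<beta> (fst u))"
          by (rule cont_diff_on_linear_comp[OF open_UNIV bounded_linear_of_real])
        have "cont_diff_on k UNIV (\<lambda>u :: complex \<times> complex. (w1, snd u))"
          by (intro cont_diff_on_Pair cont_diff_on_const cont_diff_on_bounded_linear bounded_linear_snd open_UNIV)
        from cont_diff_on_compose[where g = \<psi>, OF open_UNIV open_UNIV subset_UNIV this s]
        have 2: "cont_diff_on k UNIV (\<lambda>u :: complex \<times> complex. \<psi> (w1, snd u))" .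
        show "cont_diff_on k UNIV \<eta>" unfolding \<eta>_def by (rule cont_diff_on_mult[OF open_UNIV 1 2])
      qed
      have dbar_eta: "dbar2 \<eta> u = ?\<beta> (fst u) * dbar2 \<psi> (w1, snd u)" for u
      proof -
        note d = has_derivative_slice2[OF test_functions_has_derivative[OF \<psi>, of "(w1, snd u)"], unfolded fst_conv snd_conv]
        have "wirtinger_bar (\<lambda>z. ?\<beta> (fst u) * \<psi> (w1, z)) (snd u) = ?\<beta> (fst u) * wirtinger_bar (\<lambda>z. \<psi> (w1, z)) (snd u)"
          unfolding wirtinger_bar_eq[OF has_derivative_mult_right[OF d]] wirtinger_bar_eq[OF d] by (simp add: algebra_simps)
        then show ?thesis by (simp add: dbar2_def \<eta>_def case_prod_beta)
      qed
      have "(LINT \<zeta>|lebesgue. bump a b n \<zeta> *\<^sub>R g \<zeta>) = (LINT \<zeta>|lborel. bump a b n \<zeta> *\<^sub>R g \<zeta>)"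
        by (rule integral_completion) (use g_int in auto)
      also have "\<dots> = (LINT \<zeta>|lborel. LINT w2|lborel. h (\<zeta>, w2) * ?\<beta> \<zeta>)"
        by (simp add: g_def scaleR_conv_of_real mult.commute)
      also have "\<dots> = (LINT u|lborel. h u * ?\<beta> (fst u))"
      proof -
        have "integrable lborel (\<lambda>u. h u * ?\<beta> (fst u))"
        proof (rule integrable_mult_bounded[OF h_int])
          show "norm (?\<beta> (fst u)) \<le> 1" for u :: "complex \<times> complex" using bump_bounds[of a b n "fst u"] by simp
        qed measurable
        then show ?thesis
          using lborel_pair.integral_fst'[of "\<lambda>u. h u * ?\<beta> (fst u)"] by (simp add: lborel_prod)
      qed
      also have "\<dots> = (LINT u|lborel. F u * dbar2 \<eta> u)"
        by (simp add: dbar_eta h_def mult_ac)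
      also have "\<dots> = 0" by (rule F_closed[OF \<eta>_test])
      finally show "(LINT \<zeta>|lebesgue. bump a b n \<zeta> *\<^sub>R g \<zeta>) = 0" .
    qed
    moreover have "g \<zeta> = 0" if "\<zeta> \<notin> ball 0 1" for \<zeta>
    proof -
      have "h (\<zeta>, w2) = 0" for w2 using that F_supp[of "(\<zeta>, w2)"] by (auto simp: h_def disc_prod_def)
      then show ?thesis by (simp add: g_def)
    qed
    ultimately have g0: "AE \<zeta> in lborel. g \<zeta> = 0" by (auto elim!: eventually_mono)
    have "(LINT u|lborel. P (dbar2 \<psi>) w1 u) = (LINT \<zeta>|lborel. LINT w2|lborel. P (dbar2 \<psi>) w1 (\<zeta>, w2))"
      using lborel_pair.integral_fst'[of "P (dbar2 \<psi>) w1"] int by (simp add: lborel_prod)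
    also have "\<dots> = (LINT \<zeta>|lborel. g \<zeta> / (\<zeta> - w1))"
      by (simp add: P_def[OF hyps] g_def h_def)
    also have "\<dots> = (LINT \<zeta>|(lborel :: complex measure). 0)"
      using g_int g0 by (intro integral_cong_AE) auto
    finally show "(LINT u|lborel. P (dbar2 \<psi>) w1 u) = 0" by simp
  qed
  then have "(LINT w1|lborel. LINT u|lborel. P (dbar2 \<psi>) w1 u) = 0"
    by (rule integral_eq_zero_AE)
  then show "(LINT w|lborel. V w * dbar2 \<psi> w) = 0"
    unfolding V_mult_integral[OF hyps] by simp
qed

end

section \<open>Transfer to the Hartogs triangle\<close>

lemma twist_has_derivative:
  "(twist has_derivative (\<lambda>v. (snd w * fst v + fst w * snd v, 0 * fst v + 1 * snd v))) (at w)"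
  unfolding twist_def[abs_def]
  by (rule has_derivative_eq_rhs, (rule derivative_intros)+) (auto simp: fun_eq_iff)

text \<open>\<open>twist\<close> is polynomial on the whole space, so the composition is smooth even
  across w2 = 0; its support stays in the image under \<open>hartogs_map\<close> of the old compact
  set.\<close>

lemma test_function_twist:
  assumes \<psi>: "\<psi> \<in> test_functions hartogs" and h: "\<And>k. cont_diff_on k UNIV h"
  shows "(\<lambda>w. h w * \<psi> (twist w)) \<in> test_functions disc_prod"
proof -
  obtain K where K: "compact K" "K \<subseteq> hartogs" "\<And>z. z \<notin> K \<Longrightarrow> \<psi> z = 0" and s: "\<And>k. cont_diff_on k UNIV \<psi>"
    using test_functionsE[OF \<psi>] by metis
  show ?thesis
  proof (rule test_functionsI[where K = "hartogs_map ` K"])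
    have "continuous_on K hartogs_map"
      unfolding hartogs_map_def case_prod_beta'
      using K(2) snd_hartogs_nonzero by (intro continuous_intros) blast
    then show "compact (hartogs_map ` K)" using K(1) by (rule compact_continuous_image)
    show "hartogs_map ` K \<subseteq> disc_prod"
      using K(2) hartogs_map_in_disc_prod_iff snd_hartogs_nonzero by blast
    show "h w * \<psi> (twist w) = 0" if "w \<notin> hartogs_map ` K" for w
    proof -
      have "twist w \<notin> K"
      proof
        assume t: "twist w \<in> K"
        then have "snd (twist w) \<noteq> 0" using K(2) snd_hartogs_nonzero by blast
        then have "snd w \<noteq> 0" by (simp add: twist_def)
        from hartogs_map_twist[OF this] have "w = hartogs_map (twist w)" by (rule sym)
        then show False using t that by blast
      qed
      then show ?thesis by (simp add: K(3))
    qed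
    fix k
    have "cont_diff_on k UNIV (\<lambda>w :: complex \<times> complex. (fst w * snd w, snd w))"
      by (intro cont_diff_on_Pair cont_diff_on_mult cont_diff_on_bounded_linear bounded_linear_fst bounded_linear_snd open_UNIV)
    then have "cont_diff_on k UNIV twist" by (simp only: twist_def[abs_def])
    from cont_diff_on_compose[where g = \<psi>, OF open_UNIV open_UNIV subset_UNIV this s]
    show "cont_diff_on k UNIV (\<lambda>w. h w * \<psi> (twist w))"
      by (intro cont_diff_on_mult h open_UNIV)
  qed
qed

lemma coordinate_has_derivative:
  "(snd has_derivative (\<lambda>v. snd v)) (at w)" "((\<lambda>w. cnj (snd w)) has_derivative (\<lambda>v. cnj (snd v))) (at w)"
  "((\<lambda>w. cnj (fst w)) has_derivative (\<lambda>v. cnj (fst v))) (at w)"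
  by (auto intro!: derivative_eq_intros)

lemma cont_diff_coordinate:
  "cont_diff_on k UNIV (snd :: complex \<times> complex \<Rightarrow> complex)"
  "cont_diff_on k UNIV (\<lambda>w :: complex \<times> complex. cnj (snd w))"
  "cont_diff_on k UNIV (\<lambda>w :: complex \<times> complex. cnj (fst w))"
  by (intro cont_diff_on_bounded_linear bounded_linear_snd open_UNIV
      bounded_linear_compose[OF bounded_linear_cnj bounded_linear_snd]
      bounded_linear_compose[OF bounded_linear_cnj bounded_linear_fst])+

text \<open>The aim is to write the pulled-back derivatives, Jacobian included, as derivatives of
  test functions on \<open>disc_prod\<close>. In the second identity dbar2 of \<psi> o twist
  contains an unwanted cnj w1 \<open>dbar1 \<psi>\<close>, which the subtracted term removes; the
  two terms w2 (\<psi> o twist), from differentiating cnj w2 and cnj w1, cancel.\<close>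

lemma dbar_twist:
  assumes \<psi>: "\<psi> \<in> test_functions hartogs"
  shows "dbar1 (\<lambda>w. snd w * \<psi> (twist w)) w = (norm (snd w))\<^sup>2 *\<^sub>R dbar1 \<psi> (twist w)"
    and "dbar2 (\<lambda>w. (snd w * cnj (snd w)) * \<psi> (twist w)) w - dbar1 (\<lambda>w. (cnj (fst w) * snd w) * \<psi> (twist w)) w
       = (norm (snd w))\<^sup>2 *\<^sub>R dbar2 \<psi> (twist w)"
proof -
  note d = test_functions_has_derivative[OF \<psi>, of "twist w"]
  note t = twist_has_derivative[of w]
  note c = coordinate_has_derivative[of w]
  note dt = has_derivative_compose[OF t d]
  note dc = dbar_eq[OF c(1)] dbar_eq[OF c(2)] dbar_eq[OF c(3)]
  have n: "(norm (snd w))\<^sup>2 *\<^sub>R x = snd w * cnj (snd w) * x" for x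
    by (simp add: scaleR_conv_of_real complex_norm_square del: of_real_power)
  show "dbar1 (\<lambda>w. snd w * \<psi> (twist w)) w = (norm (snd w))\<^sup>2 *\<^sub>R dbar1 \<psi> (twist w)"
    unfolding dbar_mult(1)[OF c(1) dt] dbar_compose_holomorphic[OF d t] n by (simp add: dc)
  have e2: "dbar2 (\<lambda>w. (snd w * cnj (snd w)) * \<psi> (twist w)) w
     = snd w * cnj (snd w) * (cnj (fst w) * dbar1 \<psi> (twist w) + dbar2 \<psi> (twist w)) + snd w * \<psi> (twist w)"
    unfolding dbar_mult(2)[OF has_derivative_mult[OF c(1,2)] dt] dbar_mult(2)[OF c(1,2)] dbar_compose_holomorphic[OF d t]
    by (simp add: dc)
  have e1: "dbar1 (\<lambda>w. (cnj (fst w) * snd w) * \<psi> (twist w)) w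
     = cnj (fst w) * snd w * (cnj (snd w) * dbar1 \<psi> (twist w)) + snd w * \<psi> (twist w)"
    unfolding dbar_mult(1)[OF has_derivative_mult[OF c(3,1)] dt] dbar_mult(1)[OF c(3,1)] dbar_compose_holomorphic[OF d t]
    by (simp add: dc)
  show "dbar2 (\<lambda>w. (snd w * cnj (snd w)) * \<psi> (twist w)) w - dbar1 (\<lambda>w. (cnj (fst w) * snd w) * \<psi> (twist w)) w
       = (norm (snd w))\<^sup>2 *\<^sub>R dbar2 \<psi> (twist w)"
    unfolding e1 e2 n by (simp add: algebra_simps)
qed

context radial_form
begin

definition v :: "complex \<times> complex \<Rightarrow> complex" where
  "v z = indicat_real hartogs z *\<^sub>R V (hartogs_map z)"

lemma v_meas [measurable]: "v \<in> borel_measurable borel"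
  unfolding v_def by measurable

lemma v_supp: "z \<notin> hartogs \<Longrightarrow> v z = 0"
  by (simp add: v_def)

lemma v_twist: "snd w \<noteq> 0 \<Longrightarrow> v (twist w) = indicat_real disc_prod w *\<^sub>R V w"
  by (simp add: v_def hartogs_map_twist twist_in_hartogs_iff indicator_def)

lemma integral_v:
  assumes [measurable]: "g \<in> borel_measurable borel" and g: "\<And>z. z \<notin> hartogs \<Longrightarrow> g z = 0"
  shows "(LINT z|lborel. v z * g z) = (LINT w|lborel. V w * ((norm (snd w))\<^sup>2 *\<^sub>R g (twist w)))"
proof -
  have "(LINT z|lborel. v z * g z) = (LINT w|lborel. (norm (snd w))\<^sup>2 *\<^sub>R (v (twist w) * g (twist w)))"
    by (rule integral_twist(1)[symmetric]) measurable
  also have "\<dots> = (LINT w|lborel. V w * ((norm (snd w))\<^sup>2 *\<^sub>R g (twist w)))"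
  proof (rule integral_cong_AE)
    show "AE w in lborel. (norm (snd w))\<^sup>2 *\<^sub>R (v (twist w) * g (twist w)) = V w * ((norm (snd w))\<^sup>2 *\<^sub>R g (twist w))"
      using AE_snd_nonzero
    proof eventually_elim
      fix w :: "complex \<times> complex" assume w: "snd w \<noteq> 0"
      show "(norm (snd w))\<^sup>2 *\<^sub>R (v (twist w) * g (twist w)) = V w * ((norm (snd w))\<^sup>2 *\<^sub>R g (twist w))"
      proof (cases "w \<in> disc_prod")
        case False
        then show ?thesis using g[of "twist w"] twist_in_hartogs_iff[OF w] by simp
      qed (simp add: v_twist[OF w])
    qed
  qed measurable
  finally show ?thesis .
qed

text \<open>Both right-hand sides come from \<open>V_dbar1\<close>. In the second,
  \<open>V_dbar2\<close> contributes 0 and the corrector \<open>?e3\<close> contributes cnj w1 w2 F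
  = |w2|^2 cnj w1 A, where cnj w1 = cnj z1 / cnj z2.\<close>

lemma v_dbar:
  assumes \<psi>: "\<psi> \<in> test_functions hartogs"
  shows "(LINT z|lborel. v z * dbar1 \<psi> z) = - (LINT z|lborel. A z * \<psi> z)"
    and "(LINT z|lborel. v z * dbar2 \<psi> z) = - (LINT z|lborel. - (cnj (fst z) / cnj (snd z)) * A z * \<psi> z)"
proof -
  obtain K where K: "compact K" "K \<subseteq> hartogs" "\<And>z. z \<notin> K \<Longrightarrow> \<psi> z = 0" and s: "\<And>k. cont_diff_on k UNIV \<psi>"
    using test_functionsE[OF \<psi>] by metis
  have [measurable]: "\<psi> \<in> borel_measurable borel" "dbar1 \<psi> \<in> borel_measurable borel" "dbar2 \<psi> \<in> borel_measurable borel"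
    using dbar_test_function[OF \<psi>] cont_diff_on_imp_continuous_on[OF s] by (auto intro: borel_measurable_continuous_onI)
  have off: "dbar1 \<psi> z = 0" "dbar2 \<psi> z = 0" if "z \<notin> hartogs" for z
    using dbar_zero_off_support[OF K(1), of \<psi> z] K(2,3) that by blast+
  let ?e1 = "\<lambda>w. snd w * \<psi> (twist w)" and ?e2 = "\<lambda>w. (snd w * cnj (snd w)) * \<psi> (twist w)"
    and ?e3 = "\<lambda>w. (cnj (fst w) * snd w) * \<psi> (twist w)"
  have t1: "?e1 \<in> test_functions disc_prod" and t2: "?e2 \<in> test_functions disc_prod" and t3: "?e3 \<in> test_functions disc_prod"
    by (intro test_function_twist[OF \<psi>] cont_diff_on_mult cont_diff_coordinate open_UNIV)+
  have n: "(norm (snd w))\<^sup>2 *\<^sub>R x = snd w * cnj (snd w) * x" for x and w :: "complex \<times> complex"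
    by (simp add: scaleR_conv_of_real complex_norm_square del: of_real_power)
  have "(LINT z|lborel. v z * dbar1 \<psi> z) = (LINT w|lborel. V w * dbar1 ?e1 w)"
    unfolding dbar_twist(1)[OF \<psi>] by (rule integral_v) (use off in auto)
  also have "\<dots> = - (LINT w|lborel. F w * ?e1 w)" by (rule V_dbar1(2)[OF t1])
  also have "(LINT w|lborel. F w * ?e1 w) = (LINT w|lborel. (norm (snd w))\<^sup>2 *\<^sub>R (A (twist w) * \<psi> (twist w)))"
    by (intro Bochner_Integration.integral_cong refl) (simp add: F_def n mult_ac)
  also have "\<dots> = (LINT z|lborel. A z * \<psi> z)"
    by (rule integral_twist(1)) measurable
  finally show "(LINT z|lborel. v z * dbar1 \<psi> z) = - (LINT z|lborel. A z * \<psi> z)" .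
  have "(LINT z|lborel. v z * dbar2 \<psi> z) = (LINT w|lborel. V w * (dbar2 ?e2 w - dbar1 ?e3 w))"
    unfolding dbar_twist(2)[OF \<psi>] by (rule integral_v) (use off in auto)
  also have "\<dots> = (LINT w|lborel. V w * dbar2 ?e2 w) - (LINT w|lborel. V w * dbar1 ?e3 w)"
    unfolding right_diff_distrib by (rule Bochner_Integration.integral_diff[OF V_dbar2(1)[OF t2] V_dbar1(1)[OF t3]])
  also have "\<dots> = (LINT w|lborel. F w * ?e3 w)" unfolding V_dbar2(2)[OF t2] V_dbar1(2)[OF t3] by simp
  also have "\<dots> = (LINT w|lborel. (norm (snd w))\<^sup>2 *\<^sub>R ((cnj (fst (twist w)) / cnj (snd (twist w))) * A (twist w) * \<psi> (twist w)))"
    by (intro Bochner_Integration.integral_cong refl) (auto simp: F_def n mult_ac twist_def)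
  also have "\<dots> = (LINT z|lborel. (cnj (fst z) / cnj (snd z)) * A z * \<psi> z)"
    by (rule integral_twist(1)) measurable
  also have "\<dots> = - (LINT z|lborel. - (cnj (fst z) / cnj (snd z)) * A z * \<psi> z)" by simp
  finally show "(LINT z|lborel. v z * dbar2 \<psi> z) = - (LINT z|lborel. - (cnj (fst z) / cnj (snd z)) * A z * \<psi> z)" .
qed

text \<open>On each disc \<open>cauchy_transform_Lp_bound\<close> applies to \<open>F\<close>. The
  factors 1/pi of \<open>V\<close> and |w2| of \<open>F\<close> are at most 1 and are dropped, which
  keeps the constant m^p.\<close>

lemma v_Lp:
  assumes p: "1 \<le> p" and m: "0 < m" "kernel_mass \<le> ennreal m"
  shows "(\<integral>\<^sup>+z. ennreal (norm (v z) powr p) \<partial>lborel) \<le> ennreal (m powr p) * (\<integral>\<^sup>+z. ennreal (norm (A z) powr p) \<partial>lborel)"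
proof -
  let ?I = "indicator (ball 0 1) :: complex \<Rightarrow> ennreal" and ?J = "indicator punctured_disc :: complex \<Rightarrow> ennreal"
  let ?n = "\<lambda>w2 :: complex. ennreal ((norm w2)\<^sup>2)"
  have V [measurable]: "V \<in> borel_measurable (borel \<Otimes>\<^sub>M borel)" using V_meas by (simp add: borel_prod)
  have At [measurable]: "(\<lambda>w. A (twist w)) \<in> borel_measurable (borel \<Otimes>\<^sub>M borel)"
    using measurable_compose[OF borel_measurable_twist A_meas] by (simp add: borel_prod)
  have "(\<integral>\<^sup>+z. ennreal (norm (v z) powr p) \<partial>lborel) = (\<integral>\<^sup>+w. ennreal (norm (v (twist w)) powr p) * ?n (snd w) \<partial>lborel)"
    by (rule nn_integral_twist[symmetric]) measurable
  also have "\<dots> = (\<integral>\<^sup>+w. ?I (fst w) * ennreal (norm (V w) powr p) * (?J (snd w) * ?n (snd w)) \<partial>lborel)"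
  proof (rule nn_integral_cong_AE)
    show "AE w in lborel. ennreal (norm (v (twist w)) powr p) * ?n (snd w) = ?I (fst w) * ennreal (norm (V w) powr p) * (?J (snd w) * ?n (snd w))"
      using AE_snd_nonzero by eventually_elim (auto simp: v_twist indicator_def disc_prod_def)
  qed
  also have "\<dots> = (\<integral>\<^sup>+w2. \<integral>\<^sup>+w1. ?I w1 * ennreal (norm (V (w1, w2)) powr p) * (?J w2 * ?n w2) \<partial>lborel \<partial>lborel)"
    unfolding lborel_prod[symmetric] by (subst lborel_pair.nn_integral_snd[symmetric]) auto
  also have "\<dots> \<le> (\<integral>\<^sup>+w2. \<integral>\<^sup>+\<zeta>. ennreal (m powr p) * (ennreal (norm (A (twist (\<zeta>, w2))) powr p) * ?n w2) \<partial>lborel \<partial>lborel)"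
  proof (rule nn_integral_mono)
    fix w2 :: complex
    have Fm: "(\<lambda>\<zeta>. F (\<zeta>, w2)) \<in> borel_measurable borel" by measurable
    have "(\<integral>\<^sup>+w1. ?I w1 * ennreal (norm (V (w1, w2)) powr p) * (?J w2 * ?n w2) \<partial>lborel) =
      (\<integral>\<^sup>+w1. ?I w1 * ennreal (norm (V (w1, w2)) powr p) \<partial>lborel) * (?J w2 * ?n w2)"
      by (rule nn_integral_multc) measurable
    also have "\<dots> \<le> (\<integral>\<^sup>+w1. ?I w1 * ennreal (norm (LINT \<zeta>|lborel. F (\<zeta>, w2) / (\<zeta> - w1)) powr p) \<partial>lborel) * (?J w2 * ?n w2)"
    proof (intro mult_right_mono nn_integral_mono mult_left_mono ennreal_leI powr_mono2)
      fix w1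
      have "norm (V (w1, w2)) = norm (LINT \<zeta>|lborel. F (\<zeta>, w2) / (\<zeta> - w1)) / pi"
        by (simp add: V_def norm_divide norm_mult)
      also have "\<dots> \<le> norm (LINT \<zeta>|lborel. F (\<zeta>, w2) / (\<zeta> - w1)) / 1"
        using pi_ge_two by (intro divide_left_mono) auto
      finally show "norm (V (w1, w2)) \<le> norm (LINT \<zeta>|lborel. F (\<zeta>, w2) / (\<zeta> - w1))" by simp
    qed (use p in auto)
    also have "\<dots> \<le> ennreal (m powr p) * (\<integral>\<^sup>+\<zeta>. ennreal (norm (F (\<zeta>, w2)) powr p) \<partial>lborel) * (?J w2 * ?n w2)"
      by (intro mult_right_mono cauchy_transform_Lp_bound[OF p Fm _ m]) (auto intro!: F_supp simp: disc_prod_def)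
    also have "\<dots> \<le> ennreal (m powr p) * (\<integral>\<^sup>+\<zeta>. ennreal (norm (A (twist (\<zeta>, w2))) powr p) \<partial>lborel) * ?n w2"
    proof (cases "w2 \<in> punctured_disc")
      case True
      have "norm (F (\<zeta>, w2)) \<le> norm (A (twist (\<zeta>, w2)))" for \<zeta>
        using True mult_right_mono[of "norm w2" 1 "norm (A (twist (\<zeta>, w2)))"] by (simp add: F_def norm_mult punctured_disc_def)
      then show ?thesis using True p
        by (simp, intro mult_right_mono mult_left_mono nn_integral_mono ennreal_leI powr_mono2) auto
    qed simp
    also have "\<dots> = (\<integral>\<^sup>+\<zeta>. ennreal (m powr p) * (ennreal (norm (A (twist (\<zeta>, w2))) powr p) * ?n w2) \<partial>lborel)"
      by (simp add: nn_integral_cmult nn_integral_multc mult.assoc)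
    finally show "(\<integral>\<^sup>+w1. ?I w1 * ennreal (norm (V (w1, w2)) powr p) * (?J w2 * ?n w2) \<partial>lborel)
       \<le> (\<integral>\<^sup>+\<zeta>. ennreal (m powr p) * (ennreal (norm (A (twist (\<zeta>, w2))) powr p) * ?n w2) \<partial>lborel)" .
  qed
  also have "\<dots> = (\<integral>\<^sup>+w. ennreal (m powr p) * (ennreal (norm (A (twist w)) powr p) * ?n (snd w)) \<partial>lborel)"
    unfolding lborel_prod[symmetric, where 'a=complex and 'b=complex]
    by (subst lborel_pair.nn_integral_snd[symmetric]) auto
  also have "\<dots> = ennreal (m powr p) * (\<integral>\<^sup>+w. ennreal (norm (A (twist w)) powr p) * ?n (snd w) \<partial>lborel)"
    by (rule nn_integral_cmult) measurable
  also have "(\<integral>\<^sup>+w. ennreal (norm (A (twist w)) powr p) * ?n (snd w) \<partial>lborel) = (\<integral>\<^sup>+z. ennreal (norm (A z) powr p) \<partial>lborel)"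
    by (rule nn_integral_twist) measurable
  finally show ?thesis .
qed

end

section \<open>The operator and the L^p norms as stated, in terms of Borel representatives\<close>

lemma sym_dbar_AE_0:
  assumes f1: "\<And>\<psi>. \<psi> \<in> test_functions disc_prod \<Longrightarrow> regular_distr disc_prod f1 (dbar2 \<psi>) = 0"
    and f2: "\<And>\<psi>. \<psi> \<in> test_functions disc_prod \<Longrightarrow> regular_distr disc_prod f2 (dbar1 \<psi>) = 0"
  shows "AE w in lborel. w \<in> disc_prod \<longrightarrow> sym_dbar f1 f2 w = 0"
proof -
  let ?Q = "\<lambda>g. loc_integrable disc_prod g \<and> distr_eq disc_prod (regular_distr disc_prod g)
       (\<lambda>\<psi>. 1 / 2 * (distr_dbar2 (regular_distr disc_prod f1) \<psi> + distr_dbar1 (regular_distr disc_prod f2) \<psi>))"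
  \<comment> \<open>The zero function meets the specification, so the \<open>SOME\<close> in
    \<open>sym_dbar\<close> does pick a locally integrable representative of the zero distribution,
    and bumps then show that it vanishes almost everywhere.\<close>
  have "?Q (\<lambda>_. 0)"
    by (auto simp: loc_integrable_def set_integrable_def distr_eq_def regular_distr_def[of _ "\<lambda>_. 0"] set_lebesgue_integral_def
        distr_dbar1_def distr_dbar2_def f1 f2)
  then have Q: "?Q (sym_dbar f1 f2)" unfolding sym_dbar_def by (rule someI[where P = ?Q])
  show ?thesis
  proof (rule integral_bump_0_imp_AE_0[OF open_disc_prod])
    fix a b :: "complex \<times> complex" assume ab: "cbox a b \<subseteq> disc_prod"
    then show "set_integrable lebesgue (cbox a b) (sym_dbar f1 f2)"
      using Q compact_cbox by (auto simp: loc_integrable_def)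
    fix n
    have t: "(\<lambda>z. complex_of_real (bump a b n z)) \<in> test_functions disc_prod"
    proof (rule test_functionsI[OF _ compact_cbox ab])
      show "cont_diff_on k UNIV (\<lambda>z. complex_of_real (bump a b n z))" for k
        by (rule cont_diff_on_linear_comp[OF open_UNIV bounded_linear_of_real cont_diff_bump])
      show "complex_of_real (bump a b n z) = 0" if "z \<notin> cbox a b" for z
        using that box_subset_cbox[of a b] bump_eq_0[of z a b n] by auto
    qed
    have "(LINT z|lebesgue. bump a b n z *\<^sub>R sym_dbar f1 f2 z) = regular_distr disc_prod (sym_dbar f1 f2) (\<lambda>z. complex_of_real (bump a b n z))"
      unfolding regular_distr_def set_lebesgue_integral_def
    proof (intro Bochner_Integration.integral_cong refl)
      fix z
      show "bump a b n z *\<^sub>R sym_dbar f1 f2 z = indicat_real disc_prod z *\<^sub>R (sym_dbar f1 f2 z * complex_of_real (bump a b n z))"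
      proof (cases "z \<in> disc_prod")
        case False
        then have "bump a b n z = 0" using ab box_subset_cbox[of a b] by (intro bump_eq_0) blast
        then show ?thesis by simp
      qed (simp add: scaleR_conv_of_real mult.commute)
    qed
    also have "\<dots> = 0" using Q t by (simp add: distr_eq_def distr_dbar1_def distr_dbar2_def f1 f2)
    finally show "(LINT z|lebesgue. bump a b n z *\<^sub>R sym_dbar f1 f2 z) = 0" .
  qed
qed

text \<open>The pointwise bound t <= 1 + t^p on a set of finite measure gives the inclusion of L^p
  in L^1.\<close>

lemma integrable_of_powr:
  fixes U :: "'a::euclidean_space \<Rightarrow> complex"
  assumes p: "1 \<le> p" and [measurable]: "U \<in> borel_measurable borel" "\<Omega> \<in> sets borel" and \<Omega>: "emeasure lborel \<Omega> < \<infinity>"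
    and U: "\<And>z. z \<notin> \<Omega> \<Longrightarrow> U z = 0" and fin: "(\<integral>\<^sup>+z. ennreal (norm (U z) powr p) \<partial>lborel) < \<infinity>"
  shows "integrable lborel U"
proof (rule integrableI_bounded)
  have "(\<integral>\<^sup>+z. ennreal (norm (U z)) \<partial>lborel) \<le> (\<integral>\<^sup>+z. indicator \<Omega> z + ennreal (norm (U z) powr p) \<partial>lborel)"
  proof (rule nn_integral_mono)
    fix z
    show "ennreal (norm (U z)) \<le> indicator \<Omega> z + ennreal (norm (U z) powr p)"
    proof (cases "norm (U z) \<le> 1")
      case True
      then have "ennreal (norm (U z)) \<le> indicator \<Omega> z"
        using U[of z] by (cases "z \<in> \<Omega>") auto
      then show ?thesis by (rule order_trans) simp
    next
      case False
      then have "norm (U z) powr 1 \<le> norm (U z) powr p" using p by (intro powr_mono) auto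
      then have "ennreal (norm (U z)) \<le> ennreal (norm (U z) powr p)" using False by (intro ennreal_leI) simp
      then show ?thesis by (rule order_trans) simp
    qed
  qed
  also have "\<dots> = emeasure lborel \<Omega> + (\<integral>\<^sup>+z. ennreal (norm (U z) powr p) \<partial>lborel)"
    by (subst nn_integral_add) auto
  also have "\<dots> < \<infinity>" using \<Omega> fin by simp
  finally show "(\<integral>\<^sup>+z. ennreal (norm (U z)) \<partial>lborel) < \<infinity>" .
qed measurable

lemma emeasure_hartogs_finite: "emeasure lborel hartogs < \<infinity>"
proof -
  have "hartogs \<subseteq> ball 0 1 \<times> ball 0 1" by (auto simp: hartogs_def)
  then have "bounded hartogs" using bounded_Times[OF bounded_ball bounded_ball] bounded_subset by blast
  then show ?thesis by (rule emeasure_bounded_finite)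
qed

lemma in_Lp_iff_borel:
  assumes \<Omega>: "\<Omega> \<in> sets borel" and U: "U \<in> borel_measurable borel" "\<And>z. z \<notin> \<Omega> \<Longrightarrow> U z = 0"
    and ae: "AE z in lborel. z \<in> \<Omega> \<longrightarrow> u z = U z"
  shows "in_Lp p \<Omega> u \<longleftrightarrow> integrable lborel (\<lambda>z. norm (U z) powr p)"
    and "Lp_norm p \<Omega> u = (LINT z|lborel. norm (U z) powr p) powr (1 / p)"
proof -
  have ae': "AE z in lborel. z \<in> \<Omega> \<longrightarrow> norm (u z) powr p = norm (U z) powr p"
    using ae by (auto elim!: eventually_mono)
  have m: "(\<lambda>z. norm (U z) powr p) \<in> borel_measurable borel" using U(1) by measurable
  have z: "norm (U z) powr p = 0" if "z \<notin> \<Omega>" for z using U(2)[OF that] by simp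
  have \<Omega>': "\<Omega> \<inter> space lebesgue \<in> sets lebesgue" using \<Omega> by simp
  have 1: "u \<in> borel_measurable (lebesgue_on \<Omega>)"
    unfolding borel_measurable_restrict_space_iff[OF \<Omega>']
    by (rule set_integral_lebesgue_eq_lborel(1)[OF \<Omega> U ae])
  note si = set_integral_lebesgue_eq_lborel[OF \<Omega> m z ae']
  have 2: "integrable (lebesgue_on \<Omega>) (\<lambda>z. norm (u z) powr p) \<longleftrightarrow> integrable lborel (\<lambda>z. norm (U z) powr p)"
    unfolding integrable_restrict_space[OF \<Omega>']
  proof
    show "integrable lborel (\<lambda>z. norm (U z) powr p) \<Longrightarrow> integrable lebesgue (\<lambda>z. indicat_real \<Omega> z *\<^sub>R norm (u z) powr p)"
      using si(3) by (simp add: set_integrable_def)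
    assume i: "integrable lebesgue (\<lambda>z. indicat_real \<Omega> z *\<^sub>R norm (u z) powr p)"
    have m': "(\<lambda>z. norm (U z) powr p) \<in> borel_measurable lborel" using m by simp
    have "integrable lebesgue (\<lambda>z. norm (U z) powr p)"
    proof (rule integrable_cong_AE_imp[OF i])
      show "(\<lambda>z. norm (U z) powr p) \<in> borel_measurable lebesgue" using m' by (rule measurable_completion)
      show "AE z in lebesgue. indicat_real \<Omega> z *\<^sub>R norm (u z) powr p = norm (U z) powr p"
        by (rule AE_completion) (use ae' z in \<open>auto elim!: eventually_mono simp: indicator_def\<close>)
    qed
    then show "integrable lborel (\<lambda>z. norm (U z) powr p)"
      using integrable_completion[OF m'] by simp
  qed
  show "in_Lp p \<Omega> u \<longleftrightarrow> integrable lborel (\<lambda>z. norm (U z) powr p)"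
    using 1 2 by (simp add: in_Lp_def)
  show "Lp_norm p \<Omega> u = (LINT z|lborel. norm (U z) powr p) powr (1 / p)"
    unfolding Lp_norm_def integral_restrict_space[OF \<Omega>'] using si(2) by (simp add: set_lebesgue_integral_def)
qed

lemma regular_distr_eq_lborel:
  assumes \<Omega>: "\<Omega> \<in> sets borel" and U: "U \<in> borel_measurable borel" "\<And>z. z \<notin> \<Omega> \<Longrightarrow> U z = 0"
    and ae: "AE z in lborel. z \<in> \<Omega> \<longrightarrow> u z = U z" and g: "continuous_on UNIV g"
  shows "regular_distr \<Omega> u g = (LINT z|lborel. U z * g z)"
  unfolding regular_distr_def
proof (rule set_integral_lebesgue_eq_lborel(2)[OF \<Omega>])
  have [measurable]: "g \<in> borel_measurable borel" using g by (rule borel_measurable_continuous_onI)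
  show "(\<lambda>z. U z * g z) \<in> borel_measurable borel" using U(1) by measurable
  show "AE z in lborel. z \<in> \<Omega> \<longrightarrow> u z * g z = U z * g z" using ae by (auto elim!: eventually_mono)
qed (simp add: U)

context radial_form
begin

text \<open>Changing f1 and f2 on a null set alters the one-variable integrals only on a null set of
  slices, so the equality is almost everywhere. The two terms use slices in opposite directions: w1
  fixed for f2, w2 fixed for f1.\<close>

lemma T_op_AE:
  assumes f1: "AE w in lborel. w \<in> disc_prod \<longrightarrow> f1 w = F w" and f2: "AE w in lborel. w \<in> disc_prod \<longrightarrow> f2 w = 0"
  shows "AE w in lborel. w \<in> disc_prod \<longrightarrow> T_op f1 f2 w = V w"
proof -
  have s: "AE w in lborel. w \<in> disc_prod \<longrightarrow> sym_dbar f1 f2 w = 0"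
  proof (rule sym_dbar_AE_0)
    fix \<psi> assume \<psi>: "\<psi> \<in> test_functions disc_prod"
    show "regular_distr disc_prod f1 (dbar2 \<psi>) = 0"
      using regular_distr_eq_lborel[OF _ F_meas(1) F_supp f1 dbar_test_function(2)[OF \<psi>]] F_closed[OF \<psi>] by simp
    show "regular_distr disc_prod f2 (dbar1 \<psi>) = 0"
      using regular_distr_eq_lborel[OF _ _ _ f2 dbar_test_function(1)[OF \<psi>]] by simp
  qed
  have third: "(LINT \<zeta>:disc_prod|lebesgue. sym_dbar f1 f2 \<zeta> / ((fst \<zeta> - w1) * (snd \<zeta> - w2)) * (2 * \<i>)\<^sup>2) = 0" for w1 w2
  proof -
    have "(LINT \<zeta>:disc_prod|lebesgue. sym_dbar f1 f2 \<zeta> / ((fst \<zeta> - w1) * (snd \<zeta> - w2)) * (2 * \<i>)\<^sup>2) =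
        (LINT \<zeta>|(lborel :: (complex \<times> complex) measure). 0)"
      by (rule set_integral_lebesgue_eq_lborel(2)) (use s in \<open>auto elim!: eventually_mono\<close>)
    then show ?thesis by simp
  qed
  have slice2: "AE w1 in lborel. AE w2 in lborel. (w1, w2) \<in> disc_prod \<longrightarrow> f2 (w1, w2) = 0"
    using f2 unfolding lborel_prod[symmetric] by (rule lborel_pair.AE_pair)
  have slice1: "AE w2 in lborel. AE w1 in lborel. (w1, w2) \<in> disc_prod \<longrightarrow> f1 (w1, w2) = F (w1, w2)"
    using f1 by (rule AE_lborel_swap_pair)
  show ?thesis
    using AE_lborel_fst[OF slice2] AE_lborel_snd[OF slice1]
  proof eventually_elim
    fix w :: "complex \<times> complex"
    assume a2: "AE w2 in lborel. (fst w, w2) \<in> disc_prod \<longrightarrow> f2 (fst w, w2) = 0"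
      and a1: "AE w1 in lborel. (w1, snd w) \<in> disc_prod \<longrightarrow> f1 (w1, snd w) = F (w1, snd w)"
    show "w \<in> disc_prod \<longrightarrow> T_op f1 f2 w = V w"
    proof
      assume w: "w \<in> disc_prod"
      have "(LINT \<zeta>2:punctured_disc|lebesgue. f2 (fst w, \<zeta>2) / (\<zeta>2 - snd w) * (2 * \<i>)) = (LINT \<zeta>2|(lborel :: complex measure). 0)"
      proof (rule set_integral_lebesgue_eq_lborel(2))
        show "AE \<zeta>2 in lborel. \<zeta>2 \<in> punctured_disc \<longrightarrow> f2 (fst w, \<zeta>2) / (\<zeta>2 - snd w) * (2 * \<i>) = 0"
          using a2 w by (auto elim!: eventually_mono simp: disc_prod_def)
      qed auto
      then have 1: "(LINT \<zeta>2:punctured_disc|lebesgue. f2 (fst w, \<zeta>2) / (\<zeta>2 - snd w) * (2 * \<i>)) = 0" by simp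
      have 2: "(LINT \<zeta>1:ball 0 1|lebesgue. f1 (\<zeta>1, snd w) / (\<zeta>1 - fst w) * (2 * \<i>))
          = (LINT \<zeta>1|lborel. F (\<zeta>1, snd w) / (\<zeta>1 - fst w) * (2 * \<i>))"
      proof (rule set_integral_lebesgue_eq_lborel(2))
        show "AE \<zeta>1 in lborel. \<zeta>1 \<in> ball 0 1 \<longrightarrow> f1 (\<zeta>1, snd w) / (\<zeta>1 - fst w) * (2 * \<i>) = F (\<zeta>1, snd w) / (\<zeta>1 - fst w) * (2 * \<i>)"
          using a1 w by (auto elim!: eventually_mono simp: disc_prod_def)
        show "F (\<zeta>1, snd w) / (\<zeta>1 - fst w) * (2 * \<i>) = 0" if "\<zeta>1 \<notin> ball 0 1" for \<zeta>1
          using F_supp[of "(\<zeta>1, snd w)"] that by (auto simp: disc_prod_def)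
      qed measurable
      have "T_op f1 f2 w = - 1 / (2 * pi * \<i>) * (LINT \<zeta>1|lborel. F (\<zeta>1, snd w) / (\<zeta>1 - fst w) * (2 * \<i>))"
        unfolding T_op_def case_prod_beta 1 2 third by simp
      also have "\<dots> = - 1 / (2 * pi * \<i>) * ((LINT \<zeta>1|lborel. F (\<zeta>1, snd w) / (\<zeta>1 - fst w)) * (2 * \<i>))"
        by (simp only: integral_mult_left_zero)
      also have "\<dots> = V w" by (simp add: V_def field_simps)
      finally show "T_op f1 f2 w = V w" .
    qed
  qed
qed

end

theorem theorem6p5:
  fixes p :: real
  assumes "1 \<le> p"
  shows "\<exists>C::real. C > 0 \<and>
    (\<forall>\<alpha>1 \<alpha>2 :: complex \<times> complex \<Rightarrow> complex.
       weakly_dbar_closed hartogs \<alpha>1 \<alpha>2 \<and>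
       (AE z in lebesgue_on hartogs. cnj (fst z) * \<alpha>1 z + cnj (snd z) * \<alpha>2 z = 0) \<and>
       in_Lp p hartogs \<alpha>1 \<longrightarrow>
       (let a1 = \<alpha>1 \<circ> inv_into hartogs hartogs_map;
            a2 = \<alpha>2 \<circ> inv_into hartogs hartogs_map;
            f1 = (\<lambda>w. cnj (snd w) * a1 w);
            f2 = (\<lambda>w. cnj (fst w) * a1 w + a2 w);
            v = T_op f1 f2 \<circ> hartogs_map
        in weak_dbar_solution hartogs v \<alpha>1 \<alpha>2 \<and>
           in_Lp p hartogs v \<and>
           Lp_norm p hartogs v \<le> C * Lp_norm p hartogs \<alpha>1))"
proof -
  \<comment> \<open>Adding 1 makes the constant visibly positive. It depends neither on the form nor
    on \<open>p\<close>.\<close>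
  define m where "m = enn2real kernel_mass + 1"
  have m: "0 < m" "kernel_mass \<le> ennreal m"
  proof -
    show "0 < m" by (simp add: m_def add_nonneg_pos)
    have "kernel_mass = ennreal (enn2real kernel_mass)" using kernel_mass_finite by simp
    also have "\<dots> \<le> ennreal m" by (rule ennreal_leI) (simp add: m_def)
    finally show "kernel_mass \<le> ennreal m" .
  qed
  show ?thesis
  proof (intro exI[of _ m] conjI allI impI m(1))
    fix \<alpha>1 \<alpha>2 :: "complex \<times> complex \<Rightarrow> complex"
    assume asm: "weakly_dbar_closed hartogs \<alpha>1 \<alpha>2 \<and>
       (AE z in lebesgue_on hartogs. cnj (fst z) * \<alpha>1 z + cnj (snd z) * \<alpha>2 z = 0) \<and>
       in_Lp p hartogs \<alpha>1"
    have H: "hartogs \<inter> space lebesgue \<in> sets lebesgue" by simp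
    have rel: "AE z in lborel. z \<in> hartogs \<longrightarrow> cnj (fst z) * \<alpha>1 z + cnj (snd z) * \<alpha>2 z = 0"
      using asm by (simp add: AE_restrict_space_iff[OF H] AE_completion_iff)
    have "(\<lambda>z. indicat_real hartogs z *\<^sub>R \<alpha>1 z) \<in> borel_measurable lebesgue"
      using asm borel_measurable_restrict_space_iff[OF H, of \<alpha>1] by (simp add: in_Lp_def)
    \<comment> \<open>\<open>in_Lp\<close> gives Lebesgue measurability; the argument runs on a
      Borel version.\<close>
    then obtain A0 where A0: "A0 \<in> borel_measurable lborel" "AE z in lborel. indicat_real hartogs z *\<^sub>R \<alpha>1 z = A0 z"
      using completion_ex_borel_measurable_complex by blast
    define A where "A z = indicat_real hartogs z *\<^sub>R A0 z" for z
    define A2 where "A2 z = - (cnj (fst z) / cnj (snd z)) * A z" for z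
    have Am [measurable]: "A \<in> borel_measurable borel"
      unfolding A_def using A0(1) by (intro borel_measurable_scaleR borel_measurable_indicator) auto
    have A2m [measurable]: "A2 \<in> borel_measurable borel" unfolding A2_def by measurable
    have As: "A z = 0" "A2 z = 0" if "z \<notin> hartogs" for z using that by (auto simp: A_def A2_def)
    have A1: "AE z in lborel. z \<in> hartogs \<longrightarrow> \<alpha>1 z = A z"
      using A0(2) by (auto elim!: eventually_mono simp: A_def)
    have A2: "AE z in lborel. z \<in> hartogs \<longrightarrow> \<alpha>2 z = A2 z"
      using A1 rel
    proof eventually_elim
      fix z assume 1: "z \<in> hartogs \<longrightarrow> \<alpha>1 z = A z" and 2: "z \<in> hartogs \<longrightarrow> cnj (fst z) * \<alpha>1 z + cnj (snd z) * \<alpha>2 z = 0"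
      show "z \<in> hartogs \<longrightarrow> \<alpha>2 z = A2 z"
      proof
        assume z: "z \<in> hartogs"
        then have "cnj (snd z) \<noteq> 0" using snd_hartogs_nonzero by simp
        moreover have "cnj (snd z) * \<alpha>2 z = - (cnj (fst z) * A z)" using 1 2 z by (simp add: eq_neg_iff_add_eq_0 add.commute)
        ultimately show "\<alpha>2 z = A2 z" by (simp add: A2_def field_simps)
      qed
    qed
    have Lp: "integrable lborel (\<lambda>z. norm (A z) powr p)"
      using asm in_Lp_iff_borel(1)[OF sets_hartogs(1) Am As(1) A1] by simp
    then have Lp_fin: "(\<integral>\<^sup>+z. ennreal (norm (A z) powr p) \<partial>lborel) < \<infinity>"
      by (simp add: integrable_iff_bounded)
    have A_int: "integrable lborel A"
      by (rule integrable_of_powr[OF assms Am sets_hartogs(1) emeasure_hartogs_finite As(1) Lp_fin])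
    have distr1: "regular_distr hartogs \<alpha>1 g = (LINT z|lborel. A z * g z)" if "continuous_on UNIV g" for g
      by (rule regular_distr_eq_lborel[OF sets_hartogs(1) Am _ A1 that]) (rule As(1))
    have distr2: "regular_distr hartogs \<alpha>2 g = (LINT z|lborel. A2 z * g z)" if "continuous_on UNIV g" for g
      by (rule regular_distr_eq_lborel[OF sets_hartogs(1) A2m _ A2 that]) (rule As(2))
    interpret radial_form A
    proof
      fix \<psi> assume \<psi>: "\<psi> \<in> test_functions hartogs"
      have "distr_dbar2 (regular_distr hartogs \<alpha>1) \<psi> = distr_dbar1 (regular_distr hartogs \<alpha>2) \<psi>"
        using asm \<psi> by (simp add: weakly_dbar_closed_def distr_eq_def)
      then show "(LINT z|lborel. A z * dbar2 \<psi> z) = (LINT z|lborel. - (cnj (fst z) / cnj (snd z)) * A z * dbar1 \<psi> z)"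
        unfolding distr_dbar1_def distr_dbar2_def distr1[OF dbar_test_function(2)[OF \<psi>]] distr2[OF dbar_test_function(1)[OF \<psi>]] A2_def
        by (simp only: neg_equal_iff_equal)
    qed (use As A_int in auto)
    define f1 where "f1 w = cnj (snd w) * (\<alpha>1 \<circ> inv_into hartogs hartogs_map) w" for w
    define f2 where "f2 w = cnj (fst w) * (\<alpha>1 \<circ> inv_into hartogs hartogs_map) w + (\<alpha>2 \<circ> inv_into hartogs hartogs_map) w" for w
    define u where "u = T_op f1 f2 \<circ> hartogs_map"
    have f1: "AE w in lborel. w \<in> disc_prod \<longrightarrow> f1 w = F w"
      using AE_twist[OF A1] by eventually_elim
        (simp add: f1_def F_def inv_hartogs_map_eq_twist snd_disc_prod_nonzero twist_in_hartogs_iff)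
    have f2: "AE w in lborel. w \<in> disc_prod \<longrightarrow> f2 w = 0"
      using AE_twist[OF A1] AE_twist[OF A2] by eventually_elim
        (simp add: f2_def A2_def inv_hartogs_map_eq_twist snd_disc_prod_nonzero twist_in_hartogs_iff, simp add: twist_def snd_disc_prod_nonzero)
    \<comment> \<open>\<open>u\<close> is the solution as stated and \<open>v\<close> its Borel
      model. Agreement almost everywhere suffices for distributions and norms.\<close>
    have uv: "AE z in lborel. z \<in> hartogs \<longrightarrow> u z = v z"
      using AE_hartogs_map[OF T_op_AE[OF f1 f2]] by eventually_elim
        (simp add: u_def v_def hartogs_map_in_disc_prod_iff snd_hartogs_nonzero)
    have v_le: "(\<integral>\<^sup>+z. ennreal (norm (v z) powr p) \<partial>lborel) \<le> ennreal (m powr p) * (\<integral>\<^sup>+z. ennreal (norm (A z) powr p) \<partial>lborel)"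
      by (rule v_Lp[OF assms m])
    also have "\<dots> < \<infinity>" using Lp_fin by (simp add: ennreal_mult_less_top)
    finally have v_fin: "(\<integral>\<^sup>+z. ennreal (norm (v z) powr p) \<partial>lborel) < \<infinity>" .
    then have v_int_p: "integrable lborel (\<lambda>z. norm (v z) powr p)"
      by (intro integrableI_bounded) auto
    have v_int: "integrable lborel v"
      by (rule integrable_of_powr[OF assms v_meas sets_hartogs(1) emeasure_hartogs_finite v_supp v_fin])
    have u_distr: "regular_distr hartogs u g = (LINT z|lborel. v z * g z)" if "continuous_on UNIV g" for g
      by (rule regular_distr_eq_lborel[OF sets_hartogs(1) v_meas v_supp uv that])
    have "loc_integrable hartogs u"
      unfolding loc_integrable_def
    proof (intro allI impI)
      fix K :: "(complex \<times> complex) set" assume K: "compact K \<and> K \<subseteq> hartogs"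
      then have "K \<in> sets borel" using borel_compact by blast
      then have "K \<in> sets lebesgue" by simp
      then show "set_integrable lebesgue K u"
        using K set_integral_lebesgue_eq_lborel(3)[OF sets_hartogs(1) v_meas v_supp uv v_int] set_integrable_subset by blast
    qed
    moreover have "distr_eq hartogs (distr_dbar1 (regular_distr hartogs u)) (regular_distr hartogs \<alpha>1)"
      "distr_eq hartogs (distr_dbar2 (regular_distr hartogs u)) (regular_distr hartogs \<alpha>2)"
      unfolding distr_eq_def
    proof safe
      fix \<psi> assume \<psi>: "\<psi> \<in> test_functions hartogs"
      then have c: "continuous_on UNIV \<psi>"
        using cont_diff_on_imp_continuous_on by (elim test_functionsE) blast
      show "distr_dbar1 (regular_distr hartogs u) \<psi> = regular_distr hartogs \<alpha>1 \<psi>"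
        unfolding distr_dbar1_def u_distr[OF dbar_test_function(1)[OF \<psi>]] distr1[OF c] v_dbar(1)[OF \<psi>] by simp
      show "distr_dbar2 (regular_distr hartogs u) \<psi> = regular_distr hartogs \<alpha>2 \<psi>"
        unfolding distr_dbar2_def u_distr[OF dbar_test_function(2)[OF \<psi>]] distr2[OF c] v_dbar(2)[OF \<psi>] A2_def by simp
    qed
    ultimately have sol: "weak_dbar_solution hartogs u \<alpha>1 \<alpha>2"
      using asm by (simp add: weak_dbar_solution_def weakly_dbar_closed_def)
    have u_Lp: "in_Lp p hartogs u"
      using in_Lp_iff_borel(1)[OF sets_hartogs(1) v_meas v_supp uv] v_int_p by simp
    have "ennreal (LINT z|lborel. norm (v z) powr p) \<le> ennreal (m powr p) * ennreal (LINT z|lborel. norm (A z) powr p)"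
      using v_le by (simp add: nn_integral_eq_integral[OF v_int_p] nn_integral_eq_integral[OF Lp])
    then have le: "(LINT z|lborel. norm (v z) powr p) \<le> m powr p * (LINT z|lborel. norm (A z) powr p)"
      by (simp add: ennreal_mult[symmetric] ennreal_le_iff)
    have norm_u: "Lp_norm p hartogs u = (LINT z|lborel. norm (v z) powr p) powr (1 / p)"
      by (rule in_Lp_iff_borel(2)[OF sets_hartogs(1) v_meas _ uv]) (rule v_supp)
    have norm_\<alpha>1: "Lp_norm p hartogs \<alpha>1 = (LINT z|lborel. norm (A z) powr p) powr (1 / p)"
      by (rule in_Lp_iff_borel(2)[OF sets_hartogs(1) Am _ A1]) (rule As(1))
    have "Lp_norm p hartogs u \<le> (m powr p * (LINT z|lborel. norm (A z) powr p)) powr (1 / p)"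
      unfolding norm_u
      using assms by (intro powr_mono2 le) auto
    also have "\<dots> = m * (LINT z|lborel. norm (A z) powr p) powr (1 / p)"
      using m(1) assms by (simp add: powr_mult powr_powr)
    also have "\<dots> = m * Lp_norm p hartogs \<alpha>1"
      unfolding norm_\<alpha>1 ..
    finally show "let a1 = \<alpha>1 \<circ> inv_into hartogs hartogs_map;
            a2 = \<alpha>2 \<circ> inv_into hartogs hartogs_map;
            f1 = (\<lambda>w. cnj (snd w) * a1 w);
            f2 = (\<lambda>w. cnj (fst w) * a1 w + a2 w);
            v = T_op f1 f2 \<circ> hartogs_map
        in weak_dbar_solution hartogs v \<alpha>1 \<alpha>2 \<and>
           in_Lp p hartogs v \<and>
           Lp_norm p hartogs v \<le> m * Lp_norm p hartogs \<alpha>1"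
      using sol u_Lp unfolding Let_def u_def f1_def[abs_def] f2_def[abs_def] by blast
  qed
qed

end
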